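(* Let $\alpha>0$, $\tau:=1/\alpha$ (so $0<\tau<\infty$), $k\ge2$ an integer, $1\le q<\infty$, and let $\mathcal I$ be a regular multilevel partition of $\mathbb R$. For any $f\in\dot B^{\alpha,k}_\tau(E,q)$ there exists a polynomial $P\in\Pi_k$ such that $f-P\in\mathrm{VMO}$ and $$f-P=\sum_{m\in\mathbb Z}\sum_{Q\in\mathcal Q_m}b_{Q,q}(f)\,\varphi_Q,$$ where the convergence is unconditional in $\mathrm{BMO}$. Furthermore, $$\Big(\sum_{Q\in\mathcal Q}|b_{Q,q}(f)|^\tau\Big)^{1/\tau}\le c\,\|f\|_{\dot B^{\alpha,k}_\tau(E,q)},$$ with a constant $c>0$ independent of $f$.
   Context: All functions are complex-valued. $\Pi_k$ is the set of univariate algebraic polynomials of degree at most $k-1$. BMO and VMO: $\|f\|_{\mathrm{BMO}}:=\sup_J \frac1{|J|}\int_J|f-\mathrm{Avg}_J f|\,dx$ over all compact intervals $J\subset\mathbb R$, with $\mathrm{Avg}_Jf=\frac1{|J|}\int_J f$. $\mathrm{BMO}$ is the set of $f\in L^1_{loc}(\mathbb R)$ with $\|f\|_{\mathrm{BMO}}<\infty$, functions differing by a constant being identified; $\mathrm{VMO}$ is the closure in the BMO norm of the set $C_0(\mathbb R)$ of continuous compactly supported functions. Regular multilevel partition: $\mathcal I=\bigcup_{m\in\mathbb Z}\mathcal I_m$, where (a) each $\mathcal I_m$ is a partition of $\mathbb R$ into compact intervals with disjoint interiors, $\mathcal I_m=\{[x_{m,j},x_{m,j+1}]:j\in\mathbb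 Z\}$ with $\cdots<x_{m,-1}<x_{m,0}<x_{m,1}<\cdots$; (b) $\mathcal I_{m+1}$ refines $\mathcal I_m$ and each $I\in\mathcal I_m$ has at least two and at most $M_0$ children in $\mathcal I_{m+1}$, $M_0\ge2$ a constant; (c) there is a constant $\lambda\ge1$ with $|I'|\le\lambda|I''|$ for all $I',I''\in\mathcal I_m$, $m\in\mathbb Z$. B-splines: $\mathcal Q_m:=\{[x_{m,j},x_{m,j+k}]:j\in\mathbb Z\}$, $\mathcal Q:=\bigcup_m\mathcal Q_m$ (elements are indexed together with their level). For $Q=[x_{m,j},x_{m,j+k}]\in\mathcal Q_m$, $\varphi_Q$ is the B-spline of degree $k-1$ with knots $x_{m,j},\dots,x_{m,j+k}$, normalized so that the B-splines of each level sum to $1$; its support is $Q$. $\{\varphi_Q:Q\in\mathcal Q_m\}$ is a basis of the space $\mathcal S_m^k$ of $C^{k-2}$ piecewise polynomials of degree $k-1$ over $\mathcal I_m$ (every element is a unique, locally finite, combination of them). Besov space: for $I=[x_{m,j},x_{m,j+1}]\in\mathcal I_m$ set $\Omega_I:=[x_{m,j+1-k},x_{m,j+k}]$. For a compact interval $J$, $E_k(f,J)_q:=\inf_{R\in\Pi_k}\|f-R\|_{L^q(J)}$ and $\omega_k(f,J)_q:=\sup_{h\in\mathbb R}\|\Delta_h^k(f,\cdot,J)\|_{L^q(J)}$, where $\Delta_h^k(f,x,J)=\sum_{i=0}^k(-1)^{k+i}\binom ki f(x+ih)$ if $[x,x+kh]\subset J$ and $0$ otherwise. $\dot B^{\alpha,k}_\tau(E,q)$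 is the set of $f\in L^q_{loc}(\mathbb R)$ with $\|f\|_{\dot B^{\alpha,k}_\tau(E,q)}:=\big(\sum_{I\in\mathcal I}(|I|^{-1/q}\omega_k(f,\Omega_I)_q)^\tau\big)^{1/\tau}<\infty$ (equivalently with $E_k$ in place of $\omega_k$). Quasi-interpolant and coefficients $b_{Q,q}$: for each compact interval $J$ let $P_{J,q}:L^q(J)\to\Pi_k$ be a fixed linear projector with $\|f-P_{J,q}(f)\|_{L^q(J)}\le A\,E_k(f,J)_q$ for all $f\in L^q(J)$, with $A\ge1$ independent of $J$ and $f$. Put $\mathscr P_{m,q}(f):=\sum_{I\in\mathcal I_m}\mathbb 1_I P_{I,q}(f)$. For a piecewise polynomial $S$ of degree $k-1$ over $\mathcal I_m$ (possibly discontinuous) let $T_m(S):=\sum_{Q\in\mathcal Q_m}\beta_Q(S)\varphi_Q$, where for $Q=[x_{m,j},x_{m,j+k}]$, $\beta_Q(S):=\sum_{\nu=0}^{k-1}(-1)^\nu\varpi_Q^{(k-\nu-1)}(\xi_Q)S^{(\nu)}(\xi_Q)$, $\varpi_Q(x):=\frac1{(k-1)!}\prod_{\nu=j+1}^{j+k-1}(x-x_{m,\nu})$, and $\xi_Q$ is any point in the interior of an interval of $\mathcal I_m$ contained in $Q$ which is fixed once and for all for each $Q$ (the value does not depend on the point within that interval). Put $T_{m,q}(f):=T_m(\mathscr P_{m,q}(f))$ for $f\in L^q_{loc}(\mathbb R)$. The coefficients $b_{Q,q}(f)$, $Q\in\mathcal Q_m$, are defined uniquely by $T_{m,q}(f)-T_{m-1,q}(f)=\sum_{Q\in\mathcal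 Q_m}b_{Q,q}(f)\varphi_Q$. *)

theory Defs
  imports "HOL-Analysis.Analysis" "HOL-Computational_Algebra.Polynomial"
begin

text \<open>
  A multilevel partition is given by its knots: \<open>x m j\<close> is the \<open>j\<close>-th knot of level \<open>m\<close>. The
  intervals of the partition and the supports of the B-splines are both indexed by pairs \<open>(m, j)\<close>,
  namely \<open>I = [x m j, x m (j + 1)]\<close> and \<open>Q = [x m j, x m (j + k)]\<close>.
\<close>

definition regular_multilevel_partition :: "nat \<Rightarrow> real \<Rightarrow> (int \<Rightarrow> int \<Rightarrow> real) \<Rightarrow> bool" where
  "regular_multilevel_partition M0 lam x \<longleftrightarrow>
     M0 \<ge> 2 \<and> lam \<ge> 1 \<and>
     (\<forall>m. strict_mono (x m) \<and> (\<Union>j. {x m j..x m (j + 1)}) = UNIV) \<and>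
     (\<forall>m i. \<exists>j. {x (m + 1) i..x (m + 1) (i + 1)} \<subseteq> {x m j..x m (j + 1)}) \<and>
     (\<forall>m j. card {i. {x (m + 1) i..x (m + 1) (i + 1)} \<subseteq> {x m j..x m (j + 1)}} \<in> {2..M0}) \<and>
     (\<forall>m i j. x m (i + 1) - x m i \<le> lam * (x m (j + 1) - x m j))"

subsection \<open>Local \<open>L\<^sup>q\<close> spaces, approximation by polynomials and moduli of smoothness\<close>

definition Lq_on :: "real \<Rightarrow> real set \<Rightarrow> (real \<Rightarrow> complex) \<Rightarrow> bool" where
  "Lq_on q J f \<longleftrightarrow>
     set_borel_measurable lebesgue J f \<and> set_integrable lebesgue J (\<lambda>t. norm (f t) powr q)"

definition Lq_loc :: "real \<Rightarrow> (real \<Rightarrow> complex) \<Rightarrow> bool" where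
  "Lq_loc q f \<longleftrightarrow> (\<forall>a b. Lq_on q {a..b} f)"

definition Lq_norm :: "real \<Rightarrow> real set \<Rightarrow> (real \<Rightarrow> complex) \<Rightarrow> real" where
  "Lq_norm q J f = (LINT t:J|lebesgue. norm (f t) powr q) powr (1 / q)"

definition Pi_poly :: "nat \<Rightarrow> complex poly set" where
  "Pi_poly k = {R. degree R \<le> k - 1}"

definition poly_real :: "complex poly \<Rightarrow> real \<Rightarrow> complex" where
  "poly_real R t = poly R (of_real t)"

definition best_approx :: "nat \<Rightarrow> real \<Rightarrow> real set \<Rightarrow> (real \<Rightarrow> complex) \<Rightarrow> real" where
  "best_approx k q J f = (INF R\<in>Pi_poly k. Lq_norm q J (\<lambda>t. f t - poly_real R t))"

text \<open>The step \<open>h\<close> may be negative, hence \<open>closed_segment\<close> rather than an interval.\<close>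

definition diff_op :: "nat \<Rightarrow> real \<Rightarrow> real set \<Rightarrow> (real \<Rightarrow> complex) \<Rightarrow> real \<Rightarrow> complex" where
  "diff_op k h J f t =
     (if closed_segment t (t + real k * h) \<subseteq> J
      then \<Sum>i\<le>k. (-1) ^ (k + i) * of_nat (k choose i) * f (t + real i * h) else 0)"

definition modulus :: "nat \<Rightarrow> real \<Rightarrow> real set \<Rightarrow> (real \<Rightarrow> complex) \<Rightarrow> real" where
  "modulus k q J f = (SUP h. Lq_norm q J (diff_op k h J f))"

subsection \<open>The Besov space\<close>

text \<open>
  \<open>besov_local x k q f (m, j)\<close> is the local quantity attached to \<open>I = [x m j, x m (j + 1)]\<close>, with
  the enlarged interval \<open>[x m (j + 1 - k), x m (j + k)]\<close>. Every interval of a regular multilevel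
  partition belongs to exactly one level, so summing over all pairs \<open>(m, j)\<close> is summing over all
  intervals.
\<close>

definition besov_local ::
    "(int \<Rightarrow> int \<Rightarrow> real) \<Rightarrow> nat \<Rightarrow> real \<Rightarrow> (real \<Rightarrow> complex) \<Rightarrow> int \<times> int \<Rightarrow> real" where
  "besov_local x k q f = (\<lambda>(m, j).
     (x m (j + 1) - x m j) powr (- 1 / q) * modulus k q {x m (j + 1 - int k)..x m (j + int k)} f)"

definition besov_space ::
    "(int \<Rightarrow> int \<Rightarrow> real) \<Rightarrow> nat \<Rightarrow> real \<Rightarrow> real \<Rightarrow> (real \<Rightarrow> complex) set" where
  "besov_space x k q \<tau> = {f. Lq_loc q f \<and> (\<lambda>I. besov_local x k q f I powr \<tau>) summable_on UNIV}"

definition besov_norm ::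
    "(int \<Rightarrow> int \<Rightarrow> real) \<Rightarrow> nat \<Rightarrow> real \<Rightarrow> real \<Rightarrow> (real \<Rightarrow> complex) \<Rightarrow> real" where
  "besov_norm x k q \<tau> f = (\<Sum>\<^sub>\<infinity>I\<in>UNIV. besov_local x k q f I powr \<tau>) powr (1 / \<tau>)"

subsection \<open>BMO and VMO\<close>

text \<open>
  The BMO norm takes values in \<open>ennreal\<close> and vanishes on constants; statements about elements of
  BMO (functions modulo constants) are expressed for representatives by means of this seminorm.
\<close>

definition average :: "real \<Rightarrow> real \<Rightarrow> (real \<Rightarrow> complex) \<Rightarrow> complex" where
  "average a b f = (1 / (b - a)) *\<^sub>R (LINT t:{a..b}|lebesgue. f t)"

definition bmo_norm :: "(real \<Rightarrow> complex) \<Rightarrow> ennreal" where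
  "bmo_norm f =
     (SUP (a, b)\<in>{(a, b). a < b}.
        ennreal (1 / (b - a) * (LINT t:{a..b}|lebesgue. norm (f t - average a b f))))"

definition BMO :: "(real \<Rightarrow> complex) set" where
  "BMO = {f. Lq_loc 1 f \<and> bmo_norm f < \<infinity>}"

definition C0 :: "(real \<Rightarrow> complex) set" where
  "C0 = {g. continuous_on UNIV g \<and> compact (closure {t. g t \<noteq> 0})}"

definition VMO :: "(real \<Rightarrow> complex) set" where
  "VMO = {f\<in>BMO. \<forall>\<epsilon>>0. \<exists>g\<in>C0. bmo_norm (\<lambda>t. f t - g t) < \<epsilon>}"

text \<open>
  Unconditional convergence in BMO: convergence of the net of finite partial sums, as in
  \<open>has_sum\<close>.
\<close>

definition has_sum_BMO :: "('i \<Rightarrow> real \<Rightarrow> complex) \<Rightarrow> (real \<Rightarrow> complex) \<Rightarrow> bool" where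
  "has_sum_BMO g s \<longleftrightarrow> s \<in> BMO \<and> (\<forall>i. g i \<in> BMO) \<and>
     ((\<lambda>F. bmo_norm (\<lambda>t. s t - (\<Sum>i\<in>F. g i t))) \<longlongrightarrow> 0) (finite_subsets_at_top UNIV)"

subsection \<open>B-splines\<close>

text \<open>
  \<open>bspline y d j\<close> is the B-spline of degree \<open>d\<close> with knots \<open>y j, \<dots>, y (j + d + 1)\<close>, given by the
  Cox--de Boor recursion, which produces the normalization \<open>\<Sum>j. bspline y d j t = 1\<close>.
\<close>

primrec bspline :: "(int \<Rightarrow> real) \<Rightarrow> nat \<Rightarrow> int \<Rightarrow> real \<Rightarrow> real" where
  "bspline y 0 j t = (if y j \<le> t \<and> t < y (j + 1) then 1 else 0)"
| "bspline y (Suc d) j t =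
     (t - y j) / (y (j + int d + 1) - y j) * bspline y d j t +
     (y (j + int d + 2) - t) / (y (j + int d + 2) - y (j + 1)) * bspline y d (j + 1) t"

text \<open>The locally finite sum \<open>\<Sum>j. c j * \<phi>\<^sub>Q\<close> over the B-splines of degree \<open>k - 1\<close> of one level.\<close>

definition spline_sum :: "(int \<Rightarrow> real) \<Rightarrow> nat \<Rightarrow> (int \<Rightarrow> complex) \<Rightarrow> real \<Rightarrow> complex" where
  "spline_sum y k c t =
     (\<Sum>j | bspline y (k - 1) j t \<noteq> 0. c j * of_real (bspline y (k - 1) j t))"

subsection \<open>The quasi-interpolant\<close>

text \<open>
  \<open>P a b\<close> is a linear projector of \<open>L\<^sup>q([a, b])\<close> onto the polynomials of degree at most \<open>k - 1\<close>;
  the congruence condition says that it acts on almost-everywhere classes of functions on \<open>[a, b]\<close>.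
\<close>

definition near_best_projectors ::
    "nat \<Rightarrow> real \<Rightarrow> real \<Rightarrow> (real \<Rightarrow> real \<Rightarrow> (real \<Rightarrow> complex) \<Rightarrow> complex poly) \<Rightarrow> bool" where
  "near_best_projectors k q A P \<longleftrightarrow> A \<ge> 1 \<and>
     (\<forall>a b. a < b \<longrightarrow>
       (\<forall>f. Lq_on q {a..b} f \<longrightarrow> P a b f \<in> Pi_poly k) \<and>
       (\<forall>f g. Lq_on q {a..b} f \<and> Lq_on q {a..b} g \<and> (AE t in lebesgue. t \<in> {a..b} \<longrightarrow> f t = g t) \<longrightarrow>
          P a b f = P a b g) \<and>
       (\<forall>f g. Lq_on q {a..b} f \<and> Lq_on q {a..b} g \<longrightarrow>
          P a b (\<lambda>t. f t + g t) = P a b f + P a b g) \<and>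
       (\<forall>c f. Lq_on q {a..b} f \<longrightarrow> P a b (\<lambda>t. c * f t) = smult c (P a b f)) \<and>
       (\<forall>R\<in>Pi_poly k. P a b (poly_real R) = R) \<and>
       (\<forall>f. Lq_on q {a..b} f \<longrightarrow>
          Lq_norm q {a..b} (\<lambda>t. f t - poly_real (P a b f) t) \<le> A * best_approx k q {a..b} f))"

text \<open>
  At a knot two (closed) intervals overlap and both pieces are added up; these values are
  never used.
\<close>

definition piecewise_proj ::
    "(real \<Rightarrow> real \<Rightarrow> (real \<Rightarrow> complex) \<Rightarrow> complex poly) \<Rightarrow> (int \<Rightarrow> real) \<Rightarrow> (real \<Rightarrow> complex) \<Rightarrow>
       real \<Rightarrow> complex" where
  "piecewise_proj P y f t = (\<Sum>j | t \<in> {y j..y (j + 1)}. poly_real (P (y j) (y (j + 1)) f) t)"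

definition admissible_points :: "nat \<Rightarrow> (int \<Rightarrow> int \<Rightarrow> real) \<Rightarrow> (int \<Rightarrow> int \<Rightarrow> real) \<Rightarrow> bool" where
  "admissible_points k x \<xi> \<longleftrightarrow>
     (\<forall>m j. \<exists>i\<in>{j..<j + int k}. \<xi> m j \<in> {x m i<..<x m (i + 1)})"

definition varpi :: "nat \<Rightarrow> (int \<Rightarrow> real) \<Rightarrow> int \<Rightarrow> real poly" where
  "varpi k y j = smult (1 / fact (k - 1)) (\<Prod>i\<in>{j + 1..j + int k - 1}. [:- y i, 1:])"

definition nth_deriv :: "nat \<Rightarrow> (real \<Rightarrow> complex) \<Rightarrow> real \<Rightarrow> complex" where
  "nth_deriv n S = ((\<lambda>g t. vector_derivative g (at t)) ^^ n) S"

definition beta_coeff ::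
    "nat \<Rightarrow> (int \<Rightarrow> real) \<Rightarrow> (int \<Rightarrow> real) \<Rightarrow> (real \<Rightarrow> complex) \<Rightarrow> int \<Rightarrow> complex" where
  "beta_coeff k y \<zeta> S j =
     (\<Sum>\<nu><k. (-1) ^ \<nu> * of_real (poly ((pderiv ^^ (k - \<nu> - 1)) (varpi k y j)) (\<zeta> j)) *
        nth_deriv \<nu> S (\<zeta> j))"

definition quasi_interpolant ::
    "nat \<Rightarrow> (real \<Rightarrow> real \<Rightarrow> (real \<Rightarrow> complex) \<Rightarrow> complex poly) \<Rightarrow> (int \<Rightarrow> int \<Rightarrow> real) \<Rightarrow>
       (int \<Rightarrow> int \<Rightarrow> real) \<Rightarrow> int \<Rightarrow> (real \<Rightarrow> complex) \<Rightarrow> real \<Rightarrow> complex" where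
  "quasi_interpolant k P x \<xi> m f =
     spline_sum (x m) k (beta_coeff k (x m) (\<xi> m) (piecewise_proj P (x m) f))"

definition b_coeff ::
    "nat \<Rightarrow> (real \<Rightarrow> real \<Rightarrow> (real \<Rightarrow> complex) \<Rightarrow> complex poly) \<Rightarrow> (int \<Rightarrow> int \<Rightarrow> real) \<Rightarrow>
       (int \<Rightarrow> int \<Rightarrow> real) \<Rightarrow> (real \<Rightarrow> complex) \<Rightarrow> int \<Rightarrow> int \<Rightarrow> complex" where
  "b_coeff k P x \<xi> f m =
     (THE b. \<forall>t. quasi_interpolant k P x \<xi> m f t - quasi_interpolant k P x \<xi> (m - 1) f t =
                 spline_sum (x m) k b t)"

end

theory Submission
  imports Defs
begin

text \<open>
  Whitney's inequality provides, for each interval \<open>I\<close> of level \<open>m\<close>, a polynomial \<open>R\<^sub>I\<close> whose mean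
  distance from \<open>f\<close> on the enlarged interval \<open>\<Omega>\<^sub>I\<close> is at most a multiple of the local Besov quantity
  \<open>W\<^sub>I\<close>. Since the quasi-interpolant reproduces \<open>R\<^sub>I\<close> and is locally bounded, \<open>T\<^sub>m f - R\<^sub>I\<close> is \<open>O(W\<^sub>I)\<close> on
  \<open>I\<close>; by stability of the B-spline basis, \<open>b\<^sub>Q\<close> is bounded by \<open>W\<^sub>I\<close> and \<open>W\<^sub>J\<close>, where \<open>J\<close> is the parent
  of some interval \<open>I\<close> in \<open>Q\<close>. An interval has at most \<open>M0\<close> children, which gives the \<open>\<ell>\<^sup>\<tau>\<close> estimate.

  A finite sum of splines of distinct levels whose coefficients at each level have \<open>\<ell>\<^sup>p\<close> norm at most
  \<open>B\<close> (with \<open>p = max \<tau> 1\<close>) has BMO norm \<open>O(B)\<close>: on an interval \<open>J\<close>, the levels coarser than \<open>J\<close> are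
  controlled by their Lipschitz constants and the finer ones by their \<open>L\<^sup>1\<close> norms. Applied to the
  coefficients outside a large finite set, this gives unconditional convergence. The limit is
  identified from \<open>T\<^sub>m f \<longrightarrow> f\<close> in \<open>L\<^sup>1\<close> on compact intervals as \<open>m \<longrightarrow> \<infinity>\<close> and from the convergence of
  \<open>T\<^sub>m f\<close>, modulo constants, to a polynomial \<open>P\<close> as \<open>m \<longrightarrow> -\<infinity>\<close>.

  Whitney's inequality is proved by averaging \<open>\<Delta>\<^sup>k\<^sub>h f\<close> over the step \<open>h\<close> with the Peano kernel of the
  \<open>k\<close>-th difference as weight: this expresses \<open>f\<close> by averaged differences and by convolutions of
  finitely many \<open>\<Delta>\<^sup>k\<^sub>u f\<close> with a truncated power, and each such convolution is a polynomial plus a small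
  function.
\<close>

text \<open>Constants must not depend on the knots. Every size of a polynomial is therefore compared
  with its mean modulus over one knot interval, an affinely invariant quantity, and Marsden's
  identity makes the coefficients of a spline computable from a single polynomial piece. Convergence
  can only hold modulo constants: at coarse levels the constant terms of the local polynomials need
  not settle, so a sequence of constants is subtracted there, which the BMO seminorm does not see.
  The exponent is \<open>max \<tau> 1\<close> because Hoelder's inequality wants an exponent at
  least 1, while for \<tau> < 1 the given bound is the stronger one. The oscillation estimate splits
  into geometric sums because at least two children per interval make the mesh at least halve at
  each level. In Whitney's inequality the function is extended by zero. Differences with base point
  left of the interval are then uncontrolled, but there the truncated power is a genuine polynomial
  in \<open>x\<close>, so they only influence the approximating polynomial. Nonnegative steps reach
  the left two thirds of the interval; the rest follows by reflection.\<close>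

lemma higher_pderiv_shift:
  fixes p :: "'a :: {idom,semiring_char_0} poly"
  shows "poly ((pderiv ^^ n) p) s = fact n * coeff (p \<circ>\<^sub>p [:s, 1:]) n"
proof -
  have shift: "(pderiv ^^ n) p \<circ>\<^sub>p [:s, 1:] = (pderiv ^^ n) (p \<circ>\<^sub>p [:s, 1:])" for n
  proof (induction n)
    case (Suc n)
    have "(pderiv ^^ Suc n) p \<circ>\<^sub>p [:s, 1:] = pderiv ((pderiv ^^ n) p \<circ>\<^sub>p [:s, 1:])"
      by (simp add: pderiv_pcompose pderiv_pCons)
    then show ?case by (simp add: Suc)
  qed simp
  have "poly ((pderiv ^^ n) p) s = poly ((pderiv ^^ n) p \<circ>\<^sub>p [:s, 1:]) 0"
    by (simp add: poly_pcompose)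
  also have "\<dots> = coeff ((pderiv ^^ n) (p \<circ>\<^sub>p [:s, 1:])) 0"
    by (simp add: shift poly_0_coeff_0)
  also have "\<dots> = fact n * coeff (p \<circ>\<^sub>p [:s, 1:]) n"
    by (simp add: coeff_higher_pderiv pochhammer_fact)
  finally show ?thesis .
qed

lemma poly_eq_sum_coeff:
  fixes p :: "'a :: comm_semiring_1 poly"
  assumes "degree p \<le> d"
  shows "poly p z = (\<Sum>i\<le>d. coeff p i * z ^ i)"
proof -
  have "(\<Sum>i\<le>d. coeff p i * z ^ i) = (\<Sum>i\<le>degree p. coeff p i * z ^ i)"
    using assms by (intro sum.mono_neutral_right) (auto simp: coeff_eq_0)
  then show ?thesis by (simp add: poly_altdef)
qed

lemma poly_taylor:
  fixes p :: "'a :: field_char_0 poly"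
  assumes "degree p \<le> d"
  shows "poly p z = (\<Sum>\<nu>\<le>d. poly ((pderiv ^^ \<nu>) p) s * ((z - s) ^ \<nu> / fact \<nu>))"
proof -
  have "poly p z = poly (p \<circ>\<^sub>p [:s, 1:]) (z - s)"
    by (simp add: poly_pcompose)
  also have "\<dots> = (\<Sum>\<nu>\<le>d. coeff (p \<circ>\<^sub>p [:s, 1:]) \<nu> * (z - s) ^ \<nu>)"
    using assms by (intro poly_eq_sum_coeff) (simp add: degree_pcompose)
  finally show ?thesis
    by (simp add: higher_pderiv_shift)
qed

lemma coeff_prod_linear_of_real:
  assumes "finite A"
  shows "coeff (\<Prod>i\<in>A. [:complex_of_real (u i), 1:]) n = of_real (coeff (\<Prod>i\<in>A. [:u i, 1:]) n)"
  using assms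
proof (induction arbitrary: n rule: finite_induct)
  case empty
  then show ?case by (cases n) auto
next
  case (insert a A)
  then show ?case
    by (cases n) (auto simp: algebra_simps)
qed

subsection \<open>B-splines on a single knot interval\<close>

text \<open>The polynomial with which the B-spline \<open>j\<close> of degree \<open>d\<close>
  coincides on the knot interval \<open>J\<close>. Running the Cox--de Boor recursion on polynomials
  makes coefficients, derivatives and linear algebra available.\<close>

primrec bpiece :: "(int \<Rightarrow> real) \<Rightarrow> nat \<Rightarrow> int \<Rightarrow> int \<Rightarrow> complex poly" where
  "bpiece y 0 j J = (if j = J then 1 else 0)"
| "bpiece y (Suc d) j J =
     smult (of_real (1 / (y (j + int d + 1) - y j))) ([:- of_real (y j), 1:] * bpiece y d j J) +
     smult (of_real (1 / (y (j + int d + 2) - y (j + 1))))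
       ([:of_real (y (j + int d + 2)), -1:] * bpiece y d (j + 1) J)"

lemma bpiece_outside: "j > J \<or> j + int d < J \<Longrightarrow> bpiece y d j J = 0"
  by (induction d arbitrary: j) auto

lemma bpiece_degree: "degree (bpiece y d j J) \<le> d"
proof (induction d arbitrary: j)
  case (Suc d)
  have *: "degree (smult u ([:a, b:] * bpiece y d i J)) \<le> Suc d" for u a b i
    using degree_smult_le[of u "[:a, b:] * bpiece y d i J"]
      degree_mult_le[of "[:a, b:]" "bpiece y d i J"] Suc[of i] by (auto split: if_splits)
  show ?case
    unfolding bpiece.simps by (intro degree_add_le *)
qed simp

text \<open>On the first interval of the support only the left term of the recursion survives. The
  resulting power of the knot factor is the shape that every jump of a spline across
  \<open>y J\<close> takes.\<close>

lemma bpiece_first: "\<exists>c. bpiece y d J J = smult c ([:- of_real (y J), 1:] ^ d)"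
proof (induction d)
  case (Suc d)
  then obtain c where "bpiece y d J J = smult c ([:- of_real (y J), 1:] ^ d)" by blast
  then have "bpiece y (Suc d) J J =
      smult (of_real (1 / (y (J + int d + 1) - y J)) * c) ([:- of_real (y J), 1:] ^ Suc d)"
    by (simp add: bpiece_outside)
  then show ?case by blast
qed (auto intro: exI[of _ 1])

lemma bspline_eq_bpiece:
  assumes "strict_mono y" "y J \<le> t" "t < y (J + 1)"
  shows "of_real (bspline y d j t) = poly (bpiece y d j J) (of_real t)"
proof (induction d arbitrary: j)
  case 0
  have "y j \<le> t \<and> t < y (j + 1) \<longleftrightarrow> j = J"
  proof
    assume a: "y j \<le> t \<and> t < y (j + 1)"
    have "y j < y (J + 1)" "y J < y (j + 1)" using a assms by auto
    then show "j = J" using assms(1) by (simp add: strict_mono_less)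
  qed (use assms in auto)
  then show ?case by simp
next
  case (Suc d)
  then show ?case
    by (simp add: field_simps diff_divide_distrib flip: Suc)
qed

text \<open>Marsden's identity, as an identity of polynomials in complex \<open>z\<close> and
  \<open>w\<close>. In the induction each piece of degree \<open>d\<close> feeds two pieces of the
  next degree, and the two weighted products recombine because
  \<open>(z - a) * (b - w) + (b - z) * (a - w) = (z - w) * (b - a)\<close>.\<close>

lemma marsden:
  assumes "strict_mono y"
  shows "(\<Sum>j\<in>{J - int d..J}. poly (bpiece y d j J) z * (\<Prod>i\<in>{j + 1..j + int d}. of_real (y i) - w))
           = (z - w) ^ d"
proof (induction d)
  case 0
  then show ?case by simp
next
  case (Suc d)
  let ?B = "\<lambda>j. poly (bpiece y d j J) z"
  let ?psi = "\<lambda>j. \<Prod>i\<in>{j + 1..j + int d}. complex_of_real (y i) - w"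
  let ?psi' = "\<lambda>j. \<Prod>i\<in>{j + 1..j + int (Suc d)}. complex_of_real (y i) - w"
  let ?D = "\<lambda>j. complex_of_real (y (j + int d + 1) - y j)"
  have D: "?D j \<noteq> 0" for j
    using strict_monoD[OF assms, of j "j + int d + 1"] by (simp only: of_real_eq_0_iff) simp
  have psi1: "?psi' j = ?psi j * (of_real (y (j + int d + 1)) - w)" for j
  proof -
    have "{j + 1..j + int (Suc d)} = insert (j + int d + 1) {j + 1..j + int d}" by auto
    then show ?thesis by (simp add: mult.commute)
  qed
  have psi2: "?psi' (j - 1) = ?psi j * (of_real (y j) - w)" for j
  proof -
    have "{j - 1 + 1..j - 1 + int (Suc d)} = insert j {j + 1..j + int d}" by auto
    then show ?thesis by (simp add: mult.commute)
  qed
  \<comment> \<open>The contributions of piece \<open>j\<close> to the pieces \<open>j\<close> and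
    \<open>j - 1\<close> of the next degree, times the products belonging to those; hence the
    recursion reads \<open>F j + G (j + 1)\<close>.\<close>
  define F where "F j = (z - of_real (y j)) / ?D j * ?B j * ?psi' j" for j
  define G where "G j = (of_real (y (j + int d + 1)) - z) / ?D j * ?B j * ?psi' (j - 1)" for j
  have FG: "F j + G j = ?B j * ?psi j * (z - w)" for j
  proof -
    have "F j + G j = ?B j * ?psi j * (((z - of_real (y j)) * (of_real (y (j + int d + 1)) - w)
        + (of_real (y (j + int d + 1)) - z) * (of_real (y j) - w)) / ?D j)"
      unfolding F_def G_def psi1[of j] psi2[of j] by (simp add: algebra_simps add_divide_distrib diff_divide_distrib)
    also have "((z - of_real (y j)) * (of_real (y (j + int d + 1)) - w)
        + (of_real (y (j + int d + 1)) - z) * (of_real (y j) - w)) = (z - w) * ?D j"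
      by (simp add: algebra_simps)
    finally show ?thesis using D[of j] by simp
  qed
  have F0: "F j = 0" and G0: "G j = 0" if "j > J \<or> j + int d < J" for j
    using that by (simp_all add: F_def G_def bpiece_outside)
  have "(\<Sum>j\<in>{J - int (Suc d)..J}. poly (bpiece y (Suc d) j J) z * ?psi' j)
      = (\<Sum>j\<in>{J - int (Suc d)..J}. F j + G (j + 1))"
    by (intro sum.cong refl) (simp add: F_def G_def algebra_simps add_divide_distrib diff_divide_distrib)
  also have "\<dots> = (\<Sum>j\<in>{J - int (Suc d)..J}. F j) + (\<Sum>j\<in>{J - int (Suc d)..J}. G (j + 1))"
    by (rule sum.distrib)
  also have "(\<Sum>j\<in>{J - int (Suc d)..J}. F j) = (\<Sum>j\<in>{J - int d..J}. F j)"
    by (intro sum.mono_neutral_right) (auto simp: F0)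
  also have "(\<Sum>j\<in>{J - int (Suc d)..J}. G (j + 1)) = (\<Sum>j\<in>{J - int d..J + 1}. G j)"
    by (intro sum.reindex_bij_witness[of _ "\<lambda>j. j - 1" "\<lambda>j. j + 1"]) auto
  also have "\<dots> = (\<Sum>j\<in>{J - int d..J}. G j)"
    by (intro sum.mono_neutral_right) (auto simp: G0)
  also have "(\<Sum>j\<in>{J - int d..J}. F j) + (\<Sum>j\<in>{J - int d..J}. G j)
      = (\<Sum>j\<in>{J - int d..J}. ?B j * ?psi j * (z - w))"
    by (simp add: FG flip: sum.distrib)
  also have "\<dots> = (z - w) ^ Suc d"
    using Suc by (simp flip: sum_distrib_right)
  finally show ?case .
qed

text \<open>The de Boor--Fix functional \<open>\<beta>\<^sub>Q\<close>, applied to a polynomial.\<close>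

definition dbf :: "nat \<Rightarrow> (int \<Rightarrow> real) \<Rightarrow> int \<Rightarrow> complex poly \<Rightarrow> real \<Rightarrow> complex" where
  "dbf k y j R s = (\<Sum>\<nu><k. (-1) ^ \<nu> * of_real (poly ((pderiv ^^ (k - \<nu> - 1)) (varpi k y j)) s) *
     poly ((pderiv ^^ \<nu>) R) (of_real s))"

lemma dbf_add: "dbf k y j (R + S) s = dbf k y j R s + dbf k y j S s"
  by (simp add: dbf_def higher_pderiv_add algebra_simps sum.distrib)

lemma dbf_smult: "dbf k y j (smult c R) s = c * dbf k y j R s"
  by (simp add: dbf_def higher_pderiv_smult sum_distrib_left algebra_simps)

lemma dbf_diff: "dbf k y j (R - S) s = dbf k y j R s - dbf k y j S s"
proof -
  have "R - S = R + smult (-1) S" by simp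
  then show ?thesis by (simp only: dbf_add dbf_smult) simp
qed

lemma dbf_0 [simp]: "dbf k y j 0 s = 0"
  using dbf_smult[of k y j 0 0 s] by simp

lemma dbf_sum: "dbf k y j (\<Sum>i\<in>A. R i) s = (\<Sum>i\<in>A. dbf k y j (R i) s)"
  by (induction A rule: infinite_finite_induct) (simp_all add: dbf_add)

lemma varpi_derivative:
  "complex_of_real (poly ((pderiv ^^ n) (varpi (Suc d) y j)) s)
     = fact n / fact d * coeff (\<Prod>i\<in>{j + 1..j + int d}. [:of_real s - of_real (y i), 1:]) n"
proof -
  have "varpi (Suc d) y j \<circ>\<^sub>p [:s, 1:] = smult (1 / fact d) (\<Prod>i\<in>{j + 1..j + int d}. [:s - y i, 1:])"
    by (simp add: varpi_def pcompose_smult pcompose_prod pcompose_pCons)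
  then show ?thesis
    using coeff_prod_linear_of_real[of "{j + 1..j + int d}" "\<lambda>i. s - y i" n]
    by (simp add: higher_pderiv_shift)
qed

text \<open>With \<open>w = s + v\<close>, Marsden's identity is a polynomial identity in
  \<open>v\<close>, in which the products are, up to a constant factor, the Taylor expansions of
  \<open>varpi\<close> at \<open>s\<close>. This is its coefficient of order
  \<open>d - \<nu>\<close>.\<close>

lemma marsden_derivative:
  assumes "strict_mono y" "\<nu> \<le> d"
  shows "(\<Sum>j\<in>{J - int d..J}. poly (bpiece y d j J) z *
            of_real (poly ((pderiv ^^ (d - \<nu>)) (varpi (Suc d) y j)) s))
         = (of_real s - z) ^ \<nu> / fact \<nu>"
proof -
  let ?P = "\<lambda>j. \<Prod>i\<in>{j + 1..j + int d}. [:complex_of_real s - of_real (y i), 1:]"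
  have "(\<Sum>j\<in>{J - int d..J}. smult (poly (bpiece y d j J) z) (?P j)) = [:of_real s - z, 1:] ^ d"
  proof (rule poly_ext)
    fix v
    have P: "poly (?P j) v = (-1) ^ d * (\<Prod>i\<in>{j + 1..j + int d}. of_real (y i) - (of_real s + v))" for j
    proof -
      have "poly (?P j) v = (\<Prod>i\<in>{j + 1..j + int d}. (-1) * (of_real (y i) - (of_real s + v)))"
        by (simp add: poly_prod algebra_simps)
      then show ?thesis by (simp only: prod.distrib) simp
    qed
    have "poly (\<Sum>j\<in>{J - int d..J}. smult (poly (bpiece y d j J) z) (?P j)) v
        = (-1) ^ d * (z - (of_real s + v)) ^ d"
      unfolding marsden[OF assms(1), of d J z "of_real s + v", symmetric]
      by (simp only: poly_sum poly_smult P sum_distrib_left mult_ac)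
    also have "\<dots> = (of_real s - z + v) ^ d"
      by (simp add: algebra_simps flip: power_mult_distrib)
    finally show "poly (\<Sum>j\<in>{J - int d..J}. smult (poly (bpiece y d j J) z) (?P j)) v
        = poly ([:of_real s - z, 1:] ^ d) v"
      by (simp add: poly_power)
  qed
  then have "coeff (\<Sum>j\<in>{J - int d..J}. smult (poly (bpiece y d j J) z) (?P j)) (d - \<nu>)
      = of_nat (d choose (d - \<nu>)) * (of_real s - z) ^ \<nu>"
    using assms(2) by (simp add: coeff_linear_poly_power)
  then have "(\<Sum>j\<in>{J - int d..J}. poly (bpiece y d j J) z * coeff (?P j) (d - \<nu>))
      = fact d / (fact \<nu> * fact (d - \<nu>)) * (of_real s - z) ^ \<nu>"
    using assms(2) by (simp add: coeff_sum binomial_fact mult.commute)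
  then have "fact (d - \<nu>) / fact d * (\<Sum>j\<in>{J - int d..J}. poly (bpiece y d j J) z * coeff (?P j) (d - \<nu>))
      = (of_real s - z) ^ \<nu> / fact \<nu>"
    by simp
  then show ?thesis
    by (simp add: varpi_derivative sum_distrib_left algebra_simps)
qed

text \<open>Taylor's formula for \<open>R\<close> at \<open>s\<close>, with every power of
  \<open>z - s\<close> replaced by its Marsden expansion; the signs in the functional turn
  \<open>s - z\<close> into \<open>z - s\<close>. One common \<open>s\<close> serves all
  \<open>j\<close> here.\<close>

lemma dbf_reproduces:
  assumes "strict_mono y" "degree R \<le> d"
  shows "(\<Sum>j\<in>{J - int d..J}. smult (dbf (Suc d) y j R s) (bpiece y d j J)) = R"
proof (rule poly_ext)
  fix z
  let ?v = "\<lambda>\<nu> j. complex_of_real (poly ((pderiv ^^ (d - \<nu>)) (varpi (Suc d) y j)) s)"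
  have "poly (\<Sum>j\<in>{J - int d..J}. smult (dbf (Suc d) y j R s) (bpiece y d j J)) z
      = (\<Sum>j\<in>{J - int d..J}. \<Sum>\<nu>\<le>d. (-1) ^ \<nu> * poly ((pderiv ^^ \<nu>) R) (of_real s) *
          (poly (bpiece y d j J) z * ?v \<nu> j))"
    by (simp add: poly_sum dbf_def lessThan_Suc_atMost sum_distrib_left sum_distrib_right mult_ac)
  also have "\<dots> = (\<Sum>\<nu>\<le>d. (-1) ^ \<nu> * poly ((pderiv ^^ \<nu>) R) (of_real s) *
          (\<Sum>j\<in>{J - int d..J}. poly (bpiece y d j J) z * ?v \<nu> j))"
    by (subst sum.swap) (simp add: sum_distrib_left)
  also have "\<dots> = (\<Sum>\<nu>\<le>d. poly ((pderiv ^^ \<nu>) R) (of_real s) * ((z - of_real s) ^ \<nu> / fact \<nu>))"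
  proof (intro sum.cong refl)
    fix \<nu> assume "\<nu> \<in> {..d}"
    then have "(\<Sum>j\<in>{J - int d..J}. poly (bpiece y d j J) z * ?v \<nu> j) = (of_real s - z) ^ \<nu> / fact \<nu>"
      using marsden_derivative[OF assms(1)] by simp
    moreover have "(-1) ^ \<nu> * (of_real s - z) ^ \<nu> = (z - of_real s) ^ \<nu>"
      by (simp flip: power_mult_distrib)
    ultimately show "(-1) ^ \<nu> * poly ((pderiv ^^ \<nu>) R) (of_real s) *
          (\<Sum>j\<in>{J - int d..J}. poly (bpiece y d j J) z * ?v \<nu> j)
        = poly ((pderiv ^^ \<nu>) R) (of_real s) * ((z - of_real s) ^ \<nu> / fact \<nu>)"
      by (metis (no_types, lifting) mult.assoc mult.left_commute times_divide_eq_right)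
  qed
  also have "\<dots> = poly R z"
    by (rule poly_taylor[OF assms(2), symmetric])
  finally show "poly (\<Sum>j\<in>{J - int d..J}. smult (dbf (Suc d) y j R s) (bpiece y d j J)) z = poly R z" .
qed

text \<open>By reproduction the \<open>d + 1\<close> pieces span all polynomials of degree at most
  \<open>d\<close>. A relation with \<open>c i \<noteq> 0\<close> would leave \<open>d\<close>
  pieces spanning the \<open>d + 1\<close> independent monomials.\<close>

lemma bpiece_independent:
  assumes y: "strict_mono y" and zero: "(\<Sum>j\<in>{J - int d..J}. smult (c j) (bpiece y d j J)) = 0"
    and i: "i \<in> {J - int d..J}"
  shows "c i = 0"
proof (rule ccontr)
  assume ci: "c i \<noteq> 0"
  interpret vs: vector_space "smult :: complex \<Rightarrow> complex poly \<Rightarrow> complex poly"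
    by unfold_locales (simp_all add: smult_add_right smult_add_left)
  let ?I = "{J - int d..J}"
  define T where "T = (\<lambda>j. bpiece y d j J) ` (?I - {i})"
  define S where "S = (\<lambda>n. monom (1::complex) n) ` {..d}"
  have T: "finite T" "card T \<le> d"
    using i card_image_le[of "?I - {i}" "\<lambda>j. bpiece y d j J"] by (auto simp: T_def)
  have spanT: "bpiece y d j J \<in> vs.span T" if "j \<in> ?I" for j
  proof (cases "j = i")
    case True
    have "smult (c i) (bpiece y d i J) + (\<Sum>j\<in>?I - {i}. smult (c j) (bpiece y d j J)) = 0"
      using zero i by (simp add: sum.remove)
    then have "smult (c i) (bpiece y d i J) = - (\<Sum>j\<in>?I - {i}. smult (c j) (bpiece y d j J))"
      by (simp add: eq_neg_iff_add_eq_0)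
    then have "smult (1 / c i) (smult (c i) (bpiece y d i J))
        = smult (1 / c i) (- (\<Sum>j\<in>?I - {i}. smult (c j) (bpiece y d j J)))"
      by (rule arg_cong)
    then have eq: "bpiece y d i J = smult (1 / c i) (- (\<Sum>j\<in>?I - {i}. smult (c j) (bpiece y d j J)))"
      using ci by simp
    show ?thesis
      unfolding True eq
      by (intro vs.span_scale vs.span_neg vs.span_sum vs.span_scale vs.span_base) (auto simp: T_def)
  next
    case False
    then show ?thesis using that by (intro vs.span_base) (auto simp: T_def)
  qed
  have "S \<subseteq> vs.span T"
  proof
    fix p assume "p \<in> S"
    then have "degree p \<le> d" by (auto simp: S_def degree_monom_eq)
    then have "p = (\<Sum>j\<in>?I. smult (dbf (Suc d) y j p 0) (bpiece y d j J))"
      by (rule dbf_reproduces[OF y, symmetric])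
    then show "p \<in> vs.span T"
      by (metis (no_types, lifting) vs.span_scale vs.span_sum spanT)
  qed
  moreover have inj: "inj_on (\<lambda>n. monom (1::complex) n) {..d}"
    by (auto simp: inj_on_def monom_eq_iff')
  have "vs.independent S"
  proof (rule vs.independent_if_scalars_zero)
    fix f :: "complex poly \<Rightarrow> complex" and p
    assume "(\<Sum>p\<in>S. smult (f p) p) = 0" "p \<in> S"
    then obtain n where n: "n \<le> d" "p = monom 1 n" by (auto simp: S_def)
    have "0 = coeff (\<Sum>m\<le>d. smult (f (monom 1 m)) (monom 1 m)) n"
      using \<open>(\<Sum>p\<in>S. smult (f p) p) = 0\<close> by (simp add: S_def sum.reindex[OF inj])
    also have "\<dots> = f (monom 1 n)"
      using n(1) by (simp add: coeff_sum if_distrib[of "\<lambda>x. _ * x"] cong: if_cong)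
    finally show "f p = 0" by (simp add: n)
  qed (simp add: S_def)
  ultimately have "card S \<le> card T"
    using vs.independent_span_bound T(1) by blast
  then show False using T(2) by (simp add: S_def card_image[OF inj])
qed

text \<open>Duality: piece \<open>i\<close> has its trivial expansion and the one given by
  \<open>dbf_reproduces\<close>, and independence forces them to agree.\<close>

lemma dbf_bpiece:
  assumes y: "strict_mono y" and ij: "i \<in> {J - int d..J}" "j \<in> {J - int d..J}"
  shows "dbf (Suc d) y j (bpiece y d i J) s = (if i = j then 1 else 0)"
proof -
  let ?c = "\<lambda>l. dbf (Suc d) y l (bpiece y d i J) s - (if i = l then 1 else 0)"
  have "(\<Sum>l\<in>{J - int d..J}. smult (?c l) (bpiece y d l J)) =
      (\<Sum>l\<in>{J - int d..J}. smult (dbf (Suc d) y l (bpiece y d i J) s) (bpiece y d l J))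
      - (\<Sum>l\<in>{J - int d..J}. if i = l then bpiece y d l J else 0)"
    unfolding sum_subtractf[symmetric] by (intro sum.cong) (auto simp: smult_diff_left)
  also have "\<dots> = 0"
    using ij(1) by (simp add: dbf_reproduces[OF y bpiece_degree])
  finally have "?c j = 0"
    by (rule bpiece_independent[OF y _ ij(2)])
  then show ?thesis by simp
qed

lemma dbf_combination:
  assumes y: "strict_mono y" and j: "j \<in> {J - int d..J}"
  shows "dbf (Suc d) y j (\<Sum>i\<in>{J - int d..J}. smult (c i) (bpiece y d i J)) s = c j"
  using j by (simp add: dbf_sum dbf_smult dbf_bpiece[OF y] if_distrib[of "\<lambda>x. _ * x"] cong: if_cong)

text \<open>The value is the coefficient of \<open>R\<close> in a basis that does not involve the
  point. Later estimates evaluate at whichever point is convenient.\<close>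

lemma dbf_indep:
  assumes y: "strict_mono y" and "degree R \<le> d"
  shows "dbf (Suc d) y j R s = dbf (Suc d) y j R s'"
  using dbf_combination[OF y, of j j d "\<lambda>i. dbf (Suc d) y i R s'" s]
  by (simp add: dbf_reproduces[OF assms])

text \<open>Evaluated at the knot itself, the derivatives of the power below order \<open>d\<close>
  vanish, and the one of order \<open>d\<close> is multiplied by \<open>varpi\<close>, which is 0
  there. So the functional does not feel jumps at the interior knots of its B-spline.\<close>

lemma dbf_knot_power:
  assumes y: "strict_mono y" and i: "i \<in> {j + 1..j + int d}"
  shows "dbf (Suc d) y j ([:- of_real (y i), 1:] ^ d) s = 0"
proof -
  have R: "degree ([:- complex_of_real (y i), 1:] ^ d) \<le> d"
    using degree_linear_power[of "- complex_of_real (y i)" d] by simp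
  have "dbf (Suc d) y j ([:- of_real (y i), 1:] ^ d) (y i) = 0"
    unfolding dbf_def
  proof (rule sum.neutral, rule ballI)
    fix \<nu> assume "\<nu> \<in> {..<Suc d}"
    then consider "\<nu> = d" | "\<nu> < d" by fastforce
    then show "(- 1) ^ \<nu> * complex_of_real (poly ((pderiv ^^ (Suc d - \<nu> - 1)) (varpi (Suc d) y j)) (y i)) *
         poly ((pderiv ^^ \<nu>) ([:- of_real (y i), 1:] ^ d)) (of_real (y i)) = 0"
    proof cases
      case 1
      have "poly (varpi (Suc d) y j) (y i) = 0"
        using i by (auto simp: varpi_def poly_prod)
      then show ?thesis by (simp add: 1)
    next
      case 2
      have "[:- of_real (y i), 1:] ^ d \<circ>\<^sub>p [:of_real (y i), 1:] = (monom 1 d :: complex poly)"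
        by (rule poly_ext) (simp add: poly_pcompose poly_power poly_monom)
      then show ?thesis using 2 by (simp add: higher_pderiv_shift)
    qed
  qed
  then show ?thesis using dbf_indep[OF y R] by metis
qed

section \<open>Splines as families of polynomial pieces with prescribed jumps\<close>

definition spiece :: "(int \<Rightarrow> real) \<Rightarrow> nat \<Rightarrow> (int \<Rightarrow> complex) \<Rightarrow> int \<Rightarrow> complex poly" where
  "spiece y d c J = (\<Sum>j\<in>{J - int d..J}. smult (c j) (bpiece y d j J))"

lemma degree_spiece: "degree (spiece y d c J) \<le> d"
  unfolding spiece_def
  by (intro degree_sum_le) (auto intro: order_trans[OF degree_smult_le] bpiece_degree)

lemma dbf_spiece:
  "strict_mono y \<Longrightarrow> j \<in> {J - int d..J} \<Longrightarrow> dbf (Suc d) y j (spiece y d c J) s = c j"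
  unfolding spiece_def by (rule dbf_combination)

text \<open>The jump is annihilated by all functionals of the new interval but the last one, hence a
  multiple of the first piece of the last B-spline.\<close>

lemma spiece_jump:
  assumes y: "strict_mono y"
  shows "\<exists>a. spiece y d c J - spiece y d c (J - 1) = smult a ([:- of_real (y J), 1:] ^ d)"
proof -
  let ?D = "spiece y d c J - spiece y d c (J - 1)"
  have "degree ?D \<le> d" by (intro degree_diff_le degree_spiece)
  then have "?D = (\<Sum>j\<in>{J - int d..J}. smult (dbf (Suc d) y j ?D 0) (bpiece y d j J))"
    by (rule dbf_reproduces[OF y, symmetric])
  also have "\<dots> = (\<Sum>j\<in>{J}. smult (dbf (Suc d) y j ?D 0) (bpiece y d j J))"
    by (intro sum.mono_neutral_right) (auto simp: dbf_diff dbf_spiece[OF y])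
  finally have "?D = smult (dbf (Suc d) y J ?D 0) (bpiece y d J J)" by simp
  then show ?thesis
    using bpiece_first[of y d J] by (metis smult_smult)
qed

text \<open>The functional \<open>j\<close> takes one value on the pieces \<open>j\<close> to
  \<open>j + d\<close>, because the jumps between them sit at interior knots of the B-spline
  \<open>j\<close>; these values are the coefficients. By this criterion a difference of splines of
  two levels is recognised as a spline of the finer level.\<close>

lemma spline_of_pieces:
  assumes y: "strict_mono y" and deg: "\<And>J. degree (p J) \<le> d"
    and jump: "\<And>J. \<exists>a. p J - p (J - 1) = smult a ([:- of_real (y J), 1:] ^ d)"
  shows "p J = spiece y d (\<lambda>j. dbf (Suc d) y j (p j) 0) J"
proof -
  have const: "dbf (Suc d) y j (p (j + int n)) 0 = dbf (Suc d) y j (p j) 0" if "n \<le> d" for j n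
    using that
  proof (induction n)
    case (Suc n)
    obtain a where a: "p (j + int (Suc n)) - p (j + int (Suc n) - 1)
        = smult a ([:- of_real (y (j + int (Suc n))), 1:] ^ d)"
      using jump by blast
    have "dbf (Suc d) y j (p (j + int (Suc n)) - p (j + int (Suc n) - 1)) 0 = 0"
      unfolding a dbf_smult using Suc.prems by (subst dbf_knot_power[OF y]) auto
    then show ?case using Suc by (simp add: dbf_diff)
  qed simp
  then have "dbf (Suc d) y j (p J) 0 = dbf (Suc d) y j (p j) 0" if "j \<in> {J - int d..J}" for j
    using const[of "nat (J - j)" j] that by (auto simp: nat_le_iff)
  then show ?thesis
    unfolding spiece_def using dbf_reproduces[OF y deg[of J], where J = J and s = 0] by simp
qed

lemma bspline_outside:
  assumes "strict_mono y" "y J \<le> t" "t < y (J + 1)" "j \<notin> {J - int d..J}"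
  shows "bspline y d j t = 0"
proof -
  have "bpiece y d j J = 0" using assms(4) by (intro bpiece_outside) auto
  then show ?thesis using bspline_eq_bpiece[OF assms(1-3), of d j] by simp
qed

lemma spline_sum_finite:
  assumes "strict_mono y" "y J \<le> t" "t < y (J + 1)"
  shows "spline_sum y (Suc d) c t = (\<Sum>j\<in>{J - int d..J}. c j * of_real (bspline y d j t))"
  unfolding spline_sum_def
  using bspline_outside[OF assms, of _ d]
  by (intro sum.mono_neutral_cong_left) (auto simp del: atLeastAtMost_iff)

lemma spline_sum_eq_spiece:
  assumes "strict_mono y" "y J \<le> t" "t < y (J + 1)"
  shows "spline_sum y (Suc d) c t = poly_real (spiece y d c J) t"
  unfolding spline_sum_finite[OF assms]
  by (simp add: spiece_def poly_real_def poly_sum bspline_eq_bpiece[OF assms])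

text \<open>The half-open convention in \<open>bspline\<close> matters only at the right endpoint,
  where for positive degree the jump polynomial vanishes.\<close>

lemma spline_sum_closed:
  assumes y: "strict_mono y" and t: "y J \<le> t" "t \<le> y (J + 1)" and d: "d \<ge> 1"
  shows "spline_sum y (Suc d) c t = poly_real (spiece y d c J) t"
proof (cases "t < y (J + 1)")
  case True
  then show ?thesis using spline_sum_eq_spiece[OF y t(1)] by simp
next
  case False
  then have t': "t = y (J + 1)" using t by simp
  obtain a where "spiece y d c (J + 1) - spiece y d c J = smult a ([:- of_real (y (J + 1)), 1:] ^ d)"
    using spiece_jump[OF y, of d c "J + 1"] by auto
  then have "poly (spiece y d c (J + 1) - spiece y d c J) (of_real t) = 0"
    using d by (simp add: t' poly_power)
  then have "poly_real (spiece y d c (J + 1)) t = poly_real (spiece y d c J) t"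
    by (simp add: poly_real_def)
  moreover have "spline_sum y (Suc d) c t = poly_real (spiece y d c (J + 1)) t"
    using strict_monoD[OF y, of "J + 1" "J + 1 + 1"] by (intro spline_sum_eq_spiece[OF y]) (auto simp: t')
  ultimately show ?thesis by simp
qed

lemma poly_real_eq_on_interval:
  assumes "a < b" "\<And>t. a < t \<Longrightarrow> t < b \<Longrightarrow> poly_real p t = poly_real r t"
  shows "p = r"
proof (rule ccontr)
  assume "p \<noteq> r"
  then have "finite {z. poly (p - r) z = 0}" by (intro poly_roots_finite) simp
  moreover have "complex_of_real ` {a<..<b} \<subseteq> {z. poly (p - r) z = 0}"
    using assms(2) by (auto simp: poly_real_def)
  ultimately have "finite (complex_of_real ` {a<..<b})" by (rule rev_finite_subset)
  then have "finite {a<..<b}" by (rule finite_imageD) (auto simp: inj_on_def)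
  then show False using infinite_Ioo[OF assms(1)] by simp
qed

text \<open>The uniqueness behind the definite description in \<open>b_coeff\<close>.\<close>

lemma spline_sum_unique:
  assumes y: "strict_mono y" and eq: "\<And>t. spline_sum y (Suc d) c t = spline_sum y (Suc d) c' t"
  shows "c = c'"
proof
  fix j
  have "spiece y d c j = spiece y d c' j"
  proof (rule poly_real_eq_on_interval)
    show "y j < y (j + 1)" using y by (simp add: strict_mono_less)
    show "poly_real (spiece y d c j) t = poly_real (spiece y d c' j) t" if "y j < t" "t < y (j + 1)" for t
      using eq[of t] that spline_sum_eq_spiece[OF y, of j t d c] spline_sum_eq_spiece[OF y, of j t d c']
      by simp
  qed
  then show "c j = c' j"
    using dbf_spiece[OF y, of j j d c 0] dbf_spiece[OF y, of j j d c' 0] by simp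
qed

text \<open>The bound \<open>2 ^ d\<close> comes straight from the recursion, since each weight lies
  between 0 and 1 on the support of the B-spline it multiplies.\<close>

lemma bspline_bounds:
  assumes y: "strict_mono y"
  shows "0 \<le> bspline y d j t \<and> bspline y d j t \<le> 2 ^ d \<and>
    (t \<notin> {y j..<y (j + int d + 1)} \<longrightarrow> bspline y d j t = 0)"
proof (induction d arbitrary: j)
  case (Suc d)
  have less: "y i < y i'" if "i < i'" for i i' using y that by (rule strict_monoD)
  have *: "0 \<le> w * bspline y d i t \<and> w * bspline y d i t \<le> 2 ^ d"
    if "t \<in> {y i..<y (i + int d + 1)} \<Longrightarrow> 0 \<le> w \<and> w \<le> 1" for w i
  proof (cases "t \<in> {y i..<y (i + int d + 1)}")
    case True
    have "w * bspline y d i t \<le> 1 * 2 ^ d"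
      using that[OF True] Suc[of i] by (intro mult_mono) auto
    then show ?thesis using that[OF True] Suc[of i] by auto
  qed (use Suc[of i] in auto)
  have a: "0 \<le> (t - y j) / (y (j + int d + 1) - y j) * bspline y d j t \<and>
      (t - y j) / (y (j + int d + 1) - y j) * bspline y d j t \<le> 2 ^ d"
    using less[of j "j + int d + 1"] by (intro *) (auto simp: field_simps)
  have b: "0 \<le> (y (j + int d + 2) - t) / (y (j + int d + 2) - y (j + 1)) * bspline y d (j + 1) t \<and>
      (y (j + int d + 2) - t) / (y (j + int d + 2) - y (j + 1)) * bspline y d (j + 1) t \<le> 2 ^ d"
    using less[of "j + 1" "j + int d + 2"] by (intro *) (auto simp: field_simps add.commute)
  have "bspline y (Suc d) j t = 0" if "t \<notin> {y j..<y (j + int (Suc d) + 1)}"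
  proof -
    have "t \<notin> {y j..<y (j + int d + 1)}" "t \<notin> {y (j + 1)..<y (j + 1 + int d + 1)}"
      using that less[of j "j + 1"] less[of "j + int d + 1" "j + int d + 2"] by (auto simp: algebra_simps)
    then show ?thesis using Suc[of j] Suc[of "j + 1"] by simp
  qed
  then show ?case using a b by simp
qed simp

subsection \<open>Norms of polynomials\<close>

lemma set_integral_mono_subset:
  fixes f :: "_ \<Rightarrow> real"
  assumes "set_integrable M B f" "A \<in> sets M" "A \<subseteq> B" "\<And>x. x \<in> B \<Longrightarrow> 0 \<le> f x"
  shows "(LINT x:A|M. f x) \<le> (LINT x:B|M. f x)"
proof -
  have "set_integrable M A f"
    using assms by (intro set_integrable_subset[OF assms(1)]) auto
  then show ?thesis
    using assms unfolding set_lebesgue_integral_def set_integrable_def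
    by (intro integral_mono) (auto simp: indicator_def)
qed

lemma set_integral_const_interval: "a \<le> b \<Longrightarrow> (LINT t:{a..b}|lebesgue. c) = (b - a) * (c :: real)"
  by (simp add: set_lebesgue_integral_def)

lemma continuous_poly_real [continuous_intros]:
  "continuous_on S g \<Longrightarrow> continuous_on S (\<lambda>t. poly_real R (g t))"
  unfolding poly_real_def by (intro continuous_intros)

lemma set_integrable_continuous_lebesgue:
  fixes f :: "real \<Rightarrow> 'a :: euclidean_space"
  shows "continuous_on {a..b} f \<Longrightarrow> set_integrable lebesgue {a..b} f"
  by (rule absolutely_integrable_continuous_real)

lemma ex_value_below_mean:
  fixes \<phi> :: "real \<Rightarrow> real"
  assumes "a \<le> b" "continuous_on {a..b} \<phi>"
  shows "\<exists>t\<in>{a..b}. \<phi> t * (b - a) \<le> (LINT t:{a..b}|lebesgue. \<phi> t)"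
proof -
  obtain t where t: "t \<in> {a..b}" "\<And>s. s \<in> {a..b} \<Longrightarrow> \<phi> t \<le> \<phi> s"
    using continuous_attains_inf[of "{a..b}" \<phi>] assms by auto
  have "(LINT s:{a..b}|lebesgue. \<phi> t) \<le> (LINT s:{a..b}|lebesgue. \<phi> s)"
    by (intro set_integral_mono set_integrable_continuous_lebesgue assms continuous_intros t(2))
  then show ?thesis
    using t(1) assms(1) by (auto simp: set_integral_const_interval mult.commute)
qed

text \<open>Weighting by \<open>L ^ n\<close> makes the bound homogeneous: each linear factor
  multiplies the weighted coefficients by at most \<open>(1 + K) * L\<close>.\<close>

lemma coeff_prod_linear_bound:
  fixes u :: "'b \<Rightarrow> complex"
  assumes "finite A" "\<And>i. i \<in> A \<Longrightarrow> norm (u i) \<le> K * L" "L \<ge> 0" "K \<ge> 0"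
  shows "norm (coeff (\<Prod>i\<in>A. [:u i, 1:]) n) * L ^ n \<le> (1 + K) ^ card A * L ^ card A"
  using assms(1,2)
proof (induction arbitrary: n rule: finite_induct)
  case empty
  then show ?case by (cases n) auto
next
  case (insert a A)
  let ?p = "\<Prod>i\<in>A. [:u i, 1:]" and ?B = "(1 + K) ^ card A * L ^ card A"
  have IH: "norm (coeff ?p n) * L ^ n \<le> ?B" for n
    using insert by simp
  have B: "?B \<ge> 0" using assms by simp
  have ua: "norm (u a) \<le> K * L" using insert by simp
  have 1: "norm (u a * coeff ?p n) * L ^ n \<le> K * L * ?B" for n
  proof -
    have "norm (u a) * (norm (coeff ?p n) * L ^ n) \<le> K * L * ?B"
      by (rule mult_mono[OF ua IH]) (use assms(3,4) in auto)
    then show ?thesis by (simp add: norm_mult mult.assoc)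
  qed
  have "norm (coeff (\<Prod>i\<in>insert a A. [:u i, 1:]) n) * L ^ n \<le> (1 + K) * L * ?B"
  proof (cases n)
    case 0
    have "norm (coeff (\<Prod>i\<in>insert a A. [:u i, 1:]) n) * L ^ n \<le> K * L * ?B"
      using insert(1,2) 1[of 0] by (simp add: 0)
    also have "\<dots> \<le> (1 + K) * L * ?B"
      using B assms(3) by (intro mult_right_mono) auto
    finally show ?thesis .
  next
    case (Suc m)
    have "norm (coeff (\<Prod>i\<in>insert a A. [:u i, 1:]) n) = norm (u a * coeff ?p (Suc m) + coeff ?p m)"
      using insert(1,2) by (simp add: Suc)
    also have "\<dots> \<le> norm (u a * coeff ?p (Suc m)) + norm (coeff ?p m)"
      by (rule norm_triangle_ineq)
    finally have "norm (coeff (\<Prod>i\<in>insert a A. [:u i, 1:]) n) * L ^ n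
        \<le> (norm (u a * coeff ?p (Suc m)) + norm (coeff ?p m)) * L ^ n"
      using assms(3) by (intro mult_right_mono) auto
    also have "\<dots> = norm (u a * coeff ?p (Suc m)) * L ^ Suc m + L * (norm (coeff ?p m) * L ^ m)"
      by (simp add: Suc algebra_simps)
    also have "\<dots> \<le> K * L * ?B + L * ?B"
      using 1[of "Suc m"] IH[of m] assms(3) by (intro add_mono mult_left_mono) auto
    finally show ?thesis by (simp add: algebra_simps)
  qed
  then show ?case using insert(1,2) by (simp add: algebra_simps)
qed

text \<open>\<open>R\<close> is its own Lagrange interpolant at \<open>d + 1\<close> nodes. The
  denominators are at least \<open>\<delta> ^ d\<close> in modulus, and nodes in the unit interval
  bound the coefficients of the numerators by \<open>2 ^ d\<close>.\<close>

lemma lagrange_coeff_bound: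
  fixes R :: "complex poly" and t :: "nat \<Rightarrow> real"
  assumes deg: "degree R \<le> d" and t: "\<And>i. i \<le> d \<Longrightarrow> t i \<in> {0..1}"
    and sep: "\<And>i j. i \<le> d \<Longrightarrow> j \<le> d \<Longrightarrow> i \<noteq> j \<Longrightarrow> \<delta> \<le> \<bar>t i - t j\<bar>" and \<delta>: "0 < \<delta>"
  shows "norm (coeff R n) \<le> (2 / \<delta>) ^ d * (\<Sum>i\<le>d. norm (poly_real R (t i)))"
proof -
  define c where "c i = (\<Prod>j\<in>{..d} - {i}. 1 / complex_of_real (t i - t j))" for i
  define p where "p i = (\<Prod>j\<in>{..d} - {i}. [:- complex_of_real (t j), 1:])" for i
  have p_other: "poly (p i) (of_real (t l)) = 0" if "l \<le> d" "l \<noteq> i" for i l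
    using that by (auto simp: p_def poly_prod)
  have p_self: "c i * poly (p i) (of_real (t i)) = 1" if "i \<le> d" for i
    unfolding c_def p_def poly_prod prod.distrib[symmetric]
  proof (rule prod.neutral, rule ballI)
    fix j assume "j \<in> {..d} - {i}"
    then have "t i \<noteq> t j" using sep[of i j] that \<delta> by auto
    then show "1 / complex_of_real (t i - t j) * poly [:- complex_of_real (t j), 1:] (complex_of_real (t i)) = 1"
      by simp
  qed
  have degp: "degree (p i) \<le> d" if "i \<le> d" for i
    using degree_prod_sum_le[of "{..d} - {i}" "\<lambda>j. [:- complex_of_real (t j), 1:]"] that
    by (simp add: p_def o_def)
  have R_eq: "R = (\<Sum>i\<le>d. smult (poly_real R (t i) * c i) (p i))"
  proof (rule poly_eqI_degree[of "(\<lambda>i. complex_of_real (t i)) ` {..d}"])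
    have "inj_on (\<lambda>i. complex_of_real (t i)) {..d}"
      using sep \<delta> by (force simp: inj_on_def)
    then have card: "card ((\<lambda>i. complex_of_real (t i)) ` {..d}) = Suc d"
      by (simp add: card_image)
    then show "degree R < card ((\<lambda>i. complex_of_real (t i)) ` {..d})"
      using deg by simp
    have "degree (\<Sum>i\<le>d. smult (poly_real R (t i) * c i) (p i)) \<le> d"
      by (intro degree_sum_le) (auto intro: order_trans[OF degree_smult_le] degp)
    then show "degree (\<Sum>i\<le>d. smult (poly_real R (t i) * c i) (p i))
        < card ((\<lambda>i. complex_of_real (t i)) ` {..d})"
      using card by simp
    fix z assume "z \<in> (\<lambda>i. complex_of_real (t i)) ` {..d}"
    then obtain l where l: "l \<le> d" "z = of_real (t l)" by auto
    have "poly (\<Sum>i\<le>d. smult (poly_real R (t i) * c i) (p i)) z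
        = (\<Sum>i\<in>{l}. poly_real R (t i) * (c i * poly (p i) z))"
      unfolding poly_sum using l p_other
      by (intro sum.mono_neutral_cong_right) (auto simp: algebra_simps)
    then show "poly R z = poly (\<Sum>i\<le>d. smult (poly_real R (t i) * c i) (p i)) z"
      using l p_self by (simp add: poly_real_def)
  qed
  have "coeff R n = coeff (\<Sum>i\<le>d. smult (poly_real R (t i) * c i) (p i)) n"
    using R_eq by (rule arg_cong)
  also have "\<dots> = (\<Sum>i\<le>d. poly_real R (t i) * (c i * coeff (p i) n))"
    by (simp add: coeff_sum mult.assoc)
  finally have "norm (coeff R n) = norm (\<Sum>i\<le>d. poly_real R (t i) * (c i * coeff (p i) n))"
    by (rule arg_cong)
  also have "\<dots> \<le> (\<Sum>i\<le>d. norm (poly_real R (t i)) * (2 / \<delta>) ^ d)"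
  proof (intro sum_norm_le)
    fix i assume i: "i \<in> {..d}"
    have "norm (c i) \<le> (1 / \<delta>) ^ card ({..d} - {i})"
      unfolding c_def prod_norm[symmetric] prod_constant[symmetric]
    proof (rule prod_mono)
      fix j assume "j \<in> {..d} - {i}"
      then have "\<delta> \<le> \<bar>t i - t j\<bar>" using sep i by auto
      then show "0 \<le> norm (1 / complex_of_real (t i - t j)) \<and> norm (1 / complex_of_real (t i - t j)) \<le> 1 / \<delta>"
        using \<delta> by (simp add: norm_divide frac_le flip: of_real_diff)
    qed
    moreover have "norm (coeff (p i) n) \<le> 2 ^ card ({..d} - {i})"
      using coeff_prod_linear_bound[of "{..d} - {i}" "\<lambda>j. - complex_of_real (t j)" 1 1 n] t
      by (simp add: p_def)
    moreover have "card ({..d} - {i}) = d" using i by simp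
    ultimately have "norm (c i) * norm (coeff (p i) n) \<le> (1 / \<delta>) ^ d * 2 ^ d"
      by (intro mult_mono) (use \<delta> in auto)
    then have "norm (c i * coeff (p i) n) \<le> (2 / \<delta>) ^ d"
      by (simp add: norm_mult power_divide)
    then show "norm (poly_real R (t i) * (c i * coeff (p i) n)) \<le> norm (poly_real R (t i)) * (2 / \<delta>) ^ d"
      unfolding norm_mult[of "poly_real R (t i)"] by (rule mult_left_mono) simp
  qed
  also have "\<dots> = (\<Sum>i\<le>d. norm (poly_real R (t i))) * (2 / \<delta>) ^ d"
    by (simp only: sum_distrib_right)
  finally show ?thesis by (simp only: mult.commute)
qed

text \<open>A normalised L1 norm. It is invariant under affine changes of variable, so the constants
  of comparison depend on degree and relative position, never on lengths.\<close>

definition pmean :: "complex poly \<Rightarrow> real \<Rightarrow> real \<Rightarrow> real" where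
  "pmean R a L = (LINT t:{a..a + L}|lebesgue. norm (poly_real R t)) / L"

lemma pmean_nonneg: "L > 0 \<Longrightarrow> pmean R a L \<ge> 0"
  by (simp add: pmean_def set_lebesgue_integral_def)

text \<open>Equivalence of norms on polynomials, made explicit: each chosen cell contains a point
  where the modulus is at most its mean over that cell, and interpolation at these points bounds the
  coefficients.\<close>

lemma coeff_le_pmean:
  "\<exists>C>0. \<forall>R a L n. degree R \<le> d \<longrightarrow> L > 0 \<longrightarrow>
     norm (coeff (R \<circ>\<^sub>p [:of_real a, of_real L:]) n) \<le> C * pmean R a L"
proof -
  \<comment> \<open>There are \<open>d + 1\<close> cells of length \<open>h\<close>, and
    \<open>d\<close> gaps of the same length between them fill up the unit interval; the gaps keep
    the interpolation nodes at distance at least \<open>h\<close>.\<close>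
  define h where "h = 1 / (2 * real d + 1)"
  have h: "h > 0" by (simp add: h_def)
  define C where "C = (2 / h) ^ d * (real (Suc d) / h)"
  have "norm (coeff (R \<circ>\<^sub>p [:of_real a, of_real L:]) n) \<le> C * pmean R a L"
    if R: "degree R \<le> d" and L: "L > 0" for R :: "complex poly" and a L n
  proof -
    let ?S = "R \<circ>\<^sub>p [:of_real a, of_real L:]"
    have "\<exists>s. s \<in> {2 * real i * h..(2 * real i + 1) * h} \<and> norm (poly_real ?S s) \<le> pmean R a L / h"
      if "i \<le> d" for i
    proof -
      let ?a = "a + L * (2 * real i * h)" and ?b = "a + L * ((2 * real i + 1) * h)"
      have "?a \<le> ?b" using L h by simp
      moreover have "continuous_on {?a..?b} (\<lambda>t. norm (poly_real R t))"
        by (intro continuous_intros)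
      ultimately obtain t where t: "t \<in> {?a..?b}"
        "norm (poly_real R t) * (?b - ?a) \<le> (LINT t:{?a..?b}|lebesgue. norm (poly_real R t))"
        using ex_value_below_mean by blast
      have "(2 * real i + 1) * h \<le> (2 * real d + 1) * h"
        using that h by (intro mult_right_mono) auto
      then have "(2 * real i + 1) * h \<le> 1" by (simp add: h_def)
      then have "{?a..?b} \<subseteq> {a..a + L}"
        using L h by (auto intro: order_trans mult_left_le)
      then have "(LINT t:{?a..?b}|lebesgue. norm (poly_real R t)) \<le> (LINT t:{a..a + L}|lebesgue. norm (poly_real R t))"
        by (intro set_integral_mono_subset set_integrable_continuous_lebesgue continuous_intros) auto
      with t(2) have "norm (poly_real R t) * (L * h) \<le> pmean R a L * L"
        using L by (simp add: pmean_def algebra_simps)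
      then have "norm (poly_real R t) \<le> pmean R a L / h"
        using L h by (simp add: field_simps)
      moreover have "poly_real ?S ((t - a) / L) = poly_real R t"
        using L by (simp add: poly_real_def poly_pcompose)
      moreover have "(t - a) / L \<in> {2 * real i * h..(2 * real i + 1) * h}"
        using t(1) L by (auto simp: field_simps)
      ultimately show ?thesis by (intro exI[of _ "(t - a) / L"]) simp
    qed
    then obtain s where s: "\<And>i. i \<le> d \<Longrightarrow> s i \<in> {2 * real i * h..(2 * real i + 1) * h}"
      "\<And>i. i \<le> d \<Longrightarrow> norm (poly_real ?S (s i)) \<le> pmean R a L / h"
      by metis
    have sep1: "h \<le> s j - s i" if "i < j" "j \<le> d" for i j
    proof -
      have "(2 * real i + 2) * h \<le> 2 * real j * h"
        using that h by (intro mult_right_mono) auto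
      then have "(2 * real i + 1) * h + h \<le> 2 * real j * h"
        by (simp add: algebra_simps)
      then show ?thesis using s(1)[of i] s(1)[of j] that by auto
    qed
    have "norm (coeff ?S n) \<le> (2 / h) ^ d * (\<Sum>i\<le>d. norm (poly_real ?S (s i)))"
    proof (rule lagrange_coeff_bound)
      show "degree ?S \<le> d" using R degree_pcompose_le[of R "[:of_real a, of_real L:]"] L by simp
      fix i assume i: "i \<le> d"
      have "(2 * real i + 1) * h \<le> (2 * real d + 1) * h"
        using i h by (intro mult_right_mono) auto
      then have "(2 * real i + 1) * h \<le> 1" by (simp add: h_def)
      moreover have "0 \<le> 2 * real i * h" using h by simp
      ultimately show "s i \<in> {0..1}"
        using s(1)[OF i] unfolding atLeastAtMost_iff by (blast intro: order_trans)
    next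
      show "h \<le> \<bar>s i - s j\<bar>" if "i \<le> d" "j \<le> d" "i \<noteq> j" for i j
        using sep1[of i j] sep1[of j i] that by (cases "i < j") auto
    qed (rule h)
    also have "\<dots> \<le> (2 / h) ^ d * (\<Sum>i\<le>d. pmean R a L / h)"
      using h s(2) by (intro mult_left_mono sum_mono) auto
    also have "\<dots> = C * pmean R a L" by (simp add: C_def)
    finally show ?thesis .
  qed
  moreover have "C > 0" using h by (simp add: C_def)
  ultimately show ?thesis by blast
qed

lemma poly_real_rescale:
  assumes "degree R \<le> d" "L > 0"
  shows "poly_real R t = (\<Sum>n\<le>d. coeff (R \<circ>\<^sub>p [:of_real a, of_real L:]) n * of_real (((t - a) / L) ^ n))"
proof -
  have "poly_real R t = poly (R \<circ>\<^sub>p [:of_real a, of_real L:]) (of_real ((t - a) / L))"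
    using assms(2) by (simp add: poly_real_def poly_pcompose)
  also have "\<dots> = (\<Sum>n\<le>d. coeff (R \<circ>\<^sub>p [:of_real a, of_real L:]) n * of_real ((t - a) / L) ^ n)"
    using assms degree_pcompose_le[of R "[:of_real a, of_real L:]"] by (intro poly_eq_sum_coeff) simp
  finally show ?thesis by simp
qed

text \<open>The parameter \<open>K\<close> admits points outside the interval, which carries a bound
  from an interval to its surroundings.\<close>

lemma poly_real_le_pmean:
  assumes "K \<ge> 1"
  shows "\<exists>C>0. \<forall>R a L t. degree R \<le> d \<longrightarrow> L > 0 \<longrightarrow> \<bar>t - a\<bar> \<le> K * L \<longrightarrow>
     norm (poly_real R t) \<le> C * pmean R a L"
proof -
  obtain C where C: "C > 0" "\<And>R a L n. degree R \<le> d \<Longrightarrow> L > 0 \<Longrightarrow>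
      norm (coeff (R \<circ>\<^sub>p [:of_real a, of_real L:]) n) \<le> C * pmean R a L"
    using coeff_le_pmean[of d] by blast
  have "norm (poly_real R t) \<le> C * (\<Sum>n\<le>d. K ^ n) * pmean R a L"
    if R: "degree R \<le> d" and L: "L > 0" and t: "\<bar>t - a\<bar> \<le> K * L" for R a L t
  proof -
    have "norm (poly_real R t) \<le> (\<Sum>n\<le>d. (C * pmean R a L) * K ^ n)"
      unfolding poly_real_rescale[OF R L, of t a]
    proof (intro sum_norm_le)
      fix n
      have "\<bar>(t - a) / L\<bar> \<le> K" using L t by (simp add: field_simps)
      then have "\<bar>(t - a) / L\<bar> ^ n \<le> K ^ n" by (intro power_mono) auto
      then show "norm (coeff (R \<circ>\<^sub>p [:of_real a, of_real L:]) n * of_real (((t - a) / L) ^ n))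
          \<le> (C * pmean R a L) * K ^ n"
        unfolding norm_mult norm_of_real power_abs
        using C(1) C(2)[OF R L, of a n] pmean_nonneg[OF L, of R a] by (intro mult_mono) auto
    qed
    then show ?thesis unfolding sum_distrib_left[symmetric] by (simp only: mult_ac)
  qed
  moreover have "(\<Sum>n\<le>d. K ^ n) > 0" using assms by (intro sum_pos) auto
  ultimately show ?thesis using C(1) by (intro exI[of _ "C * (\<Sum>n\<le>d. K ^ n)"]) auto
qed

lemma power_diff_le:
  fixes u v :: real
  assumes "\<bar>u\<bar> \<le> 1" "\<bar>v\<bar> \<le> 1"
  shows "\<bar>u ^ n - v ^ n\<bar> \<le> real n * \<bar>u - v\<bar>"
proof (induction n)
  case (Suc n)
  have "u ^ Suc n - v ^ Suc n = u * (u ^ n - v ^ n) + (u - v) * v ^ n"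
    by (simp add: algebra_simps)
  then have "\<bar>u ^ Suc n - v ^ Suc n\<bar> \<le> \<bar>u\<bar> * \<bar>u ^ n - v ^ n\<bar> + \<bar>u - v\<bar> * \<bar>v\<bar> ^ n"
    by (metis abs_mult abs_triangle_ineq power_abs)
  also have "\<dots> \<le> 1 * (real n * \<bar>u - v\<bar>) + \<bar>u - v\<bar> * 1"
    using assms Suc by (intro add_mono mult_mono power_le_one) auto
  finally show ?case by (simp add: algebra_simps)
qed simp

text \<open>A Markov-type inequality, read off from the coefficients after rescaling to the unit
  interval.\<close>

lemma poly_real_Lipschitz:
  "\<exists>C>0. \<forall>R a L s t. degree R \<le> d \<longrightarrow> L > 0 \<longrightarrow> s \<in> {a..a + L} \<longrightarrow> t \<in> {a..a + L} \<longrightarrow>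
     norm (poly_real R t - poly_real R s) \<le> C * pmean R a L * (\<bar>t - s\<bar> / L)"
proof -
  obtain C where C: "C > 0" "\<And>R a L n. degree R \<le> d \<Longrightarrow> L > 0 \<Longrightarrow>
      norm (coeff (R \<circ>\<^sub>p [:of_real a, of_real L:]) n) \<le> C * pmean R a L"
    using coeff_le_pmean[of d] by blast
  have "norm (poly_real R t - poly_real R s) \<le> C * (1 + (\<Sum>n\<le>d. real n)) * pmean R a L * (\<bar>t - s\<bar> / L)"
    if R: "degree R \<le> d" and L: "L > 0" and s: "s \<in> {a..a + L}" and t: "t \<in> {a..a + L}" for R a L s t
  proof -
    let ?c = "\<lambda>n. coeff (R \<circ>\<^sub>p [:of_real a, of_real L:]) n"
    have "poly_real R t - poly_real R s
        = (\<Sum>n\<le>d. ?c n * of_real (((t - a) / L) ^ n - ((s - a) / L) ^ n))"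
      unfolding poly_real_rescale[OF R L, of t a] poly_real_rescale[OF R L, of s a]
      by (simp add: algebra_simps flip: sum_subtractf)
    also have "norm \<dots> \<le> (\<Sum>n\<le>d. (C * pmean R a L) * (real n * (\<bar>t - s\<bar> / L)))"
    proof (intro sum_norm_le)
      fix n
      have "\<bar>((t - a) / L) ^ n - ((s - a) / L) ^ n\<bar> \<le> real n * \<bar>(t - a) / L - (s - a) / L\<bar>"
        using s t L by (intro power_diff_le) (auto simp: field_simps)
      also have "\<bar>(t - a) / L - (s - a) / L\<bar> = \<bar>t - s\<bar> / L"
        using L by (simp flip: diff_divide_distrib)
      finally show "norm (?c n * of_real (((t - a) / L) ^ n - ((s - a) / L) ^ n))
          \<le> (C * pmean R a L) * (real n * (\<bar>t - s\<bar> / L))"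
        unfolding norm_mult norm_of_real using C(1) C(2)[OF R L, of a n] pmean_nonneg[OF L, of R a]
        by (intro mult_mono) auto
    qed
    also have "\<dots> = (C * pmean R a L) * ((\<Sum>n\<le>d. real n) * (\<bar>t - s\<bar> / L))"
      by (simp only: sum_distrib_left sum_distrib_right)
    also have "\<dots> = C * (\<Sum>n\<le>d. real n) * pmean R a L * (\<bar>t - s\<bar> / L)"
      by (simp only: mult_ac)
    also have "\<dots> \<le> C * (1 + (\<Sum>n\<le>d. real n)) * pmean R a L * (\<bar>t - s\<bar> / L)"
      using C(1) L pmean_nonneg[OF L, of R a] by (intro mult_right_mono mult_left_mono) auto
    finally show ?thesis .
  qed
  moreover have "C * (1 + (\<Sum>n\<le>d. real n)) > 0"
    using C(1) by (intro mult_pos_pos add_pos_nonneg sum_nonneg) auto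
  ultimately show ?thesis by blast
qed

lemma coeff_pcompose_scale:
  fixes p :: "complex poly"
  shows "coeff (p \<circ>\<^sub>p [:a, c:]) n = c ^ n * coeff (p \<circ>\<^sub>p [:a, 1:]) n"
proof -
  have "p \<circ>\<^sub>p [:a, c:] = (p \<circ>\<^sub>p [:a, 1:]) \<circ>\<^sub>p [:0, c:]"
    by (rule poly_ext) (simp add: poly_pcompose)
  then show ?thesis by (simp add: coeff_pcompose_linear)
qed

text \<open>The powers of \<open>L\<close> cancel: the Taylor coefficient of \<open>varpi\<close> of
  order \<open>d - \<nu>\<close> is of size \<open>L ^ \<nu>\<close>, and the derivative of
  \<open>R\<close> of order \<open>\<nu>\<close> is of the inverse size. The point of evaluation is
  first moved from \<open>s\<close> to \<open>a\<close> by \<open>dbf_indep\<close>.\<close>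

lemma dbf_le_pmean:
  assumes "K \<ge> 0"
  shows "\<exists>C>0. \<forall>R y j s a L. strict_mono y \<longrightarrow> degree R \<le> d \<longrightarrow> L > 0 \<longrightarrow>
     (\<forall>i\<in>{j + 1..j + int d}. \<bar>y i - a\<bar> \<le> K * L) \<longrightarrow> norm (dbf (Suc d) y j R s) \<le> C * pmean R a L"
proof -
  obtain C where C: "C > 0" "\<And>R a L n. degree R \<le> d \<Longrightarrow> L > 0 \<Longrightarrow>
      norm (coeff (R \<circ>\<^sub>p [:of_real a, of_real L:]) n) \<le> C * pmean R a L"
    using coeff_le_pmean[of d] by blast
  define c where "c \<nu> = (fact (d - \<nu>) / fact d) * (1 + K) ^ d * fact \<nu>" for \<nu>
  have "norm (dbf (Suc d) y j R s) \<le> C * (\<Sum>\<nu>\<le>d. c \<nu>) * pmean R a L"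
    if y: "strict_mono y" and R: "degree R \<le> d" and L: "L > 0"
      and near: "\<forall>i\<in>{j + 1..j + int d}. \<bar>y i - a\<bar> \<le> K * L" for R y j s a L
  proof -
    let ?P = "\<Prod>i\<in>{j + 1..j + int d}. [:complex_of_real a - of_real (y i), 1:]"
    have summand: "norm ((-1) ^ \<nu> * complex_of_real (poly ((pderiv ^^ (Suc d - \<nu> - 1)) (varpi (Suc d) y j)) a) *
         poly ((pderiv ^^ \<nu>) R) (of_real a)) \<le> c \<nu> * (C * pmean R a L)" if \<nu>: "\<nu> \<le> d" for \<nu>
    proof -
      have "norm (coeff ?P (d - \<nu>)) * L ^ (d - \<nu>) \<le> (1 + K) ^ d * L ^ d"
        using coeff_prod_linear_bound[of "{j + 1..j + int d}" "\<lambda>i. complex_of_real a - of_real (y i)" K L "d - \<nu>"]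
          near L assms by (simp add: abs_minus_commute flip: of_real_diff)
      also have "L ^ d = L ^ \<nu> * L ^ (d - \<nu>)" using \<nu> by (simp flip: power_add)
      finally have P: "norm (coeff ?P (d - \<nu>)) \<le> (1 + K) ^ d * L ^ \<nu>"
        using L by simp
      have "poly ((pderiv ^^ \<nu>) R) (of_real a) * of_real L ^ \<nu>
          = fact \<nu> * coeff (R \<circ>\<^sub>p [:of_real a, of_real L:]) \<nu>"
        by (simp add: higher_pderiv_shift coeff_pcompose_scale[of R "of_real a" "of_real L"])
      then have "norm (poly ((pderiv ^^ \<nu>) R) (of_real a) * of_real L ^ \<nu>)
          = norm (fact \<nu> * coeff (R \<circ>\<^sub>p [:of_real a, of_real L:]) \<nu>)"
        by (rule arg_cong)
      then have "norm (poly ((pderiv ^^ \<nu>) R) (of_real a)) * L ^ \<nu>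
          = fact \<nu> * norm (coeff (R \<circ>\<^sub>p [:of_real a, of_real L:]) \<nu>)"
        using L by (simp only: norm_mult norm_power norm_of_real norm_fact abs_of_pos)
      also have "\<dots> \<le> fact \<nu> * (C * pmean R a L)"
        by (intro mult_left_mono C(2)[OF R L]) auto
      finally have R': "norm (poly ((pderiv ^^ \<nu>) R) (of_real a)) * L ^ \<nu> \<le> fact \<nu> * (C * pmean R a L)" .
      have "norm ((-1) ^ \<nu> * complex_of_real (poly ((pderiv ^^ (Suc d - \<nu> - 1)) (varpi (Suc d) y j)) a) *
         poly ((pderiv ^^ \<nu>) R) (of_real a))
          = fact (d - \<nu>) / fact d * norm (coeff ?P (d - \<nu>)) * norm (poly ((pderiv ^^ \<nu>) R) (of_real a))"
        using varpi_derivative[of "d - \<nu>" d y j a]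
        by (simp add: norm_mult norm_divide norm_power del: norm_of_real)
      also have "\<dots> \<le> fact (d - \<nu>) / fact d * ((1 + K) ^ d * L ^ \<nu>) * norm (poly ((pderiv ^^ \<nu>) R) (of_real a))"
        by (intro mult_right_mono mult_left_mono P) auto
      also have "\<dots> = fact (d - \<nu>) / fact d * (1 + K) ^ d * (norm (poly ((pderiv ^^ \<nu>) R) (of_real a)) * L ^ \<nu>)"
        by simp
      also have "\<dots> \<le> fact (d - \<nu>) / fact d * (1 + K) ^ d * (fact \<nu> * (C * pmean R a L))"
        using assms by (intro mult_left_mono R') auto
      finally show ?thesis by (simp add: c_def algebra_simps)
    qed
    have "dbf (Suc d) y j R s = dbf (Suc d) y j R a" by (rule dbf_indep[OF y R])
    also have "norm \<dots> \<le> (\<Sum>\<nu>\<le>d. c \<nu> * (C * pmean R a L))"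
      unfolding dbf_def lessThan_Suc_atMost by (intro sum_norm_le summand) simp
    also have "\<dots> = (\<Sum>\<nu>\<le>d. c \<nu>) * (C * pmean R a L)"
      by (simp only: sum_distrib_right)
    finally show ?thesis by (simp only: mult_ac)
  qed
  moreover have "(\<Sum>\<nu>\<le>d. c \<nu>) > 0" using assms by (intro sum_pos) (auto simp: c_def)
  ultimately show ?thesis using C(1) by (intro exI[of _ "C * (\<Sum>\<nu>\<le>d. c \<nu>)"]) auto
qed

subsection \<open>Whitney's inequality on the unit interval\<close>

definition fdiff :: "nat \<Rightarrow> real \<Rightarrow> (real \<Rightarrow> complex) \<Rightarrow> real \<Rightarrow> complex" where
  "fdiff k h g t = (\<Sum>i\<le>k. (-1) ^ (k + i) * of_nat (k choose i) * g (t + real i * h))"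

lemma alternating_sum_Suc:
  fixes f :: "nat \<Rightarrow> 'a :: comm_ring_1"
  shows "(\<Sum>l\<le>Suc k. (-1) ^ (Suc k + l) * of_nat (Suc k choose l) * f l)
    = (\<Sum>l\<le>k. (-1) ^ (k + l) * of_nat (k choose l) * (f (Suc l) - f l))"
proof -
  have "(\<Sum>l\<le>Suc k. (-1) ^ (Suc k + l) * of_nat (Suc k choose l) * f l)
      = (-1) ^ Suc k * f 0 + (\<Sum>l\<le>k. (-1) ^ (k + l) * of_nat (Suc k choose Suc l) * f (Suc l))"
    by (subst sum.atMost_Suc_shift) simp
  also have "(\<Sum>l\<le>k. (-1) ^ (k + l) * of_nat (Suc k choose Suc l) * f (Suc l))
      = (\<Sum>l\<le>k. (-1) ^ (k + l) * of_nat (k choose l) * f (Suc l))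
        + (\<Sum>l\<le>k. (-1) ^ (k + l) * of_nat (k choose Suc l) * f (Suc l))"
    by (simp add: algebra_simps flip: sum.distrib)
  also have "(-1) ^ Suc k * f 0 + \<dots> = (\<Sum>l\<le>k. (-1) ^ (k + l) * of_nat (k choose l) * f (Suc l))
        - ((-1) ^ k * f 0 + (\<Sum>l\<le>k. (-1) ^ (k + Suc l) * of_nat (k choose Suc l) * f (Suc l)))"
    by (simp add: sum_negf)
  also have "(-1) ^ k * f 0 + (\<Sum>l\<le>k. (-1) ^ (k + Suc l) * of_nat (k choose Suc l) * f (Suc l))
      = (\<Sum>l\<le>Suc k. (-1) ^ (k + l) * of_nat (k choose l) * f l)"
    by (subst sum.atMost_Suc_shift) simp
  also have "\<dots> = (\<Sum>l\<le>k. (-1) ^ (k + l) * of_nat (k choose l) * f l)"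
    by (simp add: binomial_eq_0)
  finally show ?thesis by (simp add: algebra_simps sum_subtractf)
qed

lemma alternating_sum_power:
  fixes a :: "'a :: {comm_ring_1, semiring_char_0}"
  assumes "n \<le> k"
  shows "(\<Sum>l\<le>k. (-1) ^ (k + l) * of_nat (k choose l) * (a + of_nat l) ^ n) = (if n = k then fact k else 0)"
  using assms
proof (induction k arbitrary: n)
  case 0
  then show ?case by simp
next
  case (Suc k)
  have diff: "(a + of_nat (Suc l)) ^ n - (a + of_nat l) ^ n = (\<Sum>m<n. of_nat (n choose m) * (a + of_nat l) ^ m)" for l
  proof -
    have "(a + of_nat (Suc l)) ^ n = ((a + of_nat l) + 1) ^ n" by (simp add: algebra_simps)
    also have "\<dots> = (\<Sum>m\<le>n. of_nat (n choose m) * (a + of_nat l) ^ m)"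
      by (simp add: binomial_ring)
    also have "\<dots> = (\<Sum>m<n. of_nat (n choose m) * (a + of_nat l) ^ m) + (a + of_nat l) ^ n"
      by (simp flip: lessThan_Suc_atMost)
    finally show ?thesis by simp
  qed
  have "(\<Sum>l\<le>Suc k. (-1) ^ (Suc k + l) * of_nat (Suc k choose l) * (a + of_nat l) ^ n)
      = (\<Sum>l\<le>k. (-1) ^ (k + l) * of_nat (k choose l) * (\<Sum>m<n. of_nat (n choose m) * (a + of_nat l) ^ m))"
    unfolding alternating_sum_Suc diff ..
  also have "\<dots> = (\<Sum>m<n. of_nat (n choose m) * (\<Sum>l\<le>k. (-1) ^ (k + l) * of_nat (k choose l) * (a + of_nat l) ^ m))"
    unfolding sum_distrib_left by (subst sum.swap) (simp only: mult_ac)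
  also have "\<dots> = (\<Sum>m<n. of_nat (n choose m) * (if m = k then fact k else 0))"
    using Suc.prems by (intro sum.cong refl arg_cong2[where f = "(*)"] Suc.IH) auto
  also have "\<dots> = (if n = Suc k then fact (Suc k) else 0)"
    using Suc.prems by (auto simp: if_distrib[of "\<lambda>x. _ * x"] algebra_simps cong: if_cong)
  finally show ?case .
qed

section \<open>Truncated powers and the Peano kernel\<close>

definition tpow :: "nat \<Rightarrow> real \<Rightarrow> real" where
  "tpow d v = max 0 v ^ d / fact d"

lemma tpow_measurable [measurable]: "tpow d \<in> borel_measurable borel"
  unfolding tpow_def by measurable

lemma tpow_nonneg: "tpow d v \<ge> 0"
  by (simp add: tpow_def)

lemma tpow_mult: "u \<ge> 0 \<Longrightarrow> tpow d (u * v) = u ^ d * tpow d v"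
  by (auto simp: tpow_def max_def power_mult_distrib zero_le_mult_iff mult_le_0_iff)

lemma tpow_bound:
  assumes "\<bar>v\<bar> \<le> K"
  shows "tpow d v \<le> K ^ d"
proof -
  have "max 0 v ^ d \<le> K ^ d" using assms by (intro power_mono) auto
  moreover have "max 0 v ^ d / fact d \<le> max 0 v ^ d / 1"
    by (intro divide_left_mono) (auto simp: fact_ge_1)
  ultimately show ?thesis by (simp add: tpow_def)
qed

text \<open>The B-spline of degree \<open>k - 1\<close> with knots \<open>0, \<dots>, k\<close> as Peano kernel of the \<open>k\<close>-th difference.\<close>

definition peano :: "nat \<Rightarrow> real \<Rightarrow> real" where
  "peano k s = (\<Sum>l\<le>k. (-1) ^ (k + l) * real (k choose l) * tpow (k - 1) (real l - s))"

text \<open>Left of 0 no power is truncated, and the sum is a \<open>k\<close>-th difference of a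
  polynomial of degree \<open>k - 1\<close>; right of \<open>k\<close> every power is truncated to
  0.\<close>

lemma peano_outside:
  assumes "k \<ge> 2" "s \<notin> {0..real k}"
  shows "peano k s = 0"
proof (cases "s < 0")
  case True
  have "peano k s = (\<Sum>l\<le>k. (-1) ^ (k + l) * real (k choose l) * (- s + real l) ^ (k - 1)) / fact (k - 1)"
    unfolding peano_def sum_divide_distrib using True
    by (intro sum.cong refl) (simp add: tpow_def max_def algebra_simps)
  also have "\<dots> = 0" using assms(1) by (subst alternating_sum_power) auto
  finally show ?thesis .
next
  case False
  then have "tpow (k - 1) (real l - s) = 0" if "l \<le> k" for l
    using that assms by (auto simp: tpow_def max_def)
  then show ?thesis by (simp add: peano_def)
qed

lemma peano_bound: "\<exists>C>0. \<forall>s. k \<ge> 2 \<longrightarrow> \<bar>peano k s\<bar> \<le> C"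
proof -
  define C where "C = (\<Sum>l\<le>k. real (k choose l) * real k ^ (k - 1)) + 1"
  have C: "C > 0" unfolding C_def by (intro add_nonneg_pos sum_nonneg) auto
  have "\<bar>peano k s\<bar> \<le> C" if "k \<ge> 2" for s
  proof (cases "s \<in> {0..real k}")
    case True
    have "\<bar>peano k s\<bar> \<le> (\<Sum>l\<le>k. real (k choose l) * real k ^ (k - 1))"
      unfolding peano_def
    proof (rule order_trans[OF sum_abs sum_mono])
      fix l assume "l \<in> {..k}"
      then have "tpow (k - 1) (real l - s) \<le> real k ^ (k - 1)"
        using True by (intro tpow_bound) auto
      then show "\<bar>(-1) ^ (k + l) * real (k choose l) * tpow (k - 1) (real l - s)\<bar>
          \<le> real (k choose l) * real k ^ (k - 1)"
        by (simp add: abs_mult power_abs tpow_nonneg mult_left_mono)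
    qed
    then show ?thesis by (simp add: C_def)
  next
    case False
    then show ?thesis using peano_outside[OF that] C by simp
  qed
  then show ?thesis using C by blast
qed

lemma integral_tpow:
  assumes "0 \<le> a" "a \<le> b" "d \<ge> 1"
  shows "has_bochner_integral lborel (\<lambda>s. tpow d (a - s) * indicator {0..b} s) (a ^ Suc d / fact (Suc d))"
proof -
  have "has_bochner_integral lborel (\<lambda>s. (a - s) ^ d / fact d * indicator {0..a} s)
      (- ((a - a) ^ Suc d / fact (Suc d)) - (- ((a - 0) ^ Suc d / fact (Suc d))))"
  proof (rule has_bochner_integral_FTC_Icc_nonneg[where f = "\<lambda>s. (a - s) ^ d / fact d"
        and F = "\<lambda>s. - ((a - s) ^ Suc d / fact (Suc d))"])
    fix s assume "s \<in> {0..a}"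
    have "((\<lambda>s. - ((a - s) ^ Suc d / fact (Suc d))) has_real_derivative
        - (real (Suc d) * (a - s) ^ d * (0 - 1) / fact (Suc d))) (at s)"
      by (auto intro!: derivative_eq_intros simp del: power_Suc fact_Suc)
    also have "- (real (Suc d) * (a - s) ^ d * (0 - 1) / fact (Suc d)) = (a - s) ^ d / fact d"
      by (simp add: divide_simps)
    finally show "((\<lambda>s. - ((a - s) ^ Suc d / fact (Suc d))) has_real_derivative (a - s) ^ d / fact d) (at s)" .
  qed (use assms in auto)
  moreover have "(a - s) ^ d / fact d * indicator {0..a} s = tpow d (a - s) * indicator {0..b} s" for s
    using assms by (auto simp: tpow_def indicator_def max_def)
  ultimately show ?thesis by simp
qed

text \<open>Total mass 1 is what lets an average against this kernel keep a constant term such as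
  \<open>g x\<close> unchanged. The value is the \<open>k\<close>-th difference of
  \<open>l ^ k / fact k\<close>.\<close>

lemma integral_peano:
  assumes "k \<ge> 2"
  shows "has_bochner_integral lborel (peano k) 1"
proof -
  have "has_bochner_integral lborel (\<lambda>s. \<Sum>l\<le>k. (-1) ^ (k + l) * real (k choose l) *
        (tpow (k - 1) (real l - s) * indicator {0..real k} s))
      (\<Sum>l\<le>k. (-1) ^ (k + l) * real (k choose l) * (real l ^ Suc (k - 1) / fact (Suc (k - 1))))"
    by (intro has_bochner_integral_sum has_bochner_integral_mult_right integral_tpow) (use assms in auto)
  moreover have "(\<Sum>l\<le>k. (-1) ^ (k + l) * real (k choose l) * (tpow (k - 1) (real l - s) * indicator {0..real k} s))
      = peano k s" for s
  proof (cases "s \<in> {0..real k}")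
    case True
    then show ?thesis by (simp add: peano_def)
  next
    case False
    then show ?thesis using peano_outside[OF assms False] by simp
  qed
  moreover have "(\<Sum>l\<le>k. (-1) ^ (k + l) * real (k choose l) * (real l ^ Suc (k - 1) / fact (Suc (k - 1)))) = 1"
  proof -
    have "(\<Sum>l\<le>k. (-1) ^ (k + l) * real (k choose l) * (real l ^ k / fact k))
        = (\<Sum>l\<le>k. (-1) ^ (k + l) * real (k choose l) * (0 + real l) ^ k) / fact k"
      by (simp add: sum_divide_distrib)
    also have "\<dots> = 1" by (subst alternating_sum_power) auto
    finally show ?thesis using assms by simp
  qed
  ultimately show ?thesis by simp
qed

lemma fdiff_integrable:
  assumes "integrable lborel g"
  shows "integrable lborel (fdiff k h g)"
proof -
  have "integrable lborel (\<lambda>t. g (t + a))" for a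
    using lborel_integrable_real_affine[OF assms, of 1 a] by (simp add: add.commute)
  then show ?thesis
    unfolding fdiff_def by (intro Bochner_Integration.integrable_sum integrable_mult_right)
qed

lemma integrable_bounded_factor:
  fixes g :: "real \<Rightarrow> complex"
  assumes "integrable lborel g" and [measurable]: "B \<in> borel_measurable borel"
    and "\<And>t. g t \<noteq> 0 \<Longrightarrow> \<bar>B t\<bar> \<le> K"
  shows "integrable lborel (\<lambda>t. of_real (B t) * g t)"
proof (rule Bochner_Integration.integrable_bound)
  show "integrable lborel (\<lambda>t. of_real K * g t)" using assms(1) by simp
  have [measurable]: "g \<in> borel_measurable borel" using assms(1) by (simp add: integrable_iff_bounded)
  show "(\<lambda>t. of_real (B t) * g t) \<in> borel_measurable lborel" by measurable
  show "AE t in lborel. norm (of_real (B t) * g t) \<le> norm (of_real K * g t)"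
  proof (rule AE_I2)
    fix t
    show "norm (of_real (B t) * g t) \<le> norm (of_real K * g t)"
      using assms(3)[of t] by (cases "g t = 0") (auto simp: norm_mult intro!: mult_right_mono)
  qed
qed

text \<open>Expanded over the nodes, both sides become the same combination of integrals of
  truncated powers, shifted by \<open>l * u\<close>, against \<open>g\<close>: the left by
  \<open>t = x + u * s\<close>, the right by \<open>t = s + l * u\<close>. A weighted average of
  values of \<open>g\<close> is thus expressed by differences with the single step
  \<open>u\<close>.\<close>

lemma peano_identity:
  fixes g :: "real \<Rightarrow> complex"
  assumes g: "integrable lborel g" and supp: "\<And>t. t \<notin> {0..1} \<Longrightarrow> g t = 0" and u: "u > 0" and k: "k \<ge> 2"
  shows "integrable lborel (\<lambda>s. of_real (peano k s) * g (x + u * s))" (is ?A)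
    and "integrable lborel (\<lambda>s. of_real (tpow (k - 1) (x - s)) * fdiff k u g s)" (is ?B)
    and "of_real (u ^ k) * (\<integral>s. of_real (peano k s) * g (x + u * s) \<partial>lborel)
      = (\<integral>s. of_real (tpow (k - 1) (x - s)) * fdiff k u g s \<partial>lborel)" (is ?C)
proof -
  let ?c = "\<lambda>l. (-1) ^ (k + l) * complex_of_nat (k choose l)"
  \<comment> \<open>The common integrand, in the variable \<open>t\<close>. It is integrable because
    \<open>g\<close> lives on the unit interval, where the kernel is bounded.\<close>
  define f where "f l t = complex_of_real (tpow (k - 1) (x + real l * u - t)) * g t" for l t
  have f: "integrable lborel (f l)" for l
    unfolding f_def
  proof (rule integrable_bounded_factor[OF g])
    fix t assume "g t \<noteq> 0"
    then have "t \<in> {0..1}" using supp by blast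
    then have "\<bar>x + real l * u - t\<bar> \<le> \<bar>x + real l * u\<bar> + 1"
      unfolding atLeastAtMost_iff by linarith
    then show "\<bar>tpow (k - 1) (x + real l * u - t)\<bar> \<le> (\<bar>x + real l * u\<bar> + 1) ^ (k - 1)"
      using tpow_bound[of "x + real l * u - t" "\<bar>x + real l * u\<bar> + 1" "k - 1"] by (simp add: tpow_nonneg)
  qed measurable
  have f1: "f l (x + u * s) = of_real (u ^ (k - 1)) * (of_real (tpow (k - 1) (real l - s)) * g (x + u * s))" for l s
  proof -
    have "x + real l * u - (x + u * s) = u * (real l - s)" by (simp add: algebra_simps)
    then show ?thesis using u by (simp add: f_def tpow_mult)
  qed
  have f2: "f l (real l * u + 1 * s) = of_real (tpow (k - 1) (x - s)) * g (s + real l * u)" for l s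
    by (simp add: f_def algebra_simps)
  have i1: "integrable lborel (\<lambda>s. f l (x + u * s))" for l
    using lborel_integrable_real_affine[OF f, of u l x] u by simp
  then have i1': "integrable lborel (\<lambda>s. of_real (tpow (k - 1) (real l - s)) * g (x + u * s))" for l
  proof -
    have "integrable lborel (\<lambda>s. of_real (1 / u ^ (k - 1)) *
        (of_real (u ^ (k - 1)) * (of_real (tpow (k - 1) (real l - s)) * g (x + u * s))))"
      using i1[of l] unfolding f1 by (rule integrable_mult_right)
    then show ?thesis using u by (simp flip: mult.assoc)
  qed
  have i2: "integrable lborel (\<lambda>s. f l (real l * u + 1 * s))" for l
    by (rule lborel_integrable_real_affine[OF f]) simp
  have e1: "of_real (peano k s) * g (x + u * s) = (\<Sum>l\<le>k. ?c l * (of_real (tpow (k - 1) (real l - s)) * g (x + u * s)))" for s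
    by (simp add: peano_def sum_distrib_right mult.assoc)
  have e2: "of_real (tpow (k - 1) (x - s)) * fdiff k u g s = (\<Sum>l\<le>k. ?c l * f l (real l * u + 1 * s))" for s
    unfolding f2 by (simp add: fdiff_def sum_distrib_left mult_ac)
  show ?A unfolding e1 by (intro Bochner_Integration.integrable_sum integrable_mult_right i1')
  show ?B unfolding e2 by (intro Bochner_Integration.integrable_sum integrable_mult_right i2)
  have uk: "complex_of_real (u ^ k) = of_real u * of_real (u ^ (k - 1))"
    using k by (cases k) auto
  have "of_real (u ^ k) * (\<integral>s. of_real (peano k s) * g (x + u * s) \<partial>lborel)
      = (\<Sum>l\<le>k. ?c l * (of_real u * (\<integral>s. f l (x + u * s) \<partial>lborel)))"
  proof -
    have "of_real u * (\<integral>s. f l (x + u * s) \<partial>lborel)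
        = of_real (u ^ k) * (\<integral>s. of_real (tpow (k - 1) (real l - s)) * g (x + u * s) \<partial>lborel)" for l
      unfolding f1 integral_mult_right_zero uk by (simp only: mult.assoc)
    moreover have "(\<integral>s. of_real (peano k s) * g (x + u * s) \<partial>lborel)
        = (\<Sum>l\<le>k. ?c l * (\<integral>s. of_real (tpow (k - 1) (real l - s)) * g (x + u * s) \<partial>lborel))"
      unfolding e1 integral_mult_right_zero[symmetric]
      by (intro Bochner_Integration.integral_sum integrable_mult_right i1')
    ultimately show ?thesis by (simp only: sum_distrib_left mult_ac)
  qed
  also have "\<dots> = (\<Sum>l\<le>k. ?c l * (\<integral>t. f l t \<partial>lborel))"
    using u lborel_integral_real_affine[of u "f _" x] by (simp add: scaleR_conv_of_real)
  also have "\<dots> = (\<Sum>l\<le>k. ?c l * (\<integral>s. f l (real l * u + 1 * s) \<partial>lborel))"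
  proof (intro sum.cong refl arg_cong2[where f = "(*)"])
    show "(\<integral>t. f l t \<partial>lborel) = (\<integral>s. f l (real l * u + 1 * s) \<partial>lborel)" for l
      using lborel_integral_real_affine[of 1 "f l" "real l * u"] by simp
  qed
  also have "\<dots> = (\<integral>s. of_real (tpow (k - 1) (x - s)) * fdiff k u g s \<partial>lborel)"
    unfolding e2 integral_mult_right_zero[symmetric]
    by (intro Bochner_Integration.integral_sum[symmetric] integrable_mult_right i2)
  finally show ?C .
qed

lemma powr_sum_le:
  fixes a b q :: real
  assumes "a \<ge> 0" "b \<ge> 0" "q \<ge> 0"
  shows "(a + b) powr q \<le> 2 powr q * (a powr q + b powr q)"
proof -
  have "(a + b) powr q \<le> (2 * max a b) powr q"
    using assms by (intro powr_mono2) auto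
  also have "\<dots> = 2 powr q * max a b powr q"
    using assms by (simp add: powr_mult)
  also have "\<dots> \<le> 2 powr q * (a powr q + b powr q)"
    by (intro mult_left_mono) (auto simp: max_def)
  finally show ?thesis .
qed

text \<open>A number above \<open>\<epsilon>\<close> has quotient at least 1 by it, which the power
  \<open>q\<close> only enlarges. Combined with a choice of \<open>\<epsilon>\<close> this yields
  the forms of Hoelder's inequality used below.\<close>

lemma le_eps_powr:
  fixes y \<epsilon> q :: real
  assumes "y \<ge> 0" "\<epsilon> > 0" "q \<ge> 1"
  shows "y \<le> \<epsilon> + \<epsilon> powr (1 - q) * y powr q"
proof (cases "y \<le> \<epsilon>")
  case False
  have "(y / \<epsilon>) powr 1 \<le> (y / \<epsilon>) powr q"
    using False assms by (intro powr_mono) auto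
  then have "y \<le> \<epsilon> * (y / \<epsilon>) powr q"
    using False assms by (simp add: field_simps)
  also have "\<dots> = \<epsilon> powr (1 - q) * y powr q"
    using False assms by (simp add: powr_divide powr_diff)
  finally show ?thesis using assms by simp
qed (simp add: add_increasing2)

text \<open>Hoelder's inequality up to the factor 2, obtained by integrating \<open>le_eps_powr\<close>.\<close>

lemma nn_integral_powr_mean:
  assumes [measurable]: "\<phi> \<in> borel_measurable M" "S \<in> sets M"
    and S: "emeasure M S \<le> ennreal l" and l: "l > 0" and q: "q \<ge> 1" and w: "w \<ge> 0"
    and nonneg: "\<And>t. \<phi> t \<ge> 0"
    and le: "(\<integral>\<^sup>+t\<in>S. ennreal (\<phi> t powr q) \<partial>M) \<le> ennreal (l * w powr q)"
  shows "(\<integral>\<^sup>+t\<in>S. ennreal (\<phi> t) \<partial>M) \<le> ennreal (2 * w * l)"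
proof -
  have *: "(\<integral>\<^sup>+t\<in>S. ennreal (\<phi> t) \<partial>M) \<le> ennreal (l * (\<epsilon> + \<epsilon> powr (1 - q) * w powr q))" if \<epsilon>: "\<epsilon> > 0" for \<epsilon>
  proof -
    have "(\<integral>\<^sup>+t\<in>S. ennreal (\<phi> t) \<partial>M)
        \<le> (\<integral>\<^sup>+t. ennreal \<epsilon> * indicator S t + ennreal (\<epsilon> powr (1 - q)) * (ennreal (\<phi> t powr q) * indicator S t) \<partial>M)"
    proof (rule nn_integral_mono)
      fix t
      have "ennreal (\<phi> t) \<le> ennreal \<epsilon> + ennreal (\<epsilon> powr (1 - q)) * ennreal (\<phi> t powr q)"
        using le_eps_powr[OF nonneg \<epsilon> q, of t] \<epsilon> by (simp flip: ennreal_plus ennreal_mult')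
      then show "ennreal (\<phi> t) * indicator S t
          \<le> ennreal \<epsilon> * indicator S t + ennreal (\<epsilon> powr (1 - q)) * (ennreal (\<phi> t powr q) * indicator S t)"
        by (auto simp: indicator_def)
    qed
    also have "\<dots> = ennreal \<epsilon> * emeasure M S + ennreal (\<epsilon> powr (1 - q)) * (\<integral>\<^sup>+t\<in>S. ennreal (\<phi> t powr q) \<partial>M)"
      by (subst nn_integral_add) (auto simp: nn_integral_cmult)
    also have "\<dots> \<le> ennreal \<epsilon> * ennreal l + ennreal (\<epsilon> powr (1 - q)) * ennreal (l * w powr q)"
      by (intro add_mono mult_left_mono S le) auto
    also have "\<dots> = ennreal (l * (\<epsilon> + \<epsilon> powr (1 - q) * w powr q))"
      using \<epsilon> l by (simp add: algebra_simps flip: ennreal_plus ennreal_mult')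
    finally show ?thesis .
  qed
  \<comment> \<open>The choice \<open>\<epsilon> = w\<close> balances the two terms and produces the
    factor 2; for \<open>w = 0\<close> the number \<open>\<epsilon>\<close> is made arbitrarily
    small instead.\<close>
  show ?thesis
  proof (cases "w = 0")
    case True
    have "(\<integral>\<^sup>+t\<in>S. ennreal (\<phi> t) \<partial>M) \<le> 0 + ennreal e" if "e > 0" for e
      using *[of "e / l"] that l True by simp
    then have "(\<integral>\<^sup>+t\<in>S. ennreal (\<phi> t) \<partial>M) \<le> 0"
      by (rule ennreal_le_epsilon)
    then show ?thesis by simp
  next
    case False
    have "w powr (1 - q) * w powr q = w" using False w by (simp flip: powr_add)
    then show ?thesis using *[of w] False w by (simp add: algebra_simps)
  qed
qed

text \<open>For \<open>s < 0 \<le> x\<close> the power is not truncated, hence a polynomial in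
  \<open>x\<close> by the binomial theorem; for \<open>s > r\<close> it vanishes. Only the strip
  between 0 and \<open>r\<close> is left as a true remainder.\<close>

lemma tpow_split:
  fixes x s :: real
  assumes "0 \<le> x" "x \<le> r" "d \<ge> 1"
  shows "tpow d (x - s) = (\<Sum>n\<le>d. real (d choose n) / fact d * x ^ n * (indicator {..<0} s * (- s) ^ (d - n)))
     + indicator {0..r} s * tpow d (x - s)"
proof -
  consider "s < 0" | "0 \<le> s" "s \<le> r" | "r < s" by linarith
  then show ?thesis
  proof cases
    case 1
    have "(x + (- s)) ^ d = (\<Sum>n\<le>d. real (d choose n) * x ^ n * (- s) ^ (d - n))"
      by (rule binomial_ring)
    then show ?thesis using 1 assms
      by (simp add: tpow_def sum_divide_distrib)
  next
    case 3
    then show ?thesis using assms by (simp add: tpow_def)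
  qed (use assms in auto)
qed

text \<open>The part of the convolution over \<open>s < 0\<close> is a polynomial in
  \<open>x\<close> whose coefficients are moments of the difference. They involve the jump of the
  zero extension and have no useful bound, but enter only \<open>R\<close>. The rest runs over base
  points in \<open>{0..2/3}\<close>, where the hypothesis controls the difference.\<close>

lemma whitney_remainder:
  fixes g :: "real \<Rightarrow> complex" and q :: real
  assumes k: "k \<ge> 2" and q: "q \<ge> 1" and g: "integrable lborel g"
    and supp: "\<And>t. t \<notin> {0..1} \<Longrightarrow> g t = 0" and W: "W \<ge> 0" and u: "u > 0"
    and le: "(\<integral>\<^sup>+t\<in>{0..2/3}. ennreal (norm (fdiff k u g t) powr q) \<partial>lborel) \<le> ennreal (W powr q)"
  shows "\<exists>R. degree R \<le> k - 1 \<and> (\<forall>x\<in>{0..2/3}.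
    norm ((\<integral>s. of_real (tpow (k - 1) (x - s)) * fdiff k u g s \<partial>lborel) - poly_real R x) \<le> 2 * W)"
proof -
  define d where "d = k - 1"
  have d: "d \<ge> 1" using k by (simp add: d_def)
  let ?G = "fdiff k u g"
  have G: "integrable lborel ?G" by (rule fdiff_integrable[OF g])
  then have [measurable]: "?G \<in> borel_measurable borel" by (simp add: integrable_iff_bounded)
  have Gsupp: "\<bar>s\<bar> \<le> 1 + real k * u" if "?G s \<noteq> 0" for s
  proof -
    have "\<exists>i\<le>k. g (s + real i * u) \<noteq> 0"
    proof (rule ccontr)
      assume "\<not> (\<exists>i\<le>k. g (s + real i * u) \<noteq> 0)"
      then show False using that by (simp add: fdiff_def)
    qed
    then obtain i where i: "i \<le> k" "g (s + real i * u) \<noteq> 0" by blast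
    then have "s + real i * u \<in> {0..1}" using supp by blast
    moreover have "0 \<le> real i * u" "real i * u \<le> real k * u" using i u by auto
    ultimately show ?thesis unfolding atLeastAtMost_iff abs_le_iff by linarith
  qed
  define a where "a n s = indicator {..<0} s * (- s) ^ (d - n)" for n and s :: real
  have [measurable]: "a n \<in> borel_measurable borel" for n unfolding a_def by measurable
  have ia: "integrable lborel (\<lambda>s. of_real (a n s) * ?G s)" for n
  proof (rule integrable_bounded_factor[OF G])
    show "\<bar>a n s\<bar> \<le> (1 + real k * u) ^ (d - n)" if "?G s \<noteq> 0" for s
      using power_mono[OF Gsupp[OF that], of "d - n"] u by (auto simp: a_def indicator_def power_abs)
  qed measurable
  define R where "R = (\<Sum>n\<le>d. monom (of_nat (d choose n) / fact d * (\<integral>s. of_real (a n s) * ?G s \<partial>lborel)) n)"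
  have "degree R \<le> d"
    unfolding R_def by (intro degree_sum_le) (auto intro: order_trans[OF degree_monom_le])
  moreover have "norm ((\<integral>s. of_real (tpow d (x - s)) * ?G s \<partial>lborel) - poly_real R x) \<le> 2 * W"
    if x: "x \<in> {0..2/3}" for x
  proof -
    define e where "e s = indicator {0..2/3} s * tpow d (x - s)" for s
    have [measurable]: "e \<in> borel_measurable borel" unfolding e_def by measurable
    have e1: "\<bar>e s\<bar> \<le> indicator {0..2/3} s" for s
      using tpow_bound[of "x - s" 1 d] x by (auto simp: e_def indicator_def tpow_nonneg)
    have ie: "integrable lborel (\<lambda>s. of_real (e s) * ?G s)"
    proof (rule integrable_bounded_factor[OF G])
      show "\<bar>e s\<bar> \<le> 1" for s by (rule order_trans[OF e1]) (rule indicator_le_1)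
    qed measurable
    have "of_real (tpow d (x - s)) * ?G s = (\<Sum>n\<le>d. (of_nat (d choose n) / fact d * of_real x ^ n) * (of_real (a n s) * ?G s))
        + of_real (e s) * ?G s" for s
      using x d by (subst tpow_split[of x "2/3" d s])
        (simp_all add: a_def e_def distrib_right sum_distrib_right mult.assoc)
    then have "(\<integral>s. of_real (tpow d (x - s)) * ?G s \<partial>lborel)
        = (\<integral>s. (\<Sum>n\<le>d. (of_nat (d choose n) / fact d * of_real x ^ n) * (of_real (a n s) * ?G s))
        + of_real (e s) * ?G s \<partial>lborel)"
      by simp
    also have "\<dots> = (\<Sum>n\<le>d. (of_nat (d choose n) / fact d * of_real x ^ n) * (\<integral>s. of_real (a n s) * ?G s \<partial>lborel))
        + (\<integral>s. of_real (e s) * ?G s \<partial>lborel)"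
      by (subst Bochner_Integration.integral_add[OF Bochner_Integration.integrable_sum[OF integrable_mult_right[OF ia]] ie])
        (subst Bochner_Integration.integral_sum[OF integrable_mult_right[OF ia]], simp)
    also have "(\<Sum>n\<le>d. (of_nat (d choose n) / fact d * of_real x ^ n) * (\<integral>s. of_real (a n s) * ?G s \<partial>lborel))
        = poly_real R x"
      by (simp add: R_def poly_real_def poly_sum poly_monom mult_ac)
    finally have eq: "(\<integral>s. of_real (tpow d (x - s)) * ?G s \<partial>lborel) - poly_real R x
        = (\<integral>s. of_real (e s) * ?G s \<partial>lborel)" by simp
    have "ennreal (norm (\<integral>s. of_real (e s) * ?G s \<partial>lborel)) \<le> (\<integral>\<^sup>+s. ennreal (norm (of_real (e s) * ?G s)) \<partial>lborel)"
      by (rule integral_norm_bound_ennreal[OF ie])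
    also have "\<dots> \<le> (\<integral>\<^sup>+s\<in>{0..2/3}. ennreal (norm (?G s)) \<partial>lborel)"
    proof (rule nn_integral_mono)
      fix s
      show "ennreal (norm (of_real (e s) * ?G s)) \<le> ennreal (norm (?G s)) * indicator {0..2/3} s"
        using e1[of s] mult_right_mono[of "\<bar>e s\<bar>" 1 "norm (?G s)"]
        by (auto simp: norm_mult indicator_def split: if_splits)
    qed
    also have "\<dots> \<le> ennreal (2 * W * 1)"
      by (rule nn_integral_powr_mean[where q = q]) (use q W le in auto)
    finally show ?thesis unfolding eq using W by simp
  qed
  ultimately show ?thesis unfolding d_def by blast
qed

text \<open>Averaging the difference with step \<open>\<delta> * s\<close> against
  \<open>peano k s\<close> keeps the term of node 0 as \<open>g x\<close> up to sign, by mass 1. The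
  node \<open>i \<ge> 1\<close> gives an average of \<open>g (x + u i * s)\<close>, which
  \<open>peano_identity\<close> rewrites as a convolution of differences with the fixed step
  \<open>u i\<close>. What remains is the averaged difference itself.\<close>

lemma whitney_two_thirds:
  fixes q :: real
  assumes k: "k \<ge> 2" and q: "q \<ge> 1"
  shows "\<exists>C>0. \<forall>g W. integrable lborel g \<longrightarrow> (\<forall>t. t \<notin> {0..1} \<longrightarrow> g t = 0) \<longrightarrow> W \<ge> 0 \<longrightarrow>
    (\<forall>h. 0 \<le> h \<longrightarrow> real k * h \<le> 1 \<longrightarrow>
      (\<integral>\<^sup>+t\<in>{0..1 - real k * h}. ennreal (norm (fdiff k h g t) powr q) \<partial>lborel) \<le> ennreal (W powr q)) \<longrightarrow>
    (\<exists>R. degree R \<le> k - 1 \<and>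
      (\<integral>\<^sup>+t\<in>{0..2/3}. ennreal (norm (g t - poly_real R t) powr q) \<partial>lborel) \<le> ennreal ((C * W) powr q))"
proof -
  obtain CM where CM: "CM > 0" "\<And>s. \<bar>peano k s\<bar> \<le> CM" using peano_bound[of k] k by blast
  \<comment> \<open>With \<open>s \<le> k\<close> and \<open>i \<le> k\<close>, both kinds of steps,
    \<open>\<delta> * s\<close> and \<open>u i\<close>, satisfy \<open>k * h \<le> 1 / 3\<close>, so
    base points up to 2/3 keep all their nodes inside the unit interval.\<close>
  define \<delta> where "\<delta> = 1 / (3 * real k ^ 2)"
  have \<delta>: "\<delta> > 0" using k by (simp add: \<delta>_def)
  define u where "u i = real i * \<delta>" for i
  define C1 where "C1 = (\<Sum>i\<in>{1..k}. real (k choose i) / u i ^ k * 2)"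
  define K where "K = 2 powr q * ((2 * CM * real k) powr q + C1 powr q)"
  define C where "C = K powr (1 / q)"
  have K: "K > 0" using CM k by (simp add: K_def add_pos_nonneg)
  have C1: "C1 \<ge> 0" unfolding C1_def using \<delta> by (intro sum_nonneg) (auto simp: u_def)
  have "\<exists>R. degree R \<le> k - 1 \<and>
      (\<integral>\<^sup>+t\<in>{0..2/3}. ennreal (norm (g t - poly_real R t) powr q) \<partial>lborel) \<le> ennreal ((C * W) powr q)"
    if g: "integrable lborel g" and supp: "\<forall>t. t \<notin> {0..1} \<longrightarrow> g t = 0" and W: "W \<ge> 0"
      and le: "\<forall>h. 0 \<le> h \<longrightarrow> real k * h \<le> 1 \<longrightarrow>
      (\<integral>\<^sup>+t\<in>{0..1 - real k * h}. ennreal (norm (fdiff k h g t) powr q) \<partial>lborel) \<le> ennreal (W powr q)"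
    for g W
  proof -
    have [measurable]: "g \<in> borel_measurable borel" using g by (simp add: integrable_iff_bounded)
    have supp': "g t = 0" if "t \<notin> {0..1}" for t using supp that by blast
    have le': "(\<integral>\<^sup>+t\<in>{0..2/3}. ennreal (norm (fdiff k h g t) powr q) \<partial>lborel) \<le> ennreal (W powr q)"
      if h: "0 \<le> h" "real k * h \<le> 1 / 3" for h
    proof -
      have "(\<integral>\<^sup>+t\<in>{0..2/3}. ennreal (norm (fdiff k h g t) powr q) \<partial>lborel)
          \<le> (\<integral>\<^sup>+t\<in>{0..1 - real k * h}. ennreal (norm (fdiff k h g t) powr q) \<partial>lborel)"
        using h by (intro nn_integral_mono) (auto simp: indicator_def)
      also have "\<dots> \<le> ennreal (W powr q)" using le h by auto
      finally show ?thesis .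
    qed
    have ki: "real k * u i \<le> 1 / 3" if "i \<le> k" for i
    proof -
      have "real k * u i \<le> real k * (real k * \<delta>)"
        using that \<delta> unfolding u_def by (intro mult_left_mono mult_right_mono) auto
      also have "\<dots> = 1 / 3" using k by (simp add: \<delta>_def power2_eq_square)
      finally show ?thesis .
    qed
    have u: "u i > 0" if "i \<in> {1..k}" for i using that \<delta> by (simp add: u_def)
    have "\<exists>R. degree R \<le> k - 1 \<and> (\<forall>x\<in>{0..2/3}.
        norm ((\<integral>s. of_real (tpow (k - 1) (x - s)) * fdiff k (u i) g s \<partial>lborel) - poly_real R x) \<le> 2 * W)"
      if "i \<in> {1..k}" for i
      by (rule whitney_remainder[OF k q g supp' W u[OF that] le'])
        (use that u[OF that] ki[of i] in auto)
    then obtain Rp where Rp: "\<And>i. i \<in> {1..k} \<Longrightarrow> degree (Rp i) \<le> k - 1"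
      "\<And>i x. i \<in> {1..k} \<Longrightarrow> x \<in> {0..2/3} \<Longrightarrow>
        norm ((\<integral>s. of_real (tpow (k - 1) (x - s)) * fdiff k (u i) g s \<partial>lborel) - poly_real (Rp i) x) \<le> 2 * W"
      by metis
    define c where "c i = (-1) ^ (k + i) * complex_of_nat (k choose i)" for i
    \<comment> \<open>Solving for \<open>g x\<close> divides by \<open>c 0 = (-1) ^ k\<close>, which
      is its own inverse.\<close>
    define R where "R = smult (- ((-1) ^ k)) (\<Sum>i\<in>{1..k}. smult (c i / of_real (u i ^ k)) (Rp i))"
    have "degree R \<le> k - 1"
      unfolding R_def using Rp(1)
      by (intro order_trans[OF degree_smult_le] degree_sum_le) (auto intro: order_trans[OF degree_smult_le])
    moreover have "(\<integral>\<^sup>+t\<in>{0..2/3}. ennreal (norm (g t - poly_real R t) powr q) \<partial>lborel) \<le> ennreal ((C * W) powr q)"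
    proof -
      \<comment> \<open>The power \<open>q\<close> of the averaged difference is bounded at each
        \<open>x\<close> by this integral over the step variable; Fubini then lets the hypothesis
        act for each fixed step.\<close>
      define J where "J x = (\<integral>\<^sup>+s\<in>{0..real k}. ennreal (norm (fdiff k (\<delta> * s) g x) powr q) \<partial>lborel)" for x
      have bound: "ennreal (norm (g x - poly_real R x) powr q)
          \<le> ennreal (2 powr q) * (ennreal ((2 * CM * real k) powr q / real k) * J x + ennreal ((C1 * W) powr q))"
        if x: "x \<in> {0..2/3}" for x
      proof -
        let ?D = "\<lambda>s. of_real (peano k s) * fdiff k (\<delta> * s) g x"
        define D where "D = (\<integral>s. ?D s \<partial>lborel)"
        have split: "{..k} = insert 0 {1..k}" by auto
        have Dsum: "?D s = c 0 * g x * of_real (peano k s)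
            + (\<Sum>i\<in>{1..k}. c i * (of_real (peano k s) * g (x + u i * s)))" for s
          unfolding fdiff_def split c_def u_def by (simp add: distrib_left sum_distrib_left mult_ac)
        have ip: "integrable lborel (\<lambda>s. complex_of_real (peano k s))"
          using has_bochner_integral_of_real[OF integral_peano[OF k], where 'a = complex]
          by (auto simp: has_bochner_integral_iff)
        note pid = peano_identity[OF g supp' u k]
        have i1: "integrable lborel (\<lambda>s. c i * (of_real (peano k s) * g (x + u i * s)))" if "i \<in> {1..k}" for i
          using pid(1)[OF _ that] by (intro integrable_mult_right) auto
        have iD: "integrable lborel ?D"
          unfolding Dsum by (intro Bochner_Integration.integrable_add Bochner_Integration.integrable_sum
            integrable_mult_right ip i1)
        have "D = c 0 * g x + (\<Sum>i\<in>{1..k}. c i * (\<integral>s. of_real (peano k s) * g (x + u i * s) \<partial>lborel))"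
          unfolding D_def Dsum
          by (subst Bochner_Integration.integral_add, intro integrable_mult_right ip,
              intro Bochner_Integration.integrable_sum i1, assumption,
              subst Bochner_Integration.integral_sum, rule i1, assumption)
            (simp add: has_bochner_integral_integral_eq[OF integral_peano[OF k]])
        also have "(\<Sum>i\<in>{1..k}. c i * (\<integral>s. of_real (peano k s) * g (x + u i * s) \<partial>lborel))
            = (\<Sum>i\<in>{1..k}. c i / of_real (u i ^ k) *
                (\<integral>s. of_real (tpow (k - 1) (x - s)) * fdiff k (u i) g s \<partial>lborel))"
        proof (intro sum.cong refl)
          fix i assume i: "i \<in> {1..k}"
          have "of_real (u i ^ k) * (\<integral>s. of_real (peano k s) * g (x + u i * s) \<partial>lborel)
            = (\<integral>s. of_real (tpow (k - 1) (x - s)) * fdiff k (u i) g s \<partial>lborel)"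
            using pid(3)[OF _ i] by auto
          then show "c i * (\<integral>s. of_real (peano k s) * g (x + u i * s) \<partial>lborel)
            = c i / of_real (u i ^ k) * (\<integral>s. of_real (tpow (k - 1) (x - s)) * fdiff k (u i) g s \<partial>lborel)"
            using u[OF i] by (simp add: field_simps)
        qed
        finally have D1: "c 0 * g x = D - (\<Sum>i\<in>{1..k}. c i / of_real (u i ^ k) *
                (\<integral>s. of_real (tpow (k - 1) (x - s)) * fdiff k (u i) g s \<partial>lborel))"
          by simp
        have "c 0 * (g x - poly_real R x) = c 0 * g x + (\<Sum>i\<in>{1..k}. c i / of_real (u i ^ k) * poly_real (Rp i) x)"
        proof -
          have "poly_real R x = - c 0 * (\<Sum>i\<in>{1..k}. c i / of_real (u i ^ k) * poly_real (Rp i) x)"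
            by (simp add: R_def c_def[of 0] poly_real_def poly_sum)
          moreover have "c 0 * c 0 = 1" by (simp add: c_def flip: power_mult_distrib)
          moreover have "c 0 * (g x - (- c 0 * S)) = c 0 * g x + (c 0 * c 0) * S" for S
            by (simp add: algebra_simps)
          ultimately show ?thesis by (simp only: mult_1_left)
        qed
        also have "\<dots> = D - (\<Sum>i\<in>{1..k}. c i / of_real (u i ^ k) *
                ((\<integral>s. of_real (tpow (k - 1) (x - s)) * fdiff k (u i) g s \<partial>lborel) - poly_real (Rp i) x))"
          unfolding D1 by (simp add: right_diff_distrib sum_subtractf)
        finally have D2: "c 0 * (g x - poly_real R x) = \<dots>" .
        have "norm (g x - poly_real R x) = norm (c 0 * (g x - poly_real R x))"
          by (simp add: norm_mult c_def norm_power)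
        also have "\<dots> \<le> norm D + (\<Sum>i\<in>{1..k}. real (k choose i) / u i ^ k * (2 * W))"
          unfolding D2
        proof (rule order_trans[OF norm_triangle_ineq4 add_left_mono], rule sum_norm_le)
          fix i assume i: "i \<in> {1..k}"
          have "norm (c i / of_real (u i ^ k)) = real (k choose i) / u i ^ k"
            using u[OF i] by (simp add: c_def norm_mult norm_divide norm_power)
          then show "norm (c i / of_real (u i ^ k) *
                ((\<integral>s. of_real (tpow (k - 1) (x - s)) * fdiff k (u i) g s \<partial>lborel) - poly_real (Rp i) x))
              \<le> real (k choose i) / u i ^ k * (2 * W)"
            unfolding norm_mult using Rp(2)[OF i x] u[OF i] by (metis divide_nonneg_nonneg less_imp_le
              mult_left_mono of_nat_0_le_iff zero_le_power)
        qed
        also have "(\<Sum>i\<in>{1..k}. real (k choose i) / u i ^ k * (2 * W)) = C1 * W"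
          unfolding C1_def sum_distrib_right by (simp only: mult_ac)
        finally have n1: "norm (g x - poly_real R x) \<le> norm D + C1 * W" .
        have "norm (g x - poly_real R x) powr q \<le> (norm D + C1 * W) powr q"
          using n1 q by (intro powr_mono2) auto
        also have "\<dots> \<le> 2 powr q * (norm D powr q + (C1 * W) powr q)"
          using C1 W q by (intro powr_sum_le) auto
        finally have n2: "norm (g x - poly_real R x) powr q \<le> 2 powr q * (norm D powr q + (C1 * W) powr q)" .
        have n3: "ennreal (norm D powr q) \<le> ennreal ((2 * CM * real k) powr q / real k) * J x"
        \<comment> \<open>At a single \<open>x\<close> the integral may be infinite, and then there
          is nothing to show.\<close>
        proof (cases "J x")
          case top
          moreover have "(2 * CM * real k) powr q / real k > 0" using CM k by simp
          ultimately show ?thesis using CM(1) k by (simp add: ennreal_mult_top)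
        next
          case (real r)
          define w where "w = (r / real k) powr (1 / q)"
          have w: "w \<ge> 0" "w powr q = r / real k"
            using real k q by (auto simp: w_def powr_powr)
          have "ennreal (norm D) \<le> (\<integral>\<^sup>+s. ennreal (norm (?D s)) \<partial>lborel)"
            unfolding D_def by (rule integral_norm_bound_ennreal[OF iD])
          also have "\<dots> \<le> (\<integral>\<^sup>+s. ennreal CM * (ennreal (norm (fdiff k (\<delta> * s) g x)) * indicator {0..real k} s) \<partial>lborel)"
          proof (rule nn_integral_mono)
            fix s
            show "ennreal (norm (?D s)) \<le> ennreal CM * (ennreal (norm (fdiff k (\<delta> * s) g x)) * indicator {0..real k} s)"
            proof (cases "s \<in> {0..real k}")
              case True
              have "norm (?D s) \<le> CM * norm (fdiff k (\<delta> * s) g x)"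
                using CM(2)[of s] by (simp add: norm_mult mult_right_mono)
              then show ?thesis using True CM by (simp flip: ennreal_mult')
            qed (simp add: peano_outside[OF k])
          qed
          also have "\<dots> = ennreal CM * (\<integral>\<^sup>+s\<in>{0..real k}. ennreal (norm (fdiff k (\<delta> * s) g x)) \<partial>lborel)"
            by (intro nn_integral_cmult) (simp add: fdiff_def)
          also have "\<dots> \<le> ennreal CM * ennreal (2 * w * real k)"
          proof (intro mult_left_mono nn_integral_powr_mean[where q = q])
            show "(\<integral>\<^sup>+s\<in>{0..real k}. ennreal (norm (fdiff k (\<delta> * s) g x) powr q) \<partial>lborel) \<le> ennreal (real k * w powr q)"
              using real k unfolding J_def w(2) by simp
          qed (use k q w in \<open>auto simp: fdiff_def\<close>)
          also have "\<dots> = ennreal (2 * CM * real k * w)"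
            using CM w by (simp add: mult_ac flip: ennreal_mult')
          finally have "norm D \<le> 2 * CM * real k * w" using CM w by simp
          then have "norm D powr q \<le> (2 * CM * real k * w) powr q"
            using q by (intro powr_mono2) auto
          also have "\<dots> = (2 * CM * real k) powr q * (r / real k)"
            using w by (simp add: powr_mult)
          finally show ?thesis using real k by (simp flip: ennreal_mult')
        qed
        have "ennreal (norm (g x - poly_real R x) powr q)
            \<le> ennreal (2 powr q * (norm D powr q + (C1 * W) powr q))"
          using n2 by (rule ennreal_leI)
        also have "\<dots> = ennreal (2 powr q) * (ennreal (norm D powr q) + ennreal ((C1 * W) powr q))"
          by (simp add: ennreal_mult')
        also have "\<dots> \<le> ennreal (2 powr q) * (ennreal ((2 * CM * real k) powr q / real k) * J x + ennreal ((C1 * W) powr q))"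
          by (intro mult_left_mono add_mono n3) auto
        finally show ?thesis .
      qed
      have [measurable]: "(\<lambda>(x, s). fdiff k (\<delta> * s) g x) \<in> borel_measurable (borel \<Otimes>\<^sub>M borel)"
        unfolding fdiff_def by measurable
      have [measurable]: "J \<in> borel_measurable borel"
        unfolding J_def by measurable
      have J: "(\<integral>\<^sup>+x\<in>{0..2/3}. J x \<partial>lborel) \<le> ennreal (real k * W powr q)"
      proof -
        have "(\<integral>\<^sup>+x\<in>{0..2/3}. J x \<partial>lborel) = (\<integral>\<^sup>+x. (\<integral>\<^sup>+s. ennreal (norm (fdiff k (\<delta> * s) g x) powr q) *
              indicator {0..real k} s * indicator {0..2/3} x \<partial>lborel) \<partial>lborel)"
          unfolding J_def by (intro nn_integral_cong nn_integral_multc[symmetric]) measurable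
        also have "\<dots> = (\<integral>\<^sup>+s. (\<integral>\<^sup>+x. ennreal (norm (fdiff k (\<delta> * s) g x) powr q) *
              indicator {0..real k} s * indicator {0..2/3} x \<partial>lborel) \<partial>lborel)"
          by (rule lborel_pair.Fubini') measurable
        also have "\<dots> \<le> (\<integral>\<^sup>+s. ennreal (W powr q) * indicator {0..real k} s \<partial>lborel)"
        proof (rule nn_integral_mono)
          fix s
          show "(\<integral>\<^sup>+x. ennreal (norm (fdiff k (\<delta> * s) g x) powr q) *
              indicator {0..real k} s * indicator {0..2/3} x \<partial>lborel) \<le> ennreal (W powr q) * indicator {0..real k} s"
          proof (cases "s \<in> {0..real k}")
            case True
            have "real k * (\<delta> * s) \<le> real k * (\<delta> * real k)"
              using True \<delta> by (intro mult_left_mono) auto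
            also have "\<dots> = 1 / 3" using k by (simp add: \<delta>_def power2_eq_square)
            finally show ?thesis using le'[of "\<delta> * s"] True \<delta> by simp
          qed simp
        qed
        also have "\<dots> = ennreal (real k * W powr q)"
          by (simp add: nn_integral_cmult mult.commute flip: ennreal_mult')
        finally show ?thesis .
      qed
      have "(\<integral>\<^sup>+t\<in>{0..2/3}. ennreal (norm (g t - poly_real R t) powr q) \<partial>lborel)
          \<le> (\<integral>\<^sup>+x. ennreal (2 powr q) * (ennreal ((2 * CM * real k) powr q / real k) * (J x * indicator {0..2/3} x)
              + ennreal ((C1 * W) powr q) * indicator {0..1} x) \<partial>lborel)"
      proof (rule nn_integral_mono)
        fix x :: real
        show "ennreal (norm (g x - poly_real R x) powr q) * indicator {0..2/3} x
          \<le> ennreal (2 powr q) * (ennreal ((2 * CM * real k) powr q / real k) * (J x * indicator {0..2/3} x)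
              + ennreal ((C1 * W) powr q) * indicator {0..1} x)"
          using bound[of x] by (cases "x \<in> {0..2/3}") auto
      qed
      also have "\<dots> = ennreal (2 powr q) * (ennreal ((2 * CM * real k) powr q / real k) * (\<integral>\<^sup>+x\<in>{0..2/3}. J x \<partial>lborel)
              + ennreal ((C1 * W) powr q))"
        by (simp add: nn_integral_cmult nn_integral_add)
      also have "\<dots> \<le> ennreal (2 powr q) * (ennreal ((2 * CM * real k) powr q / real k) * ennreal (real k * W powr q)
              + ennreal ((C1 * W) powr q))"
        by (intro mult_left_mono add_mono J) auto
      also have "\<dots> = ennreal (2 powr q * ((2 * CM * real k) powr q / real k * (real k * W powr q) + (C1 * W) powr q))"
        by (simp flip: ennreal_mult' ennreal_plus)
      also have "2 powr q * ((2 * CM * real k) powr q / real k * (real k * W powr q) + (C1 * W) powr q) = K * W powr q"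
        using k C1 W by (simp add: K_def powr_mult algebra_simps)
      also have "K * W powr q = (C * W) powr q"
        using K q by (simp add: C_def powr_mult powr_powr)
      finally show ?thesis .
    qed
    ultimately show ?thesis by blast
  qed
  moreover have "C > 0" using K by (simp add: C_def)
  ultimately show ?thesis by blast
qed

lemma set_integral_eq_nn_integral:
  fixes \<phi> :: "real \<Rightarrow> real"
  assumes "set_integrable lebesgue S \<phi>" "\<And>t. t \<in> S \<Longrightarrow> 0 \<le> \<phi> t"
  shows "ennreal (LINT t:S|lebesgue. \<phi> t) = (\<integral>\<^sup>+t\<in>S. ennreal (\<phi> t) \<partial>lborel)"
proof -
  have "ennreal (LINT t:S|lebesgue. \<phi> t) = (\<integral>\<^sup>+t. ennreal (indicator S t *\<^sub>R \<phi> t) \<partial>lebesgue)"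
    unfolding set_lebesgue_integral_def using assms
    by (intro nn_integral_eq_integral[symmetric]) (auto simp: set_integrable_def indicator_def)
  also have "\<dots> = (\<integral>\<^sup>+t. ennreal (indicator S t *\<^sub>R \<phi> t) \<partial>lborel)"
    by (rule nn_integral_completion)
  also have "\<dots> = (\<integral>\<^sup>+t\<in>S. ennreal (\<phi> t) \<partial>lborel)"
    by (intro nn_integral_cong) (auto simp: indicator_def)
  finally show ?thesis .
qed

lemma set_integral_nonneg_real:
  fixes \<phi> :: "real \<Rightarrow> real"
  shows "(\<And>t. t \<in> S \<Longrightarrow> 0 \<le> \<phi> t) \<Longrightarrow> 0 \<le> (LINT t:S|M. \<phi> t)"
  unfolding set_lebesgue_integral_def by (intro Bochner_Integration.integral_nonneg) (auto simp: indicator_def)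

text \<open>Reversing the order of the nodes only changes a sign. The step stays nonnegative under
  reflection, so the estimate on the left two thirds applies to the reflected function.\<close>

lemma fdiff_reflect:
  "norm (fdiff k h (\<lambda>t. g (1 - t)) t) = norm (fdiff k h g (1 - real k * h - t))"
proof -
  have "fdiff k h (\<lambda>t. g (1 - t)) t
      = (\<Sum>i\<le>k. (-1) ^ (k + (k - i)) * of_nat (k choose (k - i)) * g (1 - (t + real (k - i) * h)))"
    unfolding fdiff_def
    by (rule sum.reindex_bij_witness[of _ "\<lambda>i. k - i" "\<lambda>i. k - i"]) auto
  also have "\<dots> = (\<Sum>i\<le>k. (-1) ^ k * ((-1) ^ (k + i) * of_nat (k choose i) * g (1 - real k * h - t + real i * h)))"
  proof (intro sum.cong refl)
    fix i assume i: "i \<in> {..k}"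
    have "(-1) ^ (k + (k - i)) = (-1) ^ k * ((-1) ^ (k + i) :: complex)"
    proof -
      obtain m where "k = i + m" using i le_Suc_ex by auto
      then show ?thesis by (simp add: minus_one_power_iff)
    qed
    moreover have "1 - (t + real (k - i) * h) = 1 - real k * h - t + real i * h"
      using i by (simp add: of_nat_diff algebra_simps)
    moreover have "k choose (k - i) = k choose i"
      using i binomial_symmetric[of i k] by simp
    ultimately show "(-1) ^ (k + (k - i)) * of_nat (k choose (k - i)) * g (1 - (t + real (k - i) * h))
        = (-1) ^ k * ((-1) ^ (k + i) * of_nat (k choose i) * g (1 - real k * h - t + real i * h))"
      by (simp only: mult.assoc)
  qed
  also have "\<dots> = (-1) ^ k * fdiff k h g (1 - real k * h - t)"
    by (simp only: fdiff_def sum_distrib_left)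
  finally show ?thesis by (simp add: norm_mult norm_power)
qed

lemma nn_integral_reflect:
  fixes f :: "real \<Rightarrow> ennreal"
  assumes "f \<in> borel_measurable borel"
  shows "(\<integral>\<^sup>+t. f (c - t) \<partial>lborel) = (\<integral>\<^sup>+t. f t \<partial>lborel)"
  using nn_integral_real_affine[OF assms, of "-1" c] by simp

lemma poly_real_measurable [measurable]: "poly_real R \<in> borel_measurable borel"
  by (intro borel_measurable_continuous_onI continuous_intros continuous_on_id
      continuous_poly_real[of _ "\<lambda>x. x", simplified])

text \<open>The estimates for \<open>g\<close> and for its reflection give two polynomials, near
  \<open>g\<close> on \<open>{0..2/3}\<close> and on \<open>{1/3..1}\<close>. On the common third
  they are near each other, hence on the whole unit interval by \<open>poly_real_le_pmean\<close>,
  and \<open>R1\<close> serves everywhere.\<close>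

lemma whitney_unit:
  fixes q :: real
  assumes k: "k \<ge> 2" and q: "q \<ge> 1"
  shows "\<exists>C>0. \<forall>g W. integrable lborel g \<longrightarrow> (\<forall>t. t \<notin> {0..1} \<longrightarrow> g t = 0) \<longrightarrow> W \<ge> 0 \<longrightarrow>
    (\<forall>h. 0 \<le> h \<longrightarrow> real k * h \<le> 1 \<longrightarrow>
      (\<integral>\<^sup>+t\<in>{0..1 - real k * h}. ennreal (norm (fdiff k h g t) powr q) \<partial>lborel) \<le> ennreal (W powr q)) \<longrightarrow>
    (\<exists>R. degree R \<le> k - 1 \<and>
      (\<integral>\<^sup>+t\<in>{0..1}. ennreal (norm (g t - poly_real R t) powr q) \<partial>lborel) \<le> ennreal ((C * W) powr q))"
proof -
  obtain C0 where C0: "C0 > 0" and half: "\<forall>g W. integrable lborel g \<longrightarrow> (\<forall>t. t \<notin> {0..1} \<longrightarrow> g t = 0) \<longrightarrow> W \<ge> 0 \<longrightarrow>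
    (\<forall>h. 0 \<le> h \<longrightarrow> real k * h \<le> 1 \<longrightarrow>
      (\<integral>\<^sup>+t\<in>{0..1 - real k * h}. ennreal (norm (fdiff k h g t) powr q) \<partial>lborel) \<le> ennreal (W powr q)) \<longrightarrow>
    (\<exists>R. degree R \<le> k - 1 \<and>
      (\<integral>\<^sup>+t\<in>{0..2/3}. ennreal (norm (g t - poly_real R t) powr q) \<partial>lborel) \<le> ennreal ((C0 * W) powr q))"
    using whitney_two_thirds[OF k q] by blast
  obtain C1 where C1: "C1 > 0" "\<And>R a L t. degree R \<le> k - 1 \<Longrightarrow> L > 0 \<Longrightarrow> \<bar>t - a\<bar> \<le> 2 * L \<Longrightarrow>
     norm (poly_real R t) \<le> C1 * pmean R a L"
    using poly_real_le_pmean[of 2 "k - 1"] by auto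
  define C2 where "C2 = C1 * (2 * (6 * 2 powr q) powr (1 / q))"
  have C2: "C2 > 0" using C1 by (simp add: C2_def)
  define K where "K = 1 + 2 powr q * (1 + C2 powr q)"
  have K: "K > 0" by (simp add: K_def add_pos_nonneg)
  define C where "C = K powr (1 / q) * C0"
  have "\<exists>R. degree R \<le> k - 1 \<and>
      (\<integral>\<^sup>+t\<in>{0..1}. ennreal (norm (g t - poly_real R t) powr q) \<partial>lborel) \<le> ennreal ((C * W) powr q)"
    if g: "integrable lborel g" and supp: "\<forall>t. t \<notin> {0..1} \<longrightarrow> g t = 0" and W: "W \<ge> 0"
      and le: "\<forall>h. 0 \<le> h \<longrightarrow> real k * h \<le> 1 \<longrightarrow>
      (\<integral>\<^sup>+t\<in>{0..1 - real k * h}. ennreal (norm (fdiff k h g t) powr q) \<partial>lborel) \<le> ennreal (W powr q)"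
    for g W
  proof -
    have [measurable]: "g \<in> borel_measurable borel" using g by (simp add: integrable_iff_bounded)
    define V where "V = C0 * W"
    have V: "V \<ge> 0" using C0 W by (simp add: V_def)
    have "\<exists>R. degree R \<le> k - 1 \<and>
      (\<integral>\<^sup>+t\<in>{0..2/3}. ennreal (norm (g t - poly_real R t) powr q) \<partial>lborel) \<le> ennreal ((C0 * W) powr q)"
      by (rule half[rule_format, OF g _ W]) (use supp le in auto)
    then obtain R1 where R1: "degree R1 \<le> k - 1"
      "(\<integral>\<^sup>+t\<in>{0..2/3}. ennreal (norm (g t - poly_real R1 t) powr q) \<partial>lborel) \<le> ennreal (V powr q)"
      unfolding V_def by blast
    have "\<exists>R. degree R \<le> k - 1 \<and>
      (\<integral>\<^sup>+t\<in>{0..2/3}. ennreal (norm (g (1 - t) - poly_real R t) powr q) \<partial>lborel) \<le> ennreal ((C0 * W) powr q)"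
    proof (rule half[rule_format, of "\<lambda>t. g (1 - t)", OF _ _ W])
      show "integrable lborel (\<lambda>t. g (1 - t))"
        using lborel_integrable_real_affine[OF g, of "-1" 1] by simp
      show "g (1 - t) = 0" if "t \<notin> {0..1}" for t using supp that by auto
      fix h :: real assume h: "0 \<le> h" "real k * h \<le> 1"
      have "(\<integral>\<^sup>+t\<in>{0..1 - real k * h}. ennreal (norm (fdiff k h (\<lambda>t. g (1 - t)) t) powr q) \<partial>lborel)
          = (\<integral>\<^sup>+t. (\<lambda>s. ennreal (norm (fdiff k h g s) powr q) * indicator {0..1 - real k * h} s) (1 - real k * h - t) \<partial>lborel)"
        unfolding fdiff_reflect by (intro nn_integral_cong) (auto simp: indicator_def)
      also have "\<dots> = (\<integral>\<^sup>+t\<in>{0..1 - real k * h}. ennreal (norm (fdiff k h g t) powr q) \<partial>lborel)"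
        by (rule nn_integral_reflect) (simp add: fdiff_def)
      finally show "(\<integral>\<^sup>+t\<in>{0..1 - real k * h}. ennreal (norm (fdiff k h (\<lambda>t. g (1 - t)) t) powr q) \<partial>lborel)
          \<le> ennreal (W powr q)" using le h by simp
    qed
    then obtain R where R: "degree R \<le> k - 1"
      "(\<integral>\<^sup>+t\<in>{0..2/3}. ennreal (norm (g (1 - t) - poly_real R t) powr q) \<partial>lborel) \<le> ennreal (V powr q)"
      unfolding V_def by blast
    define R2 where "R2 = R \<circ>\<^sub>p [:1, -1:]"
    have R2d: "degree R2 \<le> k - 1" using R(1) degree_pcompose_le[of R "[:1, -1:]"] by (simp add: R2_def)
    have R2: "(\<integral>\<^sup>+t\<in>{1/3..1}. ennreal (norm (g t - poly_real R2 t) powr q) \<partial>lborel) \<le> ennreal (V powr q)"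
    proof -
      have "(\<integral>\<^sup>+t\<in>{1/3..1}. ennreal (norm (g t - poly_real R2 t) powr q) \<partial>lborel)
          = (\<integral>\<^sup>+t. (\<lambda>s. ennreal (norm (g s - poly_real R2 s) powr q) * indicator {1/3..1} s) (1 - t) \<partial>lborel)"
        by (rule nn_integral_reflect[symmetric]) measurable
      also have "\<dots> = (\<integral>\<^sup>+t\<in>{0..2/3}. ennreal (norm (g (1 - t) - poly_real R t) powr q) \<partial>lborel)"
        by (intro nn_integral_cong) (auto simp: indicator_def R2_def poly_real_def poly_pcompose)
      finally show ?thesis using R(2) by simp
    qed
    \<comment> \<open>On the middle third the integral of the power \<open>q\<close> of
      \<open>R1 - R2\<close> is at most \<open>2 powr q * (2 * V powr q)\<close>, which is the
      length 1/3 times \<open>w powr q\<close>.\<close>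
    define w where "w = (6 * 2 powr q) powr (1 / q) * V"
    have w: "w \<ge> 0" "w powr q = 6 * 2 powr q * V powr q"
      using V q by (simp_all add: w_def powr_mult powr_powr)
    have near: "norm (poly_real (R1 - R2) t) \<le> C2 * V" if t: "t \<in> {0..1}" for t
    proof -
      have "(\<integral>\<^sup>+t\<in>{1/3..2/3}. ennreal (norm (poly_real (R1 - R2) t) powr q) \<partial>lborel)
          \<le> (\<integral>\<^sup>+t. ennreal (2 powr q) * (ennreal (norm (g t - poly_real R2 t) powr q) * indicator {1/3..1} t +
               ennreal (norm (g t - poly_real R1 t) powr q) * indicator {0..2/3} t) \<partial>lborel)"
      proof (rule nn_integral_mono)
        fix t
        have "norm (poly_real (R1 - R2) t) powr q \<le> (norm (g t - poly_real R2 t) + norm (g t - poly_real R1 t)) powr q"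
          using q norm_triangle_ineq4[of "g t - poly_real R2 t" "g t - poly_real R1 t"]
          by (intro powr_mono2) (auto simp: poly_real_def)
        also have "\<dots> \<le> 2 powr q * (norm (g t - poly_real R2 t) powr q + norm (g t - poly_real R1 t) powr q)"
          using q by (intro powr_sum_le) auto
        finally have "ennreal (norm (poly_real (R1 - R2) t) powr q)
            \<le> ennreal (2 powr q) * (ennreal (norm (g t - poly_real R2 t) powr q) + ennreal (norm (g t - poly_real R1 t) powr q))"
          by (simp flip: ennreal_plus ennreal_mult')
        then show "ennreal (norm (poly_real (R1 - R2) t) powr q) * indicator {1/3..2/3} t
          \<le> ennreal (2 powr q) * (ennreal (norm (g t - poly_real R2 t) powr q) * indicator {1/3..1} t +
               ennreal (norm (g t - poly_real R1 t) powr q) * indicator {0..2/3} t)"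
          by (auto simp: indicator_def)
      qed
      also have "\<dots> = ennreal (2 powr q) * ((\<integral>\<^sup>+t\<in>{1/3..1}. ennreal (norm (g t - poly_real R2 t) powr q) \<partial>lborel) +
               (\<integral>\<^sup>+t\<in>{0..2/3}. ennreal (norm (g t - poly_real R1 t) powr q) \<partial>lborel))"
        by (simp add: nn_integral_cmult nn_integral_add)
      also have "\<dots> \<le> ennreal (2 powr q) * (ennreal (V powr q) + ennreal (V powr q))"
        by (intro mult_left_mono add_mono R1 R2) auto
      also have "\<dots> = ennreal (1 / 3 * w powr q)"
        unfolding w by (simp add: algebra_simps flip: ennreal_plus ennreal_mult')
      finally have "(\<integral>\<^sup>+t\<in>{1/3..2/3}. ennreal (norm (poly_real (R1 - R2) t)) \<partial>lborel) \<le> ennreal (2 * w * (1 / 3))"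
        using q w(1) by (intro nn_integral_powr_mean[where q = q]) auto
      moreover have "ennreal (LINT t:{1/3..1/3 + 1/3}|lebesgue. norm (poly_real (R1 - R2) t))
          = (\<integral>\<^sup>+t\<in>{1/3..1/3 + 1/3}. ennreal (norm (poly_real (R1 - R2) t)) \<partial>lborel)"
        by (intro set_integral_eq_nn_integral set_integrable_continuous_lebesgue continuous_intros) auto
      ultimately have "ennreal (LINT t:{1/3..1/3 + 1/3}|lebesgue. norm (poly_real (R1 - R2) t)) \<le> ennreal (2 * w * (1 / 3))"
        by simp
      then have "(LINT t:{1/3..1/3 + 1/3}|lebesgue. norm (poly_real (R1 - R2) t)) \<le> 2 * w * (1 / 3)"
        using w(1) by (subst (asm) ennreal_le_iff) auto
      then have "pmean (R1 - R2) (1/3) (1/3) \<le> 2 * w" by (simp add: pmean_def)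
      moreover have "norm (poly_real (R1 - R2) t) \<le> C1 * pmean (R1 - R2) (1/3) (1/3)"
      proof (intro C1 degree_diff_le)
        show "\<bar>t - 1/3\<bar> \<le> 2 * (1/3)" using t unfolding atLeastAtMost_iff abs_le_iff by linarith
      qed (use R1(1) R2d in auto)
      ultimately have "norm (poly_real (R1 - R2) t) \<le> C1 * (2 * w)"
        using C1(1) by (meson less_imp_le mult_left_mono order_trans)
      then show ?thesis by (simp add: C2_def w_def mult_ac)
    qed
    have "(\<integral>\<^sup>+t\<in>{0..1}. ennreal (norm (g t - poly_real R1 t) powr q) \<partial>lborel)
        \<le> (\<integral>\<^sup>+t. ennreal (norm (g t - poly_real R1 t) powr q) * indicator {0..2/3} t +
             ennreal (2 powr q) * (ennreal (norm (g t - poly_real R2 t) powr q) * indicator {1/3..1} t +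
              ennreal ((C2 * V) powr q) * indicator {0..1} t) \<partial>lborel)"
    proof (rule nn_integral_mono)
      fix t
      have "ennreal (norm (g t - poly_real R1 t) powr q)
          \<le> ennreal (2 powr q) * (ennreal (norm (g t - poly_real R2 t) powr q) + ennreal ((C2 * V) powr q))"
        if t: "t \<in> {0..1}"
      proof -
        have "norm (g t - poly_real R1 t) \<le> norm (g t - poly_real R2 t) + norm (poly_real (R1 - R2) t)"
          using norm_triangle_ineq4[of "g t - poly_real R2 t" "poly_real (R1 - R2) t"] by (simp add: poly_real_def)
        then have "norm (g t - poly_real R1 t) powr q \<le> (norm (g t - poly_real R2 t) + C2 * V) powr q"
          using q near[OF t] by (intro powr_mono2) auto
        also have "\<dots> \<le> 2 powr q * (norm (g t - poly_real R2 t) powr q + (C2 * V) powr q)"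
          using q C2 V by (intro powr_sum_le) auto
        finally show ?thesis by (simp flip: ennreal_plus ennreal_mult')
      qed
      moreover have "1/3 \<le> t" if "\<not> t \<le> 2/3" using that by simp
      ultimately show "ennreal (norm (g t - poly_real R1 t) powr q) * indicator {0..1} t
        \<le> ennreal (norm (g t - poly_real R1 t) powr q) * indicator {0..2/3} t +
             ennreal (2 powr q) * (ennreal (norm (g t - poly_real R2 t) powr q) * indicator {1/3..1} t +
              ennreal ((C2 * V) powr q) * indicator {0..1} t)"
        by (cases "t \<le> 2/3") (auto simp: indicator_def)
    qed
    also have "\<dots> = (\<integral>\<^sup>+t\<in>{0..2/3}. ennreal (norm (g t - poly_real R1 t) powr q) \<partial>lborel) +
             ennreal (2 powr q) * ((\<integral>\<^sup>+t\<in>{1/3..1}. ennreal (norm (g t - poly_real R2 t) powr q) \<partial>lborel) +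
              ennreal ((C2 * V) powr q))"
      by (simp add: nn_integral_cmult nn_integral_add)
    also have "\<dots> \<le> ennreal (V powr q) + ennreal (2 powr q) * (ennreal (V powr q) + ennreal ((C2 * V) powr q))"
      by (intro add_mono mult_left_mono R1 R2) auto
    also have "\<dots> = ennreal (V powr q + 2 powr q * (V powr q + (C2 * V) powr q))"
      by (simp flip: ennreal_plus ennreal_mult')
    also have "V powr q + 2 powr q * (V powr q + (C2 * V) powr q) = K * V powr q"
      using C2 V by (simp add: K_def powr_mult algebra_simps)
    also have "\<dots> = (C * W) powr q"
      using K q C0 W by (simp add: C_def V_def powr_mult powr_powr)
    finally show ?thesis using R1(1) by blast
  qed
  moreover have "C > 0" using K C0 by (simp add: C_def)
  ultimately show ?thesis by blast
qed

subsection \<open>Whitney's inequality on arbitrary intervals\<close>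

text \<open>\<open>Lq_on\<close> speaks of Lebesgue measurable functions, whereas substitution and
  Fubini are used on \<open>lborel\<close>; a Borel version that is 0 outside the interval bridges
  the two.\<close>

lemma ex_borel_version:
  fixes f :: "real \<Rightarrow> complex"
  assumes "set_borel_measurable lebesgue {a..b} f"
  shows "\<exists>g\<in>borel_measurable borel. (\<forall>t. t \<notin> {a..b} \<longrightarrow> g t = 0) \<and>
     (AE t in lborel. t \<in> {a..b} \<longrightarrow> f t = g t)"
proof -
  let ?F = "\<lambda>t. indicator {a..b} t *\<^sub>R f t"
  have F: "?F \<in> borel_measurable lebesgue" using assms by (simp add: set_borel_measurable_def)
  have re: "(\<lambda>t. Re (?F t)) \<in> borel_measurable lebesgue"
    by (rule measurable_compose[OF F, of Re borel]) measurable
  have im: "(\<lambda>t. Im (?F t)) \<in> borel_measurable lebesgue"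
    by (rule measurable_compose[OF F, of Im borel]) measurable
  obtain u v where uv: "u \<in> borel_measurable lborel" "v \<in> borel_measurable lborel"
    "AE t in lborel. Re (?F t) = u t" "AE t in lborel. Im (?F t) = v t"
    using completion_ex_borel_measurable_real[OF re] completion_ex_borel_measurable_real[OF im] by blast
  have [measurable]: "u \<in> borel_measurable borel" "v \<in> borel_measurable borel"
    using uv(1,2) by simp_all
  define g where "g t = indicator {a..b} t *\<^sub>R Complex (u t) (v t)" for t
  have "g = (\<lambda>t. of_real (indicator {a..b} t) * (of_real (u t) + \<i> * of_real (v t)))"
    by (rule ext) (simp add: g_def Complex_eq scaleR_conv_of_real)
  moreover have "\<dots> \<in> borel_measurable borel" by measurable
  ultimately have "g \<in> borel_measurable borel" by simp
  moreover have "AE t in lborel. t \<in> {a..b} \<longrightarrow> f t = g t"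
    using uv(3,4) by eventually_elim (auto simp: g_def complex_eq_iff)
  moreover have "\<forall>t. t \<notin> {a..b} \<longrightarrow> g t = 0" by (simp add: g_def)
  ultimately show ?thesis by blast
qed

lemma AE_lborel_shift:
  assumes "AE t in lborel. P t"
  shows "AE t in lborel. P (t + a :: real)"
proof -
  obtain N where N: "N \<in> null_sets lborel" "{t \<in> space lborel. \<not> P t} \<subseteq> N"
    using assms by (auto simp: eventually_ae_filter)
  then have [measurable]: "N \<in> sets borel" by auto
  have "AE t in lborel. t \<notin> N" using N(1) by (rule AE_not_in)
  then have "AE t in lborel. a + 1 * t \<notin> N"
    by (intro AE_borel_affine) auto
  then show ?thesis
    by eventually_elim (use N(2) in \<open>auto simp: add.commute\<close>)
qed

lemma diff_op_eq_fdiff: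
  "diff_op k h {a..b} f t = (if t \<in> {a..b} \<and> t + real k * h \<in> {a..b} then fdiff k h f t else 0)"
proof -
  have "closed_segment t (t + real k * h) \<subseteq> {a..b} \<longleftrightarrow> t \<in> {a..b} \<and> t + real k * h \<in> {a..b}"
    by (auto simp: closed_segment_eq_real_ivl split: if_splits)
  then show ?thesis by (simp add: diff_op_def fdiff_def)
qed

lemma AE_diff_op:
  assumes "AE t in lborel. t \<in> {a..b} \<longrightarrow> f t = g t"
  shows "AE t in lborel. diff_op k h {a..b} f t = diff_op k h {a..b} g t"
proof -
  have "AE t in lborel. \<forall>i\<in>{..k}. t + real i * h \<in> {a..b} \<longrightarrow> f (t + real i * h) = g (t + real i * h)"
    by (intro AE_finite_allI AE_lborel_shift[OF assms]) simp
  then show ?thesis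
  proof eventually_elim
    case (elim t)
    have "t + real i * h \<in> {a..b}" if "t \<in> {a..b}" "t + real k * h \<in> {a..b}" "i \<le> k" for i
    proof -
      have "t + real i * h \<in> closed_segment t (t + real k * h)"
      proof (cases "k = 0")
        case False
        then show ?thesis using that(3) unfolding in_segment
          by (intro exI[of _ "real i / real k"]) (auto simp: field_simps)
      qed (use that in auto)
      then show ?thesis
        using that closed_segment_subset[of t "{a..b}" "t + real k * h"] convex_real_interval by blast
    qed
    then have "f (t + real i * h) = g (t + real i * h)"
      if "t \<in> {a..b}" "t + real k * h \<in> {a..b}" "i \<le> k" for i
      using that elim by blast
    then have "fdiff k h f t = fdiff k h g t" if "t \<in> {a..b}" "t + real k * h \<in> {a..b}"
      unfolding fdiff_def using that by (intro sum.cong refl) (simp del: atLeastAtMost_iff)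
    then show ?case unfolding diff_op_eq_fdiff by presburger
  qed
qed

lemma set_integrable_spike_AE:
  fixes \<phi> \<psi> :: "real \<Rightarrow> 'a :: euclidean_space"
  assumes "AE t in lborel. t \<in> S \<longrightarrow> \<phi> t = \<psi> t" and \<psi>: "set_integrable lebesgue S \<psi>"
  shows "set_integrable lebesgue S \<phi>" and "(LINT t:S|lebesgue. \<phi> t) = (LINT t:S|lebesgue. \<psi> t)"
proof -
  obtain N where N: "N \<in> null_sets lborel" "{t \<in> space lborel. \<not> (t \<in> S \<longrightarrow> \<phi> t = \<psi> t)} \<subseteq> N"
    using assms(1) by (auto simp: eventually_ae_filter)
  have neg: "negligible N" using N(1) by (simp add: negligible_iff_null_sets null_sets_completionI)
  have eq: "\<phi> t = \<psi> t" if "t \<in> S - N" for t using N(2) that by auto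
  show \<phi>: "set_integrable lebesgue S \<phi>"
    using \<psi> neg eq by (rule absolutely_integrable_spike)
  show "(LINT t:S|lebesgue. \<phi> t) = (LINT t:S|lebesgue. \<psi> t)"
    using integral_spike[OF neg, of S \<psi> \<phi>] eq
    by (simp add: set_lebesgue_integral_eq_integral(2)[OF \<phi>] set_lebesgue_integral_eq_integral(2)[OF \<psi>])
qed

lemma set_borel_measurable_norm_powr:
  fixes f :: "real \<Rightarrow> complex"
  assumes "set_borel_measurable lebesgue S f"
  shows "set_borel_measurable lebesgue S (\<lambda>t. norm (f t) powr q)"
proof -
  have [measurable]: "(\<lambda>t. indicator S t *\<^sub>R f t) \<in> borel_measurable lebesgue"
    using assms by (simp add: set_borel_measurable_def)
  have "(\<lambda>t. norm (indicator S t *\<^sub>R f t) powr q) \<in> borel_measurable lebesgue"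
    by measurable
  also have "(\<lambda>t. norm (indicator S t *\<^sub>R f t) powr q) = (\<lambda>t. indicator S t *\<^sub>R (norm (f t) powr q))"
    by (rule ext) (auto simp: indicator_def)
  finally show ?thesis by (simp add: set_borel_measurable_def)
qed

lemma set_integrable_const_interval: "set_integrable lebesgue {a..b :: real} (\<lambda>t. c :: real)"
  by (intro set_integrable_continuous_lebesgue continuous_intros)

lemma Lq_on_bound:
  assumes "set_borel_measurable lebesgue S f" "set_integrable lebesgue S \<phi>"
    and "\<And>t. t \<in> S \<Longrightarrow> norm (f t) powr q \<le> \<phi> t"
  shows "Lq_on q S f"
  unfolding Lq_on_def
proof
  show "set_integrable lebesgue S (\<lambda>t. norm (f t) powr q)"
  proof (rule set_integrable_bound[OF assms(2)])
    show "AE t in lebesgue. t \<in> S \<longrightarrow> norm (norm (f t) powr q) \<le> norm (\<phi> t)"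
    proof (rule AE_I2, rule impI)
      fix t assume "t \<in> S"
      then have "norm (f t) powr q \<le> \<phi> t" by (rule assms(3))
      then show "norm (norm (f t) powr q) \<le> norm (\<phi> t)" by simp
    qed
  qed (rule set_borel_measurable_norm_powr[OF assms(1)])
qed (rule assms)

lemma Lq_on_diff:
  assumes f: "Lq_on q S f" and g: "Lq_on q S g" and q: "q \<ge> 1"
  shows "Lq_on q S (\<lambda>t. f t - g t)"
proof (rule Lq_on_bound)
  show "set_borel_measurable lebesgue S (\<lambda>t. f t - g t)"
    using f g unfolding Lq_on_def set_borel_measurable_def scaleR_diff_right
    by (intro borel_measurable_diff) auto
  show "set_integrable lebesgue S (\<lambda>t. 2 powr q * (norm (f t) powr q + norm (g t) powr q))"
    using f g unfolding Lq_on_def by (intro set_integrable_mult_right set_integral_add) auto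
  fix t
  have "norm (f t - g t) powr q \<le> (norm (f t) + norm (g t)) powr q"
    using q norm_triangle_ineq4 by (intro powr_mono2) auto
  also have "\<dots> \<le> 2 powr q * (norm (f t) powr q + norm (g t) powr q)"
    using q by (intro powr_sum_le) auto
  finally show "norm (f t - g t) powr q \<le> 2 powr q * (norm (f t) powr q + norm (g t) powr q)" .
qed

lemma Lq_on_continuous:
  assumes "continuous_on {a..b} f" "q \<ge> 1"
  shows "Lq_on q {a..b} f"
proof -
  have "continuous_on {a..b} (\<lambda>t. norm (f t) powr q)"
    using assms by (intro continuous_intros continuous_on_powr') auto
  then have "set_integrable lebesgue {a..b} (\<lambda>t. norm (f t) powr q)" "set_integrable lebesgue {a..b} f"
    using assms(1) by (intro set_integrable_continuous_lebesgue; simp)+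
  then show ?thesis
    by (simp add: Lq_on_def set_borel_measurable_def set_integrable_def integrable_iff_bounded)
qed

lemma Lq_on_poly: "q \<ge> 1 \<Longrightarrow> Lq_on q {a..b} (poly_real R)"
  using continuous_poly_real[of "{a..b}" "\<lambda>x. x" R] by (intro Lq_on_continuous) simp_all

lemma Lq_on_imp_integrable:
  assumes f: "Lq_on q {a..b} f" and q: "q \<ge> 1"
  shows "Lq_on 1 {a..b} f" and "set_integrable lebesgue {a..b} f"
proof -
  have f': "set_borel_measurable lebesgue {a..b} f" "set_integrable lebesgue {a..b} (\<lambda>t. norm (f t) powr q)"
    using f by (auto simp: Lq_on_def)
  have \<phi>: "set_integrable lebesgue {a..b} (\<lambda>t. 1 + norm (f t) powr q)"
    using f'(2) by (intro set_integral_add set_integrable_const_interval)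
  have le: "norm (f t) \<le> 1 + norm (f t) powr q" for t
    using le_eps_powr[of "norm (f t)" 1 q] q by simp
  show "Lq_on 1 {a..b} f"
    by (rule Lq_on_bound[OF f'(1) \<phi>]) (use le in simp)
  show "set_integrable lebesgue {a..b} f"
  proof (rule set_integrable_bound[OF \<phi> f'(1)])
    show "AE t in lebesgue. t \<in> {a..b} \<longrightarrow> norm (f t) \<le> norm (1 + norm (f t) powr q)"
    proof (rule AE_I2, rule impI)
      fix t
      show "norm (f t) \<le> norm (1 + norm (f t) powr q)" using le[of t] by (simp add: add_nonneg_nonneg)
    qed
  qed
qed

lemma set_integral_powr_mean:
  assumes f: "Lq_on q {a..b} f" and q: "q \<ge> 1" and ab: "a < b" and w: "w \<ge> 0"
    and le: "(LINT t:{a..b}|lebesgue. norm (f t) powr q) \<le> (b - a) * w powr q"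
  shows "(LINT t:{a..b}|lebesgue. norm (f t)) \<le> 2 * w * (b - a)"
proof -
  have int: "set_integrable lebesgue {a..b} (\<lambda>t. norm (f t) powr q)" using f by (simp add: Lq_on_def)
  have int1: "set_integrable lebesgue {a..b} (\<lambda>t. norm (f t))"
    by (intro set_integrable_norm Lq_on_imp_integrable(2)[OF f q])
  have *: "(LINT t:{a..b}|lebesgue. norm (f t)) \<le> (b - a) * (\<epsilon> + \<epsilon> powr (1 - q) * w powr q)" if \<epsilon>: "\<epsilon> > 0" for \<epsilon>
  proof -
    have "(LINT t:{a..b}|lebesgue. norm (f t)) \<le> (LINT t:{a..b}|lebesgue. \<epsilon> + \<epsilon> powr (1 - q) * norm (f t) powr q)"
      using int1 int q \<epsilon>
      by (intro set_integral_mono set_integral_add set_integrable_mult_right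
          set_integrable_const_interval le_eps_powr) auto
    also have "\<dots> = (b - a) * \<epsilon> + \<epsilon> powr (1 - q) * (LINT t:{a..b}|lebesgue. norm (f t) powr q)"
      using ab int by (subst set_integral_add(2))
        (auto simp: set_integral_const_interval set_integrable_const_interval)
    also have "\<dots> \<le> (b - a) * \<epsilon> + \<epsilon> powr (1 - q) * ((b - a) * w powr q)"
      by (intro add_left_mono mult_left_mono le) auto
    finally show ?thesis by (simp add: algebra_simps)
  qed
  show ?thesis
  proof (cases "w = 0")
    case True
    have "(LINT t:{a..b}|lebesgue. norm (f t)) \<le> 0"
    proof (rule field_le_epsilon)
      fix e :: real assume "e > 0"
      then show "(LINT t:{a..b}|lebesgue. norm (f t)) \<le> 0 + e"
        using *[of "e / (b - a)"] ab True by simp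
    qed
    then show ?thesis using True by simp
  next
    case False
    have "w powr (1 - q) * w powr q = w" using False w by (simp flip: powr_add)
    then show ?thesis using *[of w] False w by (simp add: algebra_simps)
  qed
qed

lemma ex_Lq_version:
  assumes f: "Lq_on q {a..b} f" and q: "q \<ge> 1"
  shows "\<exists>g\<in>borel_measurable borel. (\<forall>t. t \<notin> {a..b} \<longrightarrow> g t = (0::complex)) \<and>
     (AE t in lborel. t \<in> {a..b} \<longrightarrow> f t = g t) \<and> integrable lborel (\<lambda>t. norm (g t) powr q) \<and> integrable lborel g"
proof -
  obtain g where gm [measurable]: "g \<in> borel_measurable borel" and supp: "\<forall>t. t \<notin> {a..b} \<longrightarrow> g t = 0"
    and ae: "AE t in lborel. t \<in> {a..b} \<longrightarrow> f t = g t"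
    using ex_borel_version f unfolding Lq_on_def by metis
  have "integrable lborel (\<lambda>t. norm (g t) powr q)"
  proof (rule integrableI_bounded)
    have "(\<integral>\<^sup>+t. ennreal (norm (norm (g t) powr q)) \<partial>lborel) = (\<integral>\<^sup>+t\<in>{a..b}. ennreal (norm (f t) powr q) \<partial>lborel)"
      using ae by (intro nn_integral_cong_AE, eventually_elim) (use supp q in \<open>auto simp: indicator_def\<close>)
    also have "\<dots> = ennreal (LINT t:{a..b}|lebesgue. norm (f t) powr q)"
      using f by (intro set_integral_eq_nn_integral[symmetric]) (auto simp: Lq_on_def)
    finally show "(\<integral>\<^sup>+t. ennreal (norm (norm (g t) powr q)) \<partial>lborel) < \<infinity>" by simp
  qed measurable
  moreover have "integrable lborel g"
  proof (rule Bochner_Integration.integrable_bound)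
    show "integrable lborel (\<lambda>t. indicator {a..b} t + norm (g t) powr q :: real)"
      using calculation by (intro Bochner_Integration.integrable_add integrable_real_indicator)
        (auto simp: emeasure_lborel_Icc_eq)
    show "AE t in lborel. norm (g t) \<le> norm (indicator {a..b} t + norm (g t) powr q)"
    proof (rule AE_I2)
      fix t
      show "norm (g t) \<le> norm (indicator {a..b} t + norm (g t) powr q)"
        using le_eps_powr[of "norm (g t)" 1 q] q supp by (cases "t \<in> {a..b}") auto
    qed
  qed measurable
  ultimately show ?thesis using supp ae gm by (intro bexI[of _ g] conjI)
qed

lemma powr_sum_le_card:
  fixes a :: "'i \<Rightarrow> real"
  assumes "finite A" "\<And>i. i \<in> A \<Longrightarrow> a i \<ge> 0" "q > 0"
  shows "(\<Sum>i\<in>A. a i) powr q \<le> real (card A) powr q * (\<Sum>i\<in>A. a i powr q)"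
proof -
  let ?M = "(\<Sum>i\<in>A. a i powr q) powr (1 / q)"
  have "a i \<le> ?M" if "i \<in> A" for i
  proof -
    have "a i = (a i powr q) powr (1 / q)" using assms that by (simp add: powr_powr)
    also have "\<dots> \<le> ?M"
      using assms that by (intro powr_mono2 member_le_sum) auto
    finally show ?thesis .
  qed
  then have "(\<Sum>i\<in>A. a i) \<le> real (card A) * ?M"
    by (rule sum_bounded_above)
  then have "(\<Sum>i\<in>A. a i) powr q \<le> (real (card A) * ?M) powr q"
    using assms by (intro powr_mono2 sum_nonneg) auto
  also have "\<dots> = real (card A) powr q * (\<Sum>i\<in>A. a i powr q)"
    using assms by (simp add: powr_mult powr_powr sum_nonneg)
  finally show ?thesis .
qed

lemma fdiff_powr_le:
  assumes "q > 0"
  shows "norm (fdiff k h g t) powr q \<le> (real (Suc k) * 2 ^ k) powr q * (\<Sum>i\<le>k. norm (g (t + real i * h)) powr q)"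
proof -
  have "norm (fdiff k h g t) \<le> (\<Sum>i\<le>k. 2 ^ k * norm (g (t + real i * h)))"
    unfolding fdiff_def
  proof (rule sum_norm_le)
    fix i assume "i \<in> {..k}"
    have "real (k choose i) \<le> 2 ^ k" using binomial_le_pow2[of k i] by (metis of_nat_le_iff of_nat_numeral of_nat_power)
    then show "norm ((-1) ^ (k + i) * of_nat (k choose i) * g (t + real i * h)) \<le> 2 ^ k * norm (g (t + real i * h))"
      by (simp add: norm_mult norm_power mult_right_mono)
  qed
  then have "norm (fdiff k h g t) powr q \<le> (2 ^ k * (\<Sum>i\<le>k. norm (g (t + real i * h)))) powr q"
    using assms by (intro powr_mono2) (auto simp: sum_distrib_left)
  also have "\<dots> = (2 ^ k) powr q * (\<Sum>i\<le>k. norm (g (t + real i * h))) powr q"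
    by (simp add: powr_mult sum_nonneg)
  also have "\<dots> \<le> (2 ^ k) powr q * (real (Suc k) powr q * (\<Sum>i\<le>k. norm (g (t + real i * h)) powr q))"
    using powr_sum_le_card[of "{..k}" "\<lambda>i. norm (g (t + real i * h))" q] assms
    by (intro mult_left_mono) auto
  finally show ?thesis by (simp add: powr_mult mult_ac)
qed

text \<open>\<open>modulus\<close> is a real supremum, which dominates its members only when they
  are bounded above; hence the second claim. It holds because all translates of the zero extension
  have the same norm.\<close>

lemma diff_op_Lq:
  assumes f: "Lq_on q {a..b} f" and q: "q \<ge> 1"
  shows "set_integrable lebesgue {a..b} (\<lambda>t. norm (diff_op k h {a..b} f t) powr q)"
    and "bdd_above (range (\<lambda>h. Lq_norm q {a..b} (diff_op k h {a..b} f)))"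
proof -
  obtain g where [measurable]: "g \<in> borel_measurable borel" and supp: "\<forall>t. t \<notin> {a..b} \<longrightarrow> g t = 0"
    and ae: "AE t in lborel. t \<in> {a..b} \<longrightarrow> f t = g t" and int: "integrable lborel (\<lambda>t. norm (g t) powr q)"
    using ex_Lq_version[OF f q] by metis
  define K where "K = (real (Suc k) * 2 ^ k) powr q"
  define S where "S h t = K * (\<Sum>i\<le>k. norm (g (t + real i * h)) powr q)" for h t
  have shift: "integrable lborel (\<lambda>t. norm (g (t + c)) powr q)"
    "(\<integral>t. norm (g (t + c)) powr q \<partial>lborel) = (\<integral>t. norm (g t) powr q \<partial>lborel)" for c
    using lborel_integrable_real_affine[OF int, of 1 c] lborel_integral_real_affine[of 1 "\<lambda>t. norm (g t) powr q" c]
    by (simp_all add: add.commute)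
  have S: "integrable lborel (S h)" "(\<integral>t. S h t \<partial>lborel) = K * (real (Suc k) * (\<integral>t. norm (g t) powr q \<partial>lborel))" for h
    unfolding S_def using shift by simp_all
  have dm: "diff_op k h {a..b} g \<in> borel_measurable borel" for h
    unfolding diff_op_eq_fdiff[abs_def] fdiff_def by measurable
  have le: "norm (diff_op k h {a..b} g t) powr q \<le> S h t" for h t
    using fdiff_powr_le[of q k h g t] q unfolding S_def K_def diff_op_eq_fdiff
    by (cases "t \<in> {a..b} \<and> t + real k * h \<in> {a..b}") (simp_all add: sum_nonneg del: atLeastAtMost_iff)
  have dint: "integrable lborel (\<lambda>t. norm (diff_op k h {a..b} g t) powr q)" for h
  proof (rule Bochner_Integration.integrable_bound[OF S(1)])
    show "(\<lambda>t. norm (diff_op k h {a..b} g t) powr q) \<in> borel_measurable lborel"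
      using dm by measurable
    show "AE t in lborel. norm (norm (diff_op k h {a..b} g t) powr q) \<le> norm (S h t)"
      using le[of h] by (intro AE_I2) (simp add: abs_le_iff order_trans[OF _ abs_ge_self])
  qed
  have dint': "set_integrable lebesgue {a..b} (\<lambda>t. norm (diff_op k h {a..b} g t) powr q)" for h
  proof -
    have "integrable lebesgue (\<lambda>t. norm (diff_op k h {a..b} g t) powr q)"
      using dint[of h] by (subst integrable_completion) (auto simp: integrable_iff_bounded)
    then show ?thesis unfolding set_integrable_def by (intro integrable_mult_indicator) auto
  qed
  have ae': "AE t in lborel. t \<in> {a..b} \<longrightarrow> norm (diff_op k h {a..b} f t) powr q = norm (diff_op k h {a..b} g t) powr q" for h
    using AE_diff_op[OF ae, of k h] by eventually_elim simp
  note sp = set_integrable_spike_AE[OF ae' dint']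
  show "set_integrable lebesgue {a..b} (\<lambda>t. norm (diff_op k h {a..b} f t) powr q)" by (rule sp(1))
  have "Lq_norm q {a..b} (diff_op k h {a..b} f) \<le> (K * (real (Suc k) * (\<integral>t. norm (g t) powr q \<partial>lborel))) powr (1 / q)" for h
    unfolding Lq_norm_def
  proof (rule powr_mono2)
    show "0 \<le> (LINT t:{a..b}|lebesgue. norm (diff_op k h {a..b} f t) powr q)"
      by (rule set_integral_nonneg_real) simp
    have "(LINT t:{a..b}|lebesgue. norm (diff_op k h {a..b} f t) powr q) = (LINT t:{a..b}|lebesgue. norm (diff_op k h {a..b} g t) powr q)"
      by (rule sp(2))
    also have "\<dots> \<le> (\<integral>t. S h t \<partial>lborel)"
    proof -
      have "ennreal (LINT t:{a..b}|lebesgue. norm (diff_op k h {a..b} g t) powr q)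
          = (\<integral>\<^sup>+t\<in>{a..b}. ennreal (norm (diff_op k h {a..b} g t) powr q) \<partial>lborel)"
        by (rule set_integral_eq_nn_integral[OF dint']) simp
      also have "\<dots> \<le> (\<integral>\<^sup>+t. ennreal (S h t) \<partial>lborel)"
        using le[of h] by (intro nn_integral_mono) (auto simp: indicator_def intro: ennreal_leI)
      also have "\<dots> = ennreal (\<integral>t. S h t \<partial>lborel)"
        using S(1) order_trans[OF powr_ge_zero le] by (intro nn_integral_eq_integral) auto
      finally show ?thesis
        using order_trans[OF powr_ge_zero le] by (subst (asm) ennreal_le_iff) (auto intro!: Bochner_Integration.integral_nonneg)
    qed
    finally show "(LINT t:{a..b}|lebesgue. norm (diff_op k h {a..b} f t) powr q)
        \<le> K * (real (Suc k) * (\<integral>t. norm (g t) powr q \<partial>lborel))" by (simp only: S(2))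
  qed (use q in simp)
  then show "bdd_above (range (\<lambda>h. Lq_norm q {a..b} (diff_op k h {a..b} f)))"
    by (auto simp: bdd_above_def)
qed

lemma modulus_nonneg:
  assumes "Lq_on q {a..b} f" "q \<ge> 1"
  shows "modulus k q {a..b} f \<ge> 0"
proof -
  have "0 \<le> Lq_norm q {a..b} (diff_op k 0 {a..b} f)" by (simp add: Lq_norm_def)
  also have "\<dots> \<le> modulus k q {a..b} f"
    unfolding modulus_def by (intro cSUP_upper diff_op_Lq(2)[OF assms]) simp
  finally show ?thesis .
qed

text \<open>Transport from the unit interval by the map sending \<open>t\<close> to
  \<open>a + L * t\<close>. As no norm here is normalised by length, both sides pick up the same
  power of \<open>L\<close>, and the constant is that of the unit interval.\<close>

theorem whitney:
  fixes q :: real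
  assumes k: "k \<ge> 2" and q: "q \<ge> 1"
  shows "\<exists>C>0. \<forall>a b f. a < b \<longrightarrow> Lq_on q {a..b} f \<longrightarrow>
    (\<exists>R\<in>Pi_poly k. (LINT t:{a..b}|lebesgue. norm (f t - poly_real R t) powr q) \<le> (C * modulus k q {a..b} f) powr q)"
proof -
  obtain C where C: "C > 0" and unit: "\<forall>g W. integrable lborel g \<longrightarrow> (\<forall>t. t \<notin> {0..1} \<longrightarrow> g t = 0) \<longrightarrow> W \<ge> 0 \<longrightarrow>
    (\<forall>h. 0 \<le> h \<longrightarrow> real k * h \<le> 1 \<longrightarrow>
      (\<integral>\<^sup>+t\<in>{0..1 - real k * h}. ennreal (norm (fdiff k h g t) powr q) \<partial>lborel) \<le> ennreal (W powr q)) \<longrightarrow>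
    (\<exists>R. degree R \<le> k - 1 \<and>
      (\<integral>\<^sup>+t\<in>{0..1}. ennreal (norm (g t - poly_real R t) powr q) \<partial>lborel) \<le> ennreal ((C * W) powr q))"
    using whitney_unit[OF k q] by blast
  have "\<exists>R\<in>Pi_poly k. (LINT t:{a..b}|lebesgue. norm (f t - poly_real R t) powr q) \<le> (C * modulus k q {a..b} f) powr q"
    if ab: "a < b" and f: "Lq_on q {a..b} f" for a b f
  proof -
    define L where "L = b - a"
    have L: "L > 0" using ab by (simp add: L_def)
    define \<omega> where "\<omega> = modulus k q {a..b} f"
    have \<omega>: "\<omega> \<ge> 0" unfolding \<omega>_def by (rule modulus_nonneg[OF f q])
    \<comment> \<open>Rescaling to the unit interval divides norms of exponent \<open>q\<close> by
      \<open>L powr (1 / q)\<close>.\<close>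
    define W where "W = \<omega> * L powr (- 1 / q)"
    have W: "W \<ge> 0" using \<omega> by (simp add: W_def)
    have Wq: "L * (c * W) powr q = (c * \<omega>) powr q" if "c \<ge> 0" for c
    proof -
      have "(L powr (- 1 / q)) powr q = 1 / L"
        using L q by (simp only: powr_powr) (simp add: powr_neg_one)
      then show ?thesis using L by (simp add: W_def powr_mult)
    qed
    obtain g where gm [measurable]: "g \<in> borel_measurable borel" and supp: "\<forall>t. t \<notin> {a..b} \<longrightarrow> g t = 0"
      and ae: "AE t in lborel. t \<in> {a..b} \<longrightarrow> f t = g t" and gint: "integrable lborel g"
      using ex_Lq_version[OF f q] by metis
    define G where "G t = g (a + L * t)" for t
    have [measurable]: "G \<in> borel_measurable borel" unfolding G_def by measurable
    have "\<exists>R. degree R \<le> k - 1 \<and>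
      (\<integral>\<^sup>+t\<in>{0..1}. ennreal (norm (G t - poly_real R t) powr q) \<partial>lborel) \<le> ennreal ((C * W) powr q)"
    proof (rule unit[rule_format, OF _ _ W])
      show "integrable lborel G"
        unfolding G_def using L by (intro lborel_integrable_real_affine gint) auto
      show "G t = 0" if "t \<notin> {0..1}" for t
      proof -
        have "a + L * t \<notin> {a..b}"
        proof
          assume "a + L * t \<in> {a..b}"
          then have "0 \<le> L * t" "L * t \<le> L * 1" by (auto simp: L_def)
          then show False using L that by (simp only: zero_le_mult_iff mult_le_cancel_left) auto
        qed
        then show ?thesis using supp by (simp add: G_def)
      qed
      fix h assume h: "0 \<le> h" "real k * h \<le> 1"
      define \<Phi> where "\<Phi> s = ennreal (norm (diff_op k (L * h) {a..b} g s) powr q)" for s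
      have [measurable]: "\<Phi> \<in> borel_measurable borel"
        unfolding \<Phi>_def diff_op_eq_fdiff fdiff_def by measurable
      have "L * (\<integral>\<^sup>+t\<in>{0..1 - real k * h}. ennreal (norm (fdiff k h G t) powr q) \<partial>lborel)
          \<le> ennreal L * (\<integral>\<^sup>+t. \<Phi> (a + L * t) \<partial>lborel)"
      proof (intro mult_left_mono nn_integral_mono)
        fix t
        show "ennreal (norm (fdiff k h G t) powr q) * indicator {0..1 - real k * h} t \<le> \<Phi> (a + L * t)"
        proof (cases "t \<in> {0..1 - real k * h}")
          case True
          have kh: "0 \<le> real k * h" using h by simp
          then have "0 \<le> t" "t + real k * h \<le> 1" "t \<le> 1" "0 \<le> t + real k * h"
            using True unfolding atLeastAtMost_iff by linarith+
          then have "0 \<le> L * t" "L * (t + real k * h) \<le> L * 1" "L * t \<le> L * 1" "0 \<le> L * (t + real k * h)"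
            using L by (auto intro: mult_left_mono mult_nonneg_nonneg)
          then have "a + L * t \<in> {a..b} \<and> a + L * t + real k * (L * h) \<in> {a..b}"
            by (simp add: L_def algebra_simps)
          moreover have "fdiff k h G t = fdiff k (L * h) g (a + L * t)"
            by (simp add: fdiff_def G_def algebra_simps)
          ultimately show ?thesis using True by (simp add: \<Phi>_def diff_op_eq_fdiff)
        qed simp
      qed simp
      also have "\<dots> = (\<integral>\<^sup>+s. \<Phi> s \<partial>lborel)"
        using nn_integral_real_affine[of \<Phi> L a] L by simp
      also have "\<dots> = (\<integral>\<^sup>+s\<in>{a..b}. ennreal (norm (diff_op k (L * h) {a..b} f s) powr q) \<partial>lborel)"
        using AE_diff_op[OF ae, of k "L * h"]
        by (intro nn_integral_cong_AE, eventually_elim)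
          (use q in \<open>auto simp: \<Phi>_def indicator_def diff_op_eq_fdiff\<close>)
      also have "\<dots> = ennreal (LINT s:{a..b}|lebesgue. norm (diff_op k (L * h) {a..b} f s) powr q)"
        by (rule set_integral_eq_nn_integral[OF diff_op_Lq(1)[OF f q], symmetric]) simp
      also have "\<dots> = ennreal (Lq_norm q {a..b} (diff_op k (L * h) {a..b} f) powr q)"
        using q set_integral_nonneg_real[of "{a..b}" "\<lambda>s. norm (diff_op k (L * h) {a..b} f s) powr q" lebesgue]
        by (simp add: Lq_norm_def powr_powr)
      also have "\<dots> \<le> ennreal (\<omega> powr q)"
        unfolding \<omega>_def modulus_def using q
        by (intro ennreal_leI powr_mono2 cSUP_upper diff_op_Lq(2)[OF f q]) (auto simp: Lq_norm_def)
      also have "\<dots> = ennreal L * ennreal (W powr q)"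
        using Wq[of 1] L by (simp flip: ennreal_mult')
      finally show "(\<integral>\<^sup>+t\<in>{0..1 - real k * h}. ennreal (norm (fdiff k h G t) powr q) \<partial>lborel) \<le> ennreal (W powr q)"
        using L by (subst (asm) ennreal_mult_le_mult_iff) auto
    qed
    then obtain R where R: "degree R \<le> k - 1"
      "(\<integral>\<^sup>+t\<in>{0..1}. ennreal (norm (G t - poly_real R t) powr q) \<partial>lborel) \<le> ennreal ((C * W) powr q)"
      by blast
    define R' where "R' = R \<circ>\<^sub>p [:- of_real (a / L), of_real (1 / L):]"
    have R': "poly_real R' (a + L * t) = poly_real R t" for t
    proof -
      have "complex_of_real (a + L * t) * of_real (1 / L) - of_real (a / L) = of_real t"
        using L by (simp add: field_simps flip: of_real_mult of_real_diff of_real_divide of_real_add)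
      then show ?thesis by (simp add: R'_def poly_real_def poly_pcompose mult.commute)
    qed
    have "degree R' \<le> k - 1"
      using R(1) degree_pcompose_le[of R "[:- of_real (a / L), of_real (1 / L):]"] L by (simp add: R'_def)
    then have R'P: "R' \<in> Pi_poly k" by (simp add: Pi_poly_def)
    have "Lq_on q {a..b} (\<lambda>t. f t - poly_real R' t)"
      by (intro Lq_on_diff f Lq_on_poly q)
    then have "ennreal (LINT t:{a..b}|lebesgue. norm (f t - poly_real R' t) powr q)
        = (\<integral>\<^sup>+t\<in>{a..b}. ennreal (norm (f t - poly_real R' t) powr q) \<partial>lborel)"
      by (intro set_integral_eq_nn_integral) (auto simp: Lq_on_def)
    also have "\<dots> = (\<integral>\<^sup>+t\<in>{a..b}. ennreal (norm (g t - poly_real R' t) powr q) \<partial>lborel)"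
      using ae by (intro nn_integral_cong_AE, eventually_elim) (auto simp: indicator_def)
    also have "\<dots> = ennreal L * (\<integral>\<^sup>+t. ennreal (norm (g (a + L * t) - poly_real R' (a + L * t)) powr q) * indicator {a..b} (a + L * t) \<partial>lborel)"
      using nn_integral_real_affine[of "\<lambda>t. ennreal (norm (g t - poly_real R' t) powr q) * indicator {a..b} t" L a] L
      by simp
    also have "\<dots> = ennreal L * (\<integral>\<^sup>+t\<in>{0..1}. ennreal (norm (G t - poly_real R t) powr q) \<partial>lborel)"
    proof -
      have "a + L * t \<in> {a..b} \<longleftrightarrow> t \<in> {0..1}" for t
      proof -
        have "a + L * t \<in> {a..b} \<longleftrightarrow> 0 \<le> L * t \<and> L * t \<le> L * 1" by (auto simp: L_def)
        then show ?thesis using L by (simp add: zero_le_mult_iff)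
      qed
      then show ?thesis by (simp add: R' G_def indicator_def del: atLeastAtMost_iff)
    qed
    also have "\<dots> \<le> ennreal L * ennreal ((C * W) powr q)"
      by (intro mult_left_mono R(2)) simp
    also have "\<dots> = ennreal ((C * \<omega>) powr q)"
      using Wq[of C] C L by (simp flip: ennreal_mult')
    finally show ?thesis using R'P unfolding \<omega>_def by (subst (asm) ennreal_le_iff) auto
  qed
  then show ?thesis using C by blast
qed

subsection \<open>Regular multilevel partitions\<close>

locale multilevel =
  fixes x :: "int \<Rightarrow> int \<Rightarrow> real" and M0 :: nat and lam :: real
  assumes reg: "regular_multilevel_partition M0 lam x"
begin

lemma lam: "lam \<ge> 1" and M0: "M0 \<ge> 2"
  and strict: "strict_mono (x m)"
  using reg by (auto simp: regular_multilevel_partition_def)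

lemma knot_less_iff [simp]: "x m i < x m j \<longleftrightarrow> i < j" and knot_le_iff [simp]: "x m i \<le> x m j \<longleftrightarrow> i \<le> j"
  using strict by (simp_all add: strict_mono_less strict_mono_less_eq)

lemma ex_interval: "\<exists>J. x m J \<le> t \<and> t < x m (J + 1)"
proof -
  have "t \<in> (\<Union>j. {x m j..x m (j + 1)})"
    using reg by (simp add: regular_multilevel_partition_def)
  then obtain j where j: "x m j \<le> t" "t \<le> x m (j + 1)" by auto
  show ?thesis
  proof (cases "t < x m (j + 1)")
    case False
    then have "t = x m (j + 1)" using j by simp
    then show ?thesis by (intro exI[of _ "j + 1"]) simp
  qed (use j in blast)
qed

definition len :: "int \<Rightarrow> int \<Rightarrow> real" where
  "len m j = x m (j + 1) - x m j"

text \<open>One length per level; by the ratio \<open>lam\<close> it is comparable with every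
  interval of that level.\<close>

definition mesh :: "int \<Rightarrow> real" where
  "mesh m = (INF j. len m j)"

lemma len_pos: "len m j > 0"
  by (simp add: len_def)

lemma len_le: "len m i \<le> lam * len m j"
  using reg by (simp add: regular_multilevel_partition_def len_def)

lemma mesh_le_len: "mesh m \<le> len m j"
  unfolding mesh_def using len_pos by (intro cINF_lower bdd_belowI2[of _ 0]) (auto intro: less_imp_le)

lemma len_le_mesh: "len m j \<le> lam * mesh m"
proof -
  have "len m j / lam \<le> mesh m"
    unfolding mesh_def using lam len_le[of m j]
    by (intro cINF_greatest) (auto simp: field_simps)
  then show ?thesis using lam by (simp add: field_simps)
qed

lemma mesh_pos: "mesh m > 0"
  using len_le_mesh[of m 0] len_pos[of m 0] lam by (smt (verit) mult_nonneg_nonpos)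

lemma knot_diff:
  "real n * mesh m \<le> x m (j + int n) - x m j \<and> x m (j + int n) - x m j \<le> real n * (lam * mesh m)"
proof (induction n)
  case (Suc n)
  have "x m (j + int (Suc n)) = x m (j + int n) + len m (j + int n)"
    by (simp add: len_def algebra_simps)
  then show ?case
    using Suc mesh_le_len[of m "j + int n"] len_le_mesh[of m "j + int n"] by (simp add: algebra_simps)
qed simp

lemma knot_diff_ge: "i \<le> j \<Longrightarrow> of_int (j - i) * mesh m \<le> x m j - x m i"
  using knot_diff[of "nat (j - i)" m i] by simp

lemma knot_diff_le: "i \<le> j \<Longrightarrow> x m j - x m i \<le> of_int (j - i) * (lam * mesh m)"
  using knot_diff[of "nat (j - i)" m i] by simp

lemma knot_dist_le:
  assumes "\<bar>i - j\<bar> \<le> n"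
  shows "\<bar>x m i - x m j\<bar> \<le> of_int n * (lam * mesh m)"
proof -
  have lm: "lam * mesh m \<ge> 0" using lam mesh_pos[of m] by simp
  have *: "x m j - x m i \<le> of_int n * (lam * mesh m)" if "i \<le> j" "j - i \<le> n" for i j
  proof -
    have "of_int (j - i) * (lam * mesh m) \<le> of_int n * (lam * mesh m)"
      using that lm by (intro mult_right_mono) auto
    then show ?thesis using knot_diff_le[OF that(1), of m] by linarith
  qed
  show ?thesis
    using assms *[of i j] *[of j i] by (cases "i \<le> j") auto
qed

text \<open>An index at level \<open>m - 1\<close>. The choice is harmless, since
  \<open>par_unique\<close> shows that only one index qualifies.\<close>

definition par :: "int \<Rightarrow> int \<Rightarrow> int" where
  "par m i = (SOME j. {x m i..x m (i + 1)} \<subseteq> {x (m - 1) j..x (m - 1) (j + 1)})"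

lemma par_knots: "x (m - 1) (par m i) \<le> x m i" "x m (i + 1) \<le> x (m - 1) (par m i + 1)"
proof -
  have "\<exists>j. {x ((m - 1) + 1) i..x ((m - 1) + 1) (i + 1)} \<subseteq> {x (m - 1) j..x (m - 1) (j + 1)}"
    using reg unfolding regular_multilevel_partition_def by blast
  then have "\<exists>j. {x m i..x m (i + 1)} \<subseteq> {x (m - 1) j..x (m - 1) (j + 1)}" by simp
  then have "{x m i..x m (i + 1)} \<subseteq> {x (m - 1) (par m i)..x (m - 1) (par m i + 1)}"
    unfolding par_def by (rule someI_ex)
  then show "x (m - 1) (par m i) \<le> x m i" "x m (i + 1) \<le> x (m - 1) (par m i + 1)"
    by (simp_all add: atLeastatMost_subset_iff)
qed

lemma par_unique:
  assumes "x (m - 1) j \<le> x m i" "x m (i + 1) \<le> x (m - 1) (j + 1)"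
  shows "par m i = j"
proof -
  have "x m i < x m (i + 1)" by simp
  then have "x (m - 1) j < x (m - 1) (par m i + 1)" "x (m - 1) (par m i) < x (m - 1) (j + 1)"
    using par_knots[where m = m and i = i] assms by linarith+
  then show ?thesis by simp
qed

text \<open>Neighbouring intervals overlap neighbouring or equal parents, and when the parent
  changes, the common knot is one of the coarser level. This locates the jumps of a coarse spline as
  seen from the finer level.\<close>

lemma par_step:
  "par m J = par m (J - 1) \<or> (par m J = par m (J - 1) + 1 \<and> x m J = x (m - 1) (par m J))"
proof -
  let ?j = "par m (J - 1)" and ?j' = "par m J"
  note k = par_knots[where m = m and i = J] par_knots[where m = m and i = "J - 1"]
  have "x m (J - 1) < x m J" "x m J < x m (J + 1)" by simp_all
  moreover have "x m J \<le> x (m - 1) (?j + 1)" using k(4) by simp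
  ultimately have "x (m - 1) ?j < x (m - 1) (?j' + 1)" "x (m - 1) ?j' \<le> x (m - 1) (?j + 1)"
    using k by linarith+
  then have "?j' = ?j \<or> ?j' = ?j + 1" by auto
  then show ?thesis using \<open>x m J \<le> x (m - 1) (?j + 1)\<close> k(1) by auto
qed

text \<open>Here \<open>j\<close> is an index at level \<open>m - 1\<close>, while the elements are
  indices at level \<open>m\<close>.\<close>

definition children :: "int \<Rightarrow> int \<Rightarrow> int set" where
  "children m j = {i. par m i = j}"

lemma children_card: "finite (children m j)" "card (children m j) \<in> {2..M0}"
proof -
  have eq: "children m j = {i. {x ((m - 1) + 1) i..x ((m - 1) + 1) (i + 1)} \<subseteq> {x (m - 1) j..x (m - 1) (j + 1)}}"
    using par_knots par_unique by (auto simp: children_def atLeastatMost_subset_iff)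
  have "\<forall>m j. card {i. {x (m + 1) i..x (m + 1) (i + 1)} \<subseteq> {x m j..x m (j + 1)}} \<in> {2..M0}"
    using reg unfolding regular_multilevel_partition_def by (elim conjE)
  then show "card (children m j) \<in> {2..M0}"
    unfolding eq by (elim allE)
  then show "finite (children m j)" by (intro card_ge_0_finite) auto
qed

text \<open>Two different children fit side by side into each interval. The geometric series over
  the levels all come from this factor 2.\<close>

lemma mesh_halves: "2 * mesh m \<le> mesh (m - 1)"
proof -
  have "2 * mesh m \<le> len (m - 1) j" for j
  proof -
    obtain a b where ab: "a \<in> children m j" "b \<in> children m j" "a < b"
    proof -
      have "\<not> card (children m j) \<le> 1" using children_card(2)[of m j] by auto
      then obtain a b where "a \<in> children m j" "b \<in> children m j" "a \<noteq> b"
        using card_le_Suc0_iff_eq[OF children_card(1), of m j] by auto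
      then show ?thesis using that[of a b] that[of b a] by linarith
    qed
    have "2 * mesh m \<le> of_int (b + 1 - a) * mesh m"
      using ab mesh_pos[of m] by (intro mult_right_mono) auto
    also have "\<dots> \<le> x m (b + 1) - x m a" using ab by (intro knot_diff_ge) auto
    also have "\<dots> \<le> len (m - 1) j"
      using par_knots(1)[of m a] par_knots(2)[of m b] ab(1,2) by (simp add: children_def len_def)
    finally show ?thesis .
  qed
  then show ?thesis unfolding mesh_def[of "m - 1"] by (intro cINF_greatest) auto
qed

text \<open>The children of an interval form a block of consecutive indices whose outer knots are
  those of the parent, so at most \<open>M0\<close> lengths add up to that of the parent.\<close>

lemma mesh_parent_le: "mesh (m - 1) \<le> real M0 * lam * mesh m"
proof -
  let ?C = "children m 0"
  define a b where "a = Min ?C" and "b = Max ?C"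
  have ne: "?C \<noteq> {}" using children_card(2)[of m 0] by auto
  have a: "par m a = 0" and b: "par m b = 0"
    using Min_in[OF children_card(1) ne] Max_in[OF children_card(1) ne] by (auto simp: a_def b_def children_def)
  have le: "a \<le> i" "i \<le> b" if "par m i = 0" for i
    using that children_card(1)[of m 0] by (auto simp: a_def b_def children_def)
  have "x m a = x (m - 1) 0"
    using par_step[of m a] le(1)[of "a - 1"] a by auto
  moreover have "x m (b + 1) = x (m - 1) 1"
    using par_step[of m "b + 1"] le(2)[of "b + 1"] b by auto
  ultimately have "len (m - 1) 0 = x m (b + 1) - x m a" by (simp add: len_def)
  also have "\<dots> \<le> of_int (b + 1 - a) * (lam * mesh m)"
    using le(1)[OF b] by (intro knot_diff_le) auto
  also have "\<dots> \<le> real M0 * (lam * mesh m)"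
  proof (intro mult_right_mono)
    have "{a..b} \<subseteq> ?C"
    proof
      fix i assume i: "i \<in> {a..b}"
      have "x (m - 1) 0 \<le> x m a" "x m (b + 1) \<le> x (m - 1) (0 + 1)"
        using par_knots(1)[of m a] par_knots(2)[of m b] a b by auto
      moreover have "x m a \<le> x m i" "x m (i + 1) \<le> x m (b + 1)" using i by auto
      ultimately have "x (m - 1) 0 \<le> x m i" "x m (i + 1) \<le> x (m - 1) (0 + 1)"
        by linarith+
      then show "i \<in> ?C"
        unfolding children_def mem_Collect_eq by (rule par_unique)
    qed
    then have "card {a..b} \<le> card ?C" by (rule card_mono[OF children_card(1)])
    then have "card {a..b} \<le> M0" using children_card(2)[of m 0] by auto
    then show "real_of_int (b + 1 - a) \<le> real M0" using le(1)[OF b] by simp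
  qed (use lam mesh_pos[of m] in auto)
  finally show ?thesis using mesh_le_len[of "m - 1" 0] by (simp add: mult.assoc)
qed

lemma mesh_power: "2 ^ n * mesh (m + int n) \<le> mesh m"
proof (induction n)
  case (Suc n)
  have "2 ^ Suc n * mesh (m + int (Suc n)) = 2 ^ n * (2 * mesh (m + int (Suc n)))" by simp
  also have "\<dots> \<le> 2 ^ n * mesh (m + int (Suc n) - 1)"
    by (intro mult_left_mono mesh_halves) auto
  also have "\<dots> = 2 ^ n * mesh (m + int n)" by simp
  finally show ?case using Suc.IH by (rule order_trans)
qed simp

lemma mesh_power': "m \<le> m' \<Longrightarrow> 2 ^ nat (m' - m) * mesh m' \<le> mesh m"
  using mesh_power[of "nat (m' - m)" m] by simp

lemma mesh_antimono: "m \<le> m' \<Longrightarrow> mesh m' \<le> mesh m"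
proof -
  assume "m \<le> m'"
  have "1 * mesh m' \<le> 2 ^ nat (m' - m) * mesh m'"
    using mesh_pos[of m'] by (intro mult_right_mono) auto
  then show ?thesis using mesh_power'[OF \<open>m \<le> m'\<close>] by simp
qed

lemma par_shift_down: "par m J - int n \<le> par m (J - int n)"
proof (induction n)
  case (Suc n)
  have "par m (J - int n) - 1 \<le> par m (J - int n - 1)" using par_step[of m "J - int n"] by auto
  then show ?case using Suc by (simp add: algebra_simps)
qed simp

lemma par_shift_up: "par m (J + int n) \<le> par m J + int n"
proof (induction n)
  case (Suc n)
  have "par m (J + int n + 1) \<le> par m (J + int n) + 1" using par_step[of m "J + int n + 1"] by auto
  then show ?case using Suc by (simp add: algebra_simps)
qed simp

text \<open>One step in the index changes the parent index by at most one, so \<open>n\<close>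
  neighbours on each side stay within \<open>n\<close> neighbours of the parent. For
  \<open>n = d\<close> these are the enlarged intervals of the Besov norm.\<close>

lemma enlarged_nested:
  "{x m (J - int n)..x m (J + int n + 1)} \<subseteq> {x (m - 1) (par m J - int n)..x (m - 1) (par m J + int n + 1)}"
proof -
  have "x (m - 1) (par m J - int n) \<le> x (m - 1) (par m (J - int n))" using par_shift_down by simp
  moreover have "x (m - 1) (par m (J + int n) + 1) \<le> x (m - 1) (par m J + int n + 1)" using par_shift_up by simp
  ultimately show ?thesis
    using par_knots(1)[of m "J - int n"] par_knots(2)[of m "J + int n"]
    unfolding atLeastatMost_subset_iff by linarith
qed

text \<open>On interval \<open>J\<close> the coarse spline is the piece of the parent. It can jump
  across a knot only if the parent changes, and then the knot belongs to the coarser level; so all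
  jumps have the form that \<open>spline_of_pieces\<close> asks for.\<close>

lemma spline_difference:
  fixes c c' :: "int \<Rightarrow> complex" and m :: int and d :: nat
  assumes d: "d \<ge> 1"
  defines "p \<equiv> \<lambda>J. spiece (x m) d c J - spiece (x (m - 1)) d c' (par m J)"
  defines "b \<equiv> \<lambda>j. dbf (Suc d) (x m) j (p j) 0"
  shows "spline_sum (x m) (Suc d) c t - spline_sum (x (m - 1)) (Suc d) c' t = spline_sum (x m) (Suc d) b t"
proof -
  have "\<exists>a. p J - p (J - 1) = smult a ([:- of_real (x m J), 1:] ^ d)" for J
  proof -
    obtain a where a: "spiece (x m) d c J - spiece (x m) d c (J - 1) = smult a ([:- of_real (x m J), 1:] ^ d)"
      using spiece_jump[OF strict] by blast
    obtain a' where a': "spiece (x (m - 1)) d c' (par m J) - spiece (x (m - 1)) d c' (par m (J - 1))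
        = smult a' ([:- of_real (x m J), 1:] ^ d)"
    proof (cases "par m J = par m (J - 1)")
      case True
      then show ?thesis using that[of 0] by simp
    next
      case False
      then have "par m (J - 1) = par m J - 1" "x m J = x (m - 1) (par m J)"
        using par_step[of m J] by auto
      then show ?thesis using that spiece_jump[OF strict, where J = "par m J"] by metis
    qed
    have "p J - p (J - 1) = (spiece (x m) d c J - spiece (x m) d c (J - 1))
        - (spiece (x (m - 1)) d c' (par m J) - spiece (x (m - 1)) d c' (par m (J - 1)))"
      by (simp add: p_def)
    also have "\<dots> = smult (a - a') ([:- of_real (x m J), 1:] ^ d)"
      unfolding a a' by (simp add: smult_diff_left)
    finally show ?thesis by blast
  qed
  then have p: "p J = spiece (x m) d b J" for J
    unfolding b_def by (intro spline_of_pieces strict) (auto simp: p_def intro!: degree_diff_le degree_spiece)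
  obtain J where J: "x m J \<le> t" "t < x m (J + 1)" using ex_interval by blast
  then have J': "x (m - 1) (par m J) \<le> t" "t < x (m - 1) (par m J + 1)"
    using par_knots[where m = m and i = J] by linarith+
  show ?thesis
    unfolding spline_sum_eq_spiece[OF strict J] spline_sum_eq_spiece[OF strict J'] p[symmetric]
    by (simp add: p_def poly_real_def)
qed

end

section \<open>The quasi-interpolant and its local errors\<close>

lemma poly_real_derivative: "(poly_real R has_vector_derivative poly_real (pderiv R) t) (at t)"
  unfolding poly_real_def
  using has_vector_derivative_real_field[of "poly R" "poly (pderiv R) (of_real t)" t UNIV] poly_DERIV by simp

lemma nth_deriv_poly:
  assumes "open U" "\<And>s. s \<in> U \<Longrightarrow> S s = poly_real R s" "t \<in> U"
  shows "nth_deriv n S t = poly_real ((pderiv ^^ n) R) t"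
  using assms(3)
proof (induction n arbitrary: t)
  case 0
  then show ?case by (simp add: nth_deriv_def assms(2))
next
  case (Suc n)
  have "(nth_deriv n S has_vector_derivative poly_real (pderiv ((pderiv ^^ n) R)) t) (at t)"
    by (rule has_vector_derivative_transform_within_open[OF poly_real_derivative assms(1) Suc.prems])
      (simp add: Suc.IH)
  moreover have "nth_deriv (Suc n) S t = vector_derivative (nth_deriv n S) (at t)"
    by (simp add: nth_deriv_def)
  ultimately show ?case by (simp add: vector_derivative_at)
qed

lemma bpiece_bound:
  assumes y: "strict_mono y" and t: "y J \<le> t" "t \<le> y (J + 1)"
  shows "norm (poly_real (bpiece y d j J) t) \<le> 2 ^ d"
proof -
  have J: "y J < y (J + 1)" using y by (simp add: strict_mono_less)
  have bound: "norm (poly_real (bpiece y d j J) s) \<le> 2 ^ d" if "s \<in> {y J..<y (J + 1)}" for s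
  proof -
    have "poly_real (bpiece y d j J) s = of_real (bspline y d j s)"
      using that bspline_eq_bpiece[OF y, of J s d j] by (simp add: poly_real_def)
    then show ?thesis using bspline_bounds[OF y, of d j s] by simp
  qed
  have cl: "t \<in> closure {y J..<y (J + 1)}"
    using J t by simp
  have cont: "continuous_on (closure {y J..<y (J + 1)}) (\<lambda>t. norm (poly_real (bpiece y d j J) t))"
    by (intro continuous_intros)
  show ?thesis by (rule continuous_le_on_closure[OF cont cl bound])
qed

text \<open>The order \<open>k\<close> is \<open>Suc d\<close>, so that \<open>d\<close> is the
  degree of the splines.\<close>

locale quasi_interpolation = multilevel x M0 lam for x M0 lam +
  fixes \<xi> :: "int \<Rightarrow> int \<Rightarrow> real" and P :: "real \<Rightarrow> real \<Rightarrow> (real \<Rightarrow> complex) \<Rightarrow> complex poly"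
    and q A :: real and d :: nat
  assumes d: "d \<ge> 1" and q: "q \<ge> 1"
    and proj: "near_best_projectors (Suc d) q A P"
    and adm: "admissible_points (Suc d) x \<xi>"
begin

abbreviation "T m f \<equiv> quasi_interpolant (Suc d) P x \<xi> m f"

definition idx :: "int \<Rightarrow> int \<Rightarrow> int" where
  "idx m j = (SOME i. i \<in> {j..<j + int (Suc d)} \<and> \<xi> m j \<in> {x m i<..<x m (i + 1)})"

lemma idx: "idx m j \<in> {j..j + int d}" "\<xi> m j \<in> {x m (idx m j)<..<x m (idx m j + 1)}"
proof -
  have "\<exists>i. i \<in> {j..<j + int (Suc d)} \<and> \<xi> m j \<in> {x m i<..<x m (i + 1)}"
    using adm unfolding admissible_points_def by blast
  then have "idx m j \<in> {j..<j + int (Suc d)} \<and> \<xi> m j \<in> {x m (idx m j)<..<x m (idx m j + 1)}"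
    unfolding idx_def by (rule someI_ex)
  then show "idx m j \<in> {j..j + int d}" "\<xi> m j \<in> {x m (idx m j)<..<x m (idx m j + 1)}" by auto
qed

definition coef :: "int \<Rightarrow> (real \<Rightarrow> complex) \<Rightarrow> int \<Rightarrow> complex" where
  "coef m f j = dbf (Suc d) (x m) j (P (x m (idx m j)) (x m (idx m j + 1)) f) (\<xi> m j)"

text \<open>The point lies in the open interval \<open>idx m j\<close>, on which
  \<open>piecewise_proj\<close> is a single polynomial; the doubled values at knots never
  enter.\<close>

lemma beta_coeff_eq: "beta_coeff (Suc d) (x m) (\<xi> m) (piecewise_proj P (x m) f) j = coef m f j"
proof -
  let ?i = "idx m j"
  let ?R = "P (x m ?i) (x m (?i + 1)) f"
  have "piecewise_proj P (x m) f s = poly_real ?R s" if s: "s \<in> {x m ?i<..<x m (?i + 1)}" for s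
  proof -
    have "{i. s \<in> {x m i..x m (i + 1)}} = {?i}"
    proof (intro equalityI subsetI)
      fix i assume "i \<in> {i. s \<in> {x m i..x m (i + 1)}}"
      then have "x m i \<le> s" "s \<le> x m (i + 1)" by auto
      moreover have "x m ?i < s" "s < x m (?i + 1)" using s by auto
      ultimately have "x m i < x m (?i + 1)" "x m ?i < x m (i + 1)" by linarith+
      then show "i \<in> {?i}" by simp
    qed (use s in auto)
    then show ?thesis by (simp add: piecewise_proj_def)
  qed
  then have "nth_deriv \<nu> (piecewise_proj P (x m) f) (\<xi> m j) = poly_real ((pderiv ^^ \<nu>) ?R) (\<xi> m j)" for \<nu>
    using idx(2)[of m j] by (intro nth_deriv_poly[of "{x m ?i<..<x m (?i + 1)}"]) auto
  then show ?thesis by (simp add: beta_coeff_def coef_def dbf_def poly_real_def)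
qed

lemma T_eq: "T m f t = spline_sum (x m) (Suc d) (coef m f) t"
  by (simp add: quasi_interpolant_def beta_coeff_eq[abs_def])

lemma T_eq_spiece: "t \<in> {x m J..x m (J + 1)} \<Longrightarrow> T m f t = poly_real (spiece (x m) d (coef m f) J) t"
  unfolding T_eq using d by (intro spline_sum_closed strict) auto

lemma dbf_le_pmean_level:
  "\<exists>C>0. \<forall>R m j i s. degree R \<le> d \<longrightarrow> i \<in> {j..j + int d} \<longrightarrow>
     norm (dbf (Suc d) (x m) j R s) \<le> C * pmean R (x m i) (len m i)"
proof -
  \<comment> \<open>The interior knots of a B-spline are at most \<open>d\<close> intervals away
    from the left end of any interval in its support, and each of these intervals is at most
    \<open>lam\<close> times as long as that one.\<close>
  obtain C where C: "C > 0" "\<forall>R y j s a L. strict_mono y \<longrightarrow> degree R \<le> d \<longrightarrow> L > 0 \<longrightarrow>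
     (\<forall>i\<in>{j + 1..j + int d}. \<bar>y i - a\<bar> \<le> (real d * lam) * L) \<longrightarrow> norm (dbf (Suc d) y j R s) \<le> C * pmean R a L"
    using dbf_le_pmean[of "real d * lam" d] lam by auto
  have "norm (dbf (Suc d) (x m) j R s) \<le> C * pmean R (x m i) (len m i)"
    if R: "degree R \<le> d" and i: "i \<in> {j..j + int d}" for R m j i s
  proof (rule C(2)[rule_format, OF strict R len_pos])
    fix l assume "l \<in> {j + 1..j + int d}"
    then have "\<bar>x m l - x m i\<bar> \<le> of_int (int d) * (lam * mesh m)"
      using i by (intro knot_dist_le) auto
    also have "\<dots> \<le> real d * lam * len m i"
      using mesh_le_len[of m i] lam by (simp add: mult_left_mono mult.assoc)
    finally show "\<bar>x m l - x m i\<bar> \<le> real d * lam * len m i" .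
  qed
  then show ?thesis using C(1) by blast
qed

lemma Lq_norm_powr: "Lq_norm q S g powr q = (LINT t:S|lebesgue. norm (g t) powr q)"
  using q set_integral_nonneg_real[of S "\<lambda>t. norm (g t) powr q" lebesgue]
  by (simp add: Lq_norm_def powr_powr)

text \<open>The zero polynomial competes in \<open>best_approx\<close>, so the error of the
  projector is at most \<open>A\<close> times the norm of \<open>g\<close>; the triangle inequality
  does the rest.\<close>

lemma proj_bounded:
  assumes ab: "a < b" and g: "Lq_on q {a..b} g"
  shows "(LINT t:{a..b}|lebesgue. norm (poly_real (P a b g) t) powr q)
     \<le> 2 powr q * (1 + A powr q) * (LINT t:{a..b}|lebesgue. norm (g t) powr q)"
proof -
  let ?I = "\<lambda>h. LINT t:{a..b}|lebesgue. norm (h t :: complex) powr q"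
  let ?h = "\<lambda>t. g t - poly_real (P a b g) t"
  have A: "A \<ge> 1" and le: "Lq_norm q {a..b} ?h \<le> A * best_approx (Suc d) q {a..b} g"
    using proj ab g unfolding near_best_projectors_def by blast+
  have "best_approx (Suc d) q {a..b} g \<le> Lq_norm q {a..b} (\<lambda>t. g t - poly_real 0 t)"
    unfolding best_approx_def
    by (intro cINF_lower bdd_belowI2[of _ 0]) (auto simp: Lq_norm_def Pi_poly_def)
  then have "A * best_approx (Suc d) q {a..b} g \<le> A * Lq_norm q {a..b} g"
    using A by (intro mult_left_mono) (auto simp: poly_real_def)
  then have "Lq_norm q {a..b} ?h \<le> A * Lq_norm q {a..b} g" using le by linarith
  then have "Lq_norm q {a..b} ?h powr q \<le> (A * Lq_norm q {a..b} g) powr q"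
    using q by (intro powr_mono2) (auto simp: Lq_norm_def)
  then have h: "?I ?h \<le> A powr q * ?I g"
    using A by (simp add: powr_mult Lq_norm_powr)
  have hL: "Lq_on q {a..b} ?h" by (intro Lq_on_diff g Lq_on_poly q)
  have "?I (poly_real (P a b g)) \<le> (LINT t:{a..b}|lebesgue. 2 powr q * (norm (g t) powr q + norm (?h t) powr q))"
  proof (rule set_integral_mono)
    show "set_integrable lebesgue {a..b} (\<lambda>t. norm (poly_real (P a b g) t) powr q)"
      using Lq_on_poly[OF q, of a b] by (simp add: Lq_on_def)
    show "set_integrable lebesgue {a..b} (\<lambda>t. 2 powr q * (norm (g t) powr q + norm (?h t) powr q))"
      using g hL unfolding Lq_on_def by (intro set_integrable_mult_right set_integral_add) auto
    fix t
    have "norm (poly_real (P a b g) t) powr q \<le> (norm (g t) + norm (?h t)) powr q"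
      using q norm_triangle_ineq4[of "g t" "?h t"] by (intro powr_mono2) auto
    also have "\<dots> \<le> 2 powr q * (norm (g t) powr q + norm (?h t) powr q)"
      using q by (intro powr_sum_le) auto
    finally show "norm (poly_real (P a b g) t) powr q \<le> 2 powr q * (norm (g t) powr q + norm (?h t) powr q)" .
  qed
  also have "\<dots> = 2 powr q * (?I g + ?I ?h)"
    using g hL unfolding Lq_on_def by (simp add: set_integral_add(2))
  also have "\<dots> \<le> 2 powr q * (?I g + A powr q * ?I g)"
    by (intro mult_left_mono add_left_mono h) auto
  finally show ?thesis by (simp add: algebra_simps)
qed

lemma proj_diff_poly:
  assumes ab: "a < b" and f: "Lq_on q {a..b} f" and R: "degree R \<le> d"
  shows "P a b (\<lambda>t. f t - poly_real R t) = P a b f - R"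
proof -
  have "- R \<in> Pi_poly (Suc d)" using R by (simp add: Pi_poly_def)
  then have "P a b (poly_real (- R)) = - R"
    using proj ab unfolding near_best_projectors_def by blast
  moreover have "P a b (\<lambda>t. f t + poly_real (- R) t) = P a b f + P a b (poly_real (- R))"
    using proj ab f Lq_on_poly[OF q] unfolding near_best_projectors_def by blast
  ultimately show ?thesis by (simp add: poly_real_def)
qed

lemma proj_degree: "a < b \<Longrightarrow> Lq_on q {a..b} f \<Longrightarrow> degree (P a b f) \<le> d"
  using proj unfolding near_best_projectors_def Pi_poly_def by auto

text \<open>With \<open>k = Suc d\<close> this is the enlarged interval of
  \<open>besov_local\<close>.\<close>

abbreviation "Om m J \<equiv> {x m (J - int d)..x m (J + int d + 1)}"

lemma interval_in_Om: "i \<in> {J - int d..J + int d} \<Longrightarrow> {x m i..x m (i + 1)} \<subseteq> Om m J"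
  by (simp add: atLeastatMost_subset_iff)

lemma Om_length: "mesh m \<le> x m (J + int d + 1) - x m (J - int d)"
  "x m (J + int d + 1) - x m (J - int d) \<le> (2 * real d + 1) * lam * mesh m"
proof -
  have "1 * mesh m \<le> of_int (J + int d + 1 - (J - int d)) * mesh m"
    using mesh_pos[of m] by (intro mult_right_mono) auto
  then show "mesh m \<le> x m (J + int d + 1) - x m (J - int d)"
    using knot_diff_ge[of "J - int d" "J + int d + 1" m] by linarith
  show "x m (J + int d + 1) - x m (J - int d) \<le> (2 * real d + 1) * lam * mesh m"
    using knot_diff_le[of "J - int d" "J + int d + 1" m] by (simp add: algebra_simps)
qed

text \<open>Reproduction of polynomials turns the error into functionals of the projected difference
  \<open>f - R\<close>. The coefficients active on interval \<open>J\<close> use data from intervals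
  at most \<open>d\<close> steps away, all of which lie in \<open>Om m J\<close>.\<close>

lemma T_near_poly:
  "\<exists>C>0. \<forall>f m J R w. Lq_loc q f \<longrightarrow> degree R \<le> d \<longrightarrow> w \<ge> 0 \<longrightarrow>
     (LINT t:Om m J|lebesgue. norm (f t - poly_real R t) powr q) \<le> mesh m * w powr q \<longrightarrow>
     (\<forall>t\<in>{x m J..x m (J + 1)}. norm (T m f t - poly_real R t) \<le> C * w)"
proof -
  obtain C where C: "C > 0" "\<forall>R m j i s. degree R \<le> d \<longrightarrow> i \<in> {j..j + int d} \<longrightarrow>
     norm (dbf (Suc d) (x m) j R s) \<le> C * pmean R (x m i) (len m i)"
    using dbf_le_pmean_level by blast
  define B where "B = (2 powr q * (1 + A powr q)) powr (1 / q)"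
  have B: "B > 0" "B powr q = 2 powr q * (1 + A powr q)"
  proof -
    have "1 + A powr q \<noteq> 0" "1 + A powr q > 0" using powr_ge_zero[of A q] by linarith+
    then show "B > 0" "B powr q = 2 powr q * (1 + A powr q)"
      using q by (simp_all add: B_def powr_powr)
  qed
  define C' where "C' = real (Suc d) * (C * (2 * B) * 2 ^ d)"
  have C': "C' > 0" using B C by (simp add: C'_def)
  have "norm (T m f t - poly_real R t) \<le> C' * w"
    if f: "Lq_loc q f" and R: "degree R \<le> d" and w: "w \<ge> 0"
      and le: "(LINT t:Om m J|lebesgue. norm (f t - poly_real R t) powr q) \<le> mesh m * w powr q"
      and t: "t \<in> {x m J..x m (J + 1)}" for f m J R w t
  proof -
    have dj: "norm (coef m f j - dbf (Suc d) (x m) j R (\<xi> m j)) \<le> C * (2 * B) * w"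
      if j: "j \<in> {J - int d..J}" for j
    proof -
      define a b where "a = x m (idx m j)" and "b = x m (idx m j + 1)"
      have ab: "a < b" and ba: "b - a = len m (idx m j)" and b: "b = a + len m (idx m j)"
        by (simp_all add: a_def b_def len_def)
      let ?g = "\<lambda>t. f t - poly_real R t"
      have fab: "Lq_on q {a..b} f" using f by (simp add: Lq_loc_def)
      have gab: "Lq_on q {a..b} ?g" by (intro Lq_on_diff fab Lq_on_poly q)
      have sub: "{a..b} \<subseteq> Om m J"
        unfolding a_def b_def using idx(1)[of m j] j by (intro interval_in_Om) auto
      have "Lq_on q (Om m J) ?g"
        using f by (intro Lq_on_diff Lq_on_poly q) (simp add: Lq_loc_def)
      then have "(LINT t:{a..b}|lebesgue. norm (?g t) powr q) \<le> (LINT t:Om m J|lebesgue. norm (?g t) powr q)"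
        using sub unfolding Lq_on_def by (intro set_integral_mono_subset) auto
      also have "\<dots> \<le> mesh m * w powr q" by (rule le)
      also have "\<dots> \<le> (b - a) * w powr q"
        unfolding ba by (intro mult_right_mono mesh_le_len) auto
      finally have g: "(LINT t:{a..b}|lebesgue. norm (?g t) powr q) \<le> (b - a) * w powr q" .
      have "(LINT t:{a..b}|lebesgue. norm (poly_real (P a b ?g) t) powr q)
          \<le> B powr q * (LINT t:{a..b}|lebesgue. norm (?g t) powr q)"
        unfolding B(2) by (rule proj_bounded[OF ab gab])
      also have "\<dots> \<le> B powr q * ((b - a) * w powr q)"
        by (intro mult_left_mono g) auto
      also have "\<dots> = (b - a) * (B * w) powr q" using B(1) w by (simp add: powr_mult)
      finally have "(LINT t:{a..b}|lebesgue. norm (poly_real (P a b ?g) t)) \<le> 2 * (B * w) * (b - a)"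
        using B(1) w by (intro set_integral_powr_mean[OF Lq_on_poly[OF q] q ab]) auto
      then have pm: "pmean (P a b f - R) a (len m (idx m j)) \<le> 2 * B * w"
        unfolding pmean_def proj_diff_poly[OF ab fab R] b[symmetric] using len_pos[of m "idx m j"]
        by (simp add: ba[symmetric] divide_le_eq mult.assoc)
      have "coef m f j - dbf (Suc d) (x m) j R (\<xi> m j) = dbf (Suc d) (x m) j (P a b f - R) (\<xi> m j)"
        by (simp add: coef_def dbf_diff a_def b_def)
      also have "norm \<dots> \<le> C * pmean (P a b f - R) a (len m (idx m j))"
        unfolding a_def using proj_degree[OF ab fab] R idx(1)
        by (intro C(2)[rule_format] degree_diff_le) (auto simp: a_def)
      also have "\<dots> \<le> C * (2 * B * w)"
        using C(1) by (intro mult_left_mono pm) auto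
      finally show ?thesis by (simp add: mult.assoc)
    qed
    \<comment> \<open>\<open>dbf_reproduces\<close> works with one common point, whereas each
      coefficient uses its own \<open>\<xi> m j\<close>; \<open>dbf_indep\<close> removes the
      mismatch.\<close>
    define s where "s = \<xi> m J"
    have "dbf (Suc d) (x m) j R (\<xi> m j) = dbf (Suc d) (x m) j R s" for j
      by (rule dbf_indep[OF strict R])
    then have "R = (\<Sum>j\<in>{J - int d..J}. smult (dbf (Suc d) (x m) j R (\<xi> m j)) (bpiece (x m) d j J))"
      using dbf_reproduces[OF strict[of m] R, where J = J and s = s] by simp
    then have "poly_real (spiece (x m) d (coef m f) J) t - poly_real R t
        = poly_real (\<Sum>j\<in>{J - int d..J}. smult (coef m f j) (bpiece (x m) d j J)) t
          - poly_real (\<Sum>j\<in>{J - int d..J}. smult (dbf (Suc d) (x m) j R (\<xi> m j)) (bpiece (x m) d j J)) t"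
      by (simp add: spiece_def)
    also have "\<dots> = (\<Sum>j\<in>{J - int d..J}. (coef m f j - dbf (Suc d) (x m) j R (\<xi> m j)) * poly_real (bpiece (x m) d j J) t)"
      by (simp add: poly_real_def poly_sum sum_subtractf left_diff_distrib)
    also have "norm \<dots> \<le> (\<Sum>j\<in>{J - int d..J}. C * (2 * B) * w * 2 ^ d)"
    proof (rule sum_norm_le)
      fix j assume j: "j \<in> {J - int d..J}"
      have "norm (poly_real (bpiece (x m) d j J) t) \<le> 2 ^ d"
        using t by (intro bpiece_bound strict) auto
      then show "norm ((coef m f j - dbf (Suc d) (x m) j R (\<xi> m j)) * poly_real (bpiece (x m) d j J) t)
          \<le> C * (2 * B) * w * 2 ^ d"
        unfolding norm_mult using dj[OF j] C(1) B(1) w by (intro mult_mono) auto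
    qed
    also have "\<dots> = C' * w" by (simp add: C'_def)
    finally show ?thesis using T_eq_spiece[OF t] by simp
  qed
  then show ?thesis using C' by blast
qed

definition W :: "(real \<Rightarrow> complex) \<Rightarrow> int \<Rightarrow> int \<Rightarrow> real" where
  "W f m J = besov_local x (Suc d) q f (m, J)"

lemma W_eq: "W f m J = len m J powr (- 1 / q) * modulus (Suc d) q (Om m J) f"
  by (simp add: W_def besov_local_def len_def algebra_simps)

lemma W_nonneg: "Lq_loc q f \<Longrightarrow> W f m J \<ge> 0"
  unfolding W_eq using modulus_nonneg[OF _ q] by (simp add: Lq_loc_def)

text \<open>The polynomial of Whitney's inequality serves both estimates, the first one through
  \<open>T_near_poly\<close>. Later steps compare in L1 only, so the exponent \<open>q\<close>
  disappears here.\<close>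

lemma local_poly:
  "\<exists>C>0. \<forall>f m J. Lq_loc q f \<longrightarrow> (\<exists>R. degree R \<le> d \<and>
     (\<forall>t\<in>{x m J..x m (J + 1)}. norm (T m f t - poly_real R t) \<le> C * W f m J) \<and>
     (LINT t:Om m J|lebesgue. norm (f t - poly_real R t)) \<le> C * mesh m * W f m J)"
proof -
  obtain C1 where C1: "C1 > 0" "\<forall>f m J R w. Lq_loc q f \<longrightarrow> degree R \<le> d \<longrightarrow> w \<ge> 0 \<longrightarrow>
     (LINT t:Om m J|lebesgue. norm (f t - poly_real R t) powr q) \<le> mesh m * w powr q \<longrightarrow>
     (\<forall>t\<in>{x m J..x m (J + 1)}. norm (T m f t - poly_real R t) \<le> C1 * w)"
    using T_near_poly by blast
  obtain C2 where C2: "C2 > 0" "\<forall>a b f. a < b \<longrightarrow> Lq_on q {a..b} f \<longrightarrow>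
    (\<exists>R\<in>Pi_poly (Suc d). (LINT t:{a..b}|lebesgue. norm (f t - poly_real R t) powr q) \<le> (C2 * modulus (Suc d) q {a..b} f) powr q)"
    using whitney[of "Suc d" q] d q by auto
  define K where "K = C1 * (lam * C2) + 2 * (lam * C2) * ((2 * real d + 1) * lam)"
  have K: "K > 0" using C1 C2 lam by (simp add: K_def add_pos_nonneg)
  have "\<exists>R. degree R \<le> d \<and>
     (\<forall>t\<in>{x m J..x m (J + 1)}. norm (T m f t - poly_real R t) \<le> K * W f m J) \<and>
     (LINT t:Om m J|lebesgue. norm (f t - poly_real R t)) \<le> K * mesh m * W f m J"
    if f: "Lq_loc q f" for f m J
  proof -
    let ?w = "lam * C2 * W f m J"
    have W0: "W f m J \<ge> 0" by (rule W_nonneg[OF f])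
    have w: "?w \<ge> 0" using W0 lam C2 by simp
    have Om: "x m (J - int d) < x m (J + int d + 1)" by simp
    have fOm: "Lq_on q (Om m J) f" using f by (simp add: Lq_loc_def)
    obtain R where R: "R \<in> Pi_poly (Suc d)"
      "(LINT t:Om m J|lebesgue. norm (f t - poly_real R t) powr q) \<le> (C2 * modulus (Suc d) q (Om m J) f) powr q"
      using C2(2)[rule_format, OF Om fOm] by blast
    have deg: "degree R \<le> d" using R(1) by (simp add: Pi_poly_def)
    have "(C2 * modulus (Suc d) q (Om m J) f) powr q = len m J * (C2 * W f m J) powr q"
    proof -
      have "(len m J powr (- 1 / q)) powr q = 1 / len m J"
        using len_pos[of m J] q by (simp only: powr_powr) (simp add: powr_neg_one)
      then show ?thesis using len_pos[of m J] by (simp add: W_eq powr_mult)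
    qed
    also have "\<dots> \<le> (lam * mesh m) * (C2 * W f m J) powr q"
      by (intro mult_right_mono len_le_mesh) auto
    \<comment> \<open>The factor \<open>lam\<close> is enlarged to its power \<open>q\<close> so
      that it can be absorbed into \<open>?w\<close>.\<close>
    also have "\<dots> \<le> (lam powr q * mesh m) * (C2 * W f m J) powr q"
      using powr_mono[of 1 q lam] q lam mesh_pos[of m] by (intro mult_right_mono) auto
    also have "\<dots> = mesh m * ?w powr q"
      by (simp add: powr_mult mult.assoc)
    finally have le: "(LINT t:Om m J|lebesgue. norm (f t - poly_real R t) powr q) \<le> mesh m * ?w powr q"
      using R(2) by simp
    have 1: "norm (T m f t - poly_real R t) \<le> K * W f m J" if "t \<in> {x m J..x m (J + 1)}" for t
    proof -
      have "norm (T m f t - poly_real R t) \<le> C1 * ?w"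
        using C1(2)[rule_format, OF f deg w le that] .
      also have "\<dots> = (C1 * (lam * C2)) * W f m J" by simp
      also have "\<dots> \<le> K * W f m J"
        using W0 lam C2(1) by (intro mult_right_mono) (auto simp: K_def)
      finally show ?thesis .
    qed
    have "(LINT t:Om m J|lebesgue. norm (f t - poly_real R t)) \<le> 2 * ?w * (x m (J + int d + 1) - x m (J - int d))"
    proof (rule set_integral_powr_mean[OF Lq_on_diff[OF fOm Lq_on_poly[OF q] q] q Om w])
      show "(LINT t:Om m J|lebesgue. norm (f t - poly_real R t) powr q)
          \<le> (x m (J + int d + 1) - x m (J - int d)) * ?w powr q"
        using le mult_right_mono[OF Om_length(1)[of m J], of "?w powr q"] by simp
    qed
    also have "\<dots> \<le> 2 * ?w * ((2 * real d + 1) * lam * mesh m)"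
      using w by (intro mult_left_mono Om_length) auto
    also have "\<dots> = (2 * (lam * C2) * ((2 * real d + 1) * lam)) * mesh m * W f m J"
      by (simp add: mult_ac)
    also have "\<dots> \<le> K * mesh m * W f m J"
      using W0 mesh_pos[of m] C1(1) C2(1) lam by (intro mult_right_mono) (auto simp: K_def)
    finally show ?thesis using 1 deg by blast
  qed
  then show ?thesis using K by blast
qed

definition bq :: "(real \<Rightarrow> complex) \<Rightarrow> int \<Rightarrow> int \<Rightarrow> complex" where
  "bq f m = b_coeff (Suc d) P x \<xi> f m"

text \<open>Existence comes from \<open>spline_difference\<close> and uniqueness from
  \<open>spline_sum_unique\<close>, so the definite description in \<open>b_coeff\<close> is
  justified.\<close>

lemma bq: "T m f t - T (m - 1) f t = spline_sum (x m) (Suc d) (bq f m) t"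
proof -
  have "\<exists>!b. \<forall>t. T m f t - T (m - 1) f t = spline_sum (x m) (Suc d) b t"
  proof (rule ex_ex1I)
    show "\<exists>b. \<forall>t. T m f t - T (m - 1) f t = spline_sum (x m) (Suc d) b t"
      unfolding T_eq using spline_difference[OF d] by blast
  next
    fix b b'
    assume "\<forall>t. T m f t - T (m - 1) f t = spline_sum (x m) (Suc d) b t"
      "\<forall>t. T m f t - T (m - 1) f t = spline_sum (x m) (Suc d) b' t"
    then show "b = b'" by (intro spline_sum_unique[OF strict, of m d b b']) metis
  qed
  from theI'[OF this] show ?thesis unfolding bq_def b_coeff_def by blast
qed

text \<open>Two successive quasi-interpolants are compared on interval \<open>j\<close>, the first
  in the support of the B-spline, by way of \<open>f\<close>: both local polynomials are near
  \<open>f\<close> in L1 there, because the interval lies in its own enlarged interval and in that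
  of its parent.\<close>

lemma bq_bound:
  "\<exists>C>0. \<forall>f m j. Lq_loc q f \<longrightarrow> norm (bq f m j) \<le> C * (W f m j + W f (m - 1) (par m j))"
proof -
  obtain C1 where C1: "C1 > 0" "\<forall>f m J. Lq_loc q f \<longrightarrow> (\<exists>R. degree R \<le> d \<and>
     (\<forall>t\<in>{x m J..x m (J + 1)}. norm (T m f t - poly_real R t) \<le> C1 * W f m J) \<and>
     (LINT t:Om m J|lebesgue. norm (f t - poly_real R t)) \<le> C1 * mesh m * W f m J)"
    using local_poly by blast
  obtain C2 where C2: "C2 > 0" "\<forall>R m j i s. degree R \<le> d \<longrightarrow> i \<in> {j..j + int d} \<longrightarrow>
     norm (dbf (Suc d) (x m) j R s) \<le> C2 * pmean R (x m i) (len m i)"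
    using dbf_le_pmean_level by blast
  define K where "K = C1 + C1 * (real M0 * lam)"
  have MM: "real M0 * lam \<ge> 0" using lam by simp
  have "norm (bq f m j) \<le> (C2 * (C1 + K)) * (W f m j + W f (m - 1) (par m j))" if f: "Lq_loc q f" for f m j
  proof -
    let ?J = "par m j"
    let ?D = "spiece (x m) d (bq f m) j" and ?W = "W f m j" and ?W' = "W f (m - 1) ?J"
    have W: "?W \<ge> 0" "?W' \<ge> 0" by (intro W_nonneg[OF f])+
    obtain R where R: "degree R \<le> d" "\<And>t. t \<in> {x m j..x m (j + 1)} \<Longrightarrow> norm (T m f t - poly_real R t) \<le> C1 * ?W"
      "(LINT t:Om m j|lebesgue. norm (f t - poly_real R t)) \<le> C1 * mesh m * ?W"
      using C1(2)[rule_format, OF f, of m j] by blast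
    obtain R' where R': "degree R' \<le> d"
      "\<And>t. t \<in> {x (m - 1) ?J..x (m - 1) (?J + 1)} \<Longrightarrow> norm (T (m - 1) f t - poly_real R' t) \<le> C1 * ?W'"
      "(LINT t:Om (m - 1) ?J|lebesgue. norm (f t - poly_real R' t)) \<le> C1 * mesh (m - 1) * ?W'"
      using C1(2)[rule_format, OF f, of "m - 1" ?J] by blast
    let ?I = "{x m j..x m (j + 1)}"
    have I1: "?I \<subseteq> Om m j" by (rule interval_in_Om) simp
    have I2: "?I \<subseteq> {x (m - 1) ?J..x (m - 1) (?J + 1)}"
      using par_knots[where m = m and i = j] by (simp add: atLeastatMost_subset_iff)
    have I3: "?I \<subseteq> Om (m - 1) ?J"
      by (rule order_trans[OF I2 interval_in_Om]) simp
    have Lq: "set_integrable lebesgue {a..b} (\<lambda>t. norm (f t - poly_real S t))" for a b S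
      using f by (intro set_integrable_norm Lq_on_imp_integrable(2)[OF _ q] Lq_on_diff Lq_on_poly q) (simp add: Lq_loc_def)
    have D: "norm (poly_real ?D t) \<le> (C1 * ?W + C1 * ?W') + (norm (f t - poly_real R t) + norm (f t - poly_real R' t))"
      if t: "t \<in> ?I" for t
    proof -
      have "poly_real ?D t = T m f t - T (m - 1) f t"
        unfolding bq using t d by (intro spline_sum_closed[OF strict, symmetric]) auto
      then have eq: "poly_real ?D t = ((T m f t - poly_real R t) - (T (m - 1) f t - poly_real R' t))
          - ((f t - poly_real R t) - (f t - poly_real R' t))" by simp
      have "norm (poly_real ?D t) \<le> (norm (T m f t - poly_real R t) + norm (T (m - 1) f t - poly_real R' t))
          + (norm (f t - poly_real R t) + norm (f t - poly_real R' t))"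
        unfolding eq
        by (rule order_trans[OF norm_triangle_ineq4 add_mono[OF norm_triangle_ineq4 norm_triangle_ineq4]])
      then show ?thesis
        using R(2)[OF t] R'(2)[OF subsetD[OF I2 t]] by linarith
    qed
    have "(LINT t:?I|lebesgue. norm (poly_real ?D t))
        \<le> (LINT t:?I|lebesgue. (C1 * ?W + C1 * ?W') + (norm (f t - poly_real R t) + norm (f t - poly_real R' t)))"
      using D by (intro set_integral_mono set_integral_add set_integrable_const_interval Lq
          set_integrable_continuous_lebesgue[of _ _ "\<lambda>t. norm (poly_real ?D t)"] continuous_intros) auto
    also have "\<dots> = len m j * (C1 * ?W + C1 * ?W') +
        ((LINT t:?I|lebesgue. norm (f t - poly_real R t)) + (LINT t:?I|lebesgue. norm (f t - poly_real R' t)))"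
    proof -
      have le: "x m j \<le> x m (j + 1)" by simp
      show ?thesis
        by (simp only: set_integral_add(2)[OF set_integrable_const_interval set_integral_add(1)[OF Lq Lq]]
            set_integral_add(2)[OF Lq Lq] set_integral_const_interval[OF le] len_def)
    qed
    also have "\<dots> \<le> len m j * (C1 * ?W + C1 * ?W') +
        ((LINT t:Om m j|lebesgue. norm (f t - poly_real R t)) + (LINT t:Om (m - 1) ?J|lebesgue. norm (f t - poly_real R' t)))"
      using I1 I3 by (intro add_mono order_refl set_integral_mono_subset Lq) auto
    also have "\<dots> \<le> len m j * (C1 * ?W + C1 * ?W') + (C1 * mesh m * ?W + C1 * mesh (m - 1) * ?W')"
      using R(3) R'(3) by (intro add_mono) auto
    also have "\<dots> \<le> len m j * (C1 * ?W + C1 * ?W') + (C1 * len m j * ?W + C1 * (real M0 * lam * len m j) * ?W')"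
    proof (intro add_mono order_refl mult_right_mono mult_left_mono mesh_le_len)
      show "mesh (m - 1) \<le> real M0 * lam * len m j"
        using mesh_parent_le[of m] mult_left_mono[OF mesh_le_len[of m j] MM] by simp
    qed (use C1 W in auto)
    also have "\<dots> \<le> len m j * ((C1 + (C1 + C1 * (real M0 * lam))) * (?W + ?W'))"
    proof -
      have "C1 * (real M0 * lam) * ?W \<ge> 0" "C1 * ?W' \<ge> 0" using C1 W MM by auto
      then have "C1 * ?W + C1 * ?W' + (C1 * ?W + C1 * (real M0 * lam) * ?W')
          \<le> (C1 + (C1 + C1 * (real M0 * lam))) * (?W + ?W')"
        by (simp add: algebra_simps)
      then have "len m j * (C1 * ?W + C1 * ?W' + (C1 * ?W + C1 * (real M0 * lam) * ?W'))
          \<le> len m j * ((C1 + (C1 + C1 * (real M0 * lam))) * (?W + ?W'))"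
        using len_pos[of m j] by (intro mult_left_mono) auto
      then show ?thesis by (simp add: algebra_simps)
    qed
    finally have pm: "pmean ?D (x m j) (len m j) \<le> (C1 + K) * (?W + ?W')"
      using len_pos[of m j] by (simp add: pmean_def K_def len_def divide_le_eq mult.commute)
    have "bq f m j = dbf (Suc d) (x m) j ?D 0"
      by (rule dbf_spiece[OF strict, symmetric]) simp
    moreover have "norm (dbf (Suc d) (x m) j ?D 0) \<le> C2 * pmean ?D (x m j) (len m j)"
      by (intro C2(2)[rule_format] degree_spiece) auto
    moreover have "C2 * pmean ?D (x m j) (len m j) \<le> C2 * ((C1 + K) * (?W + ?W'))"
      using C2(1) by (intro mult_left_mono pm) auto
    ultimately show ?thesis by (simp add: mult.assoc)
  qed
  moreover have "C2 * (C1 + K) > 0" using C1(1) C2(1) MM by (simp add: K_def add_pos_nonneg)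
  ultimately show ?thesis by blast
qed

end

subsection \<open>Oscillation of sums of splines\<close>

text \<open>Distinct exponents suffice, so gaps among the levels are allowed.\<close>

lemma sum_geometric_le:
  fixes g :: "int \<Rightarrow> real"
  assumes "finite X" "0 < r" "r < 1" "\<And>m. m \<in> X \<Longrightarrow> g m \<le> r ^ \<psi> m" "inj_on \<psi> X"
  shows "(\<Sum>m\<in>X. g m) \<le> 1 / (1 - r)"
proof -
  have "(\<Sum>m\<in>X. g m) \<le> (\<Sum>m\<in>X. r ^ \<psi> m)" by (rule sum_mono) (rule assms(4))
  also have "\<dots> = (\<Sum>n\<in>\<psi> ` X. r ^ n)" by (simp add: sum.reindex[OF assms(5)])
  also have "\<dots> \<le> (\<Sum>n. r ^ n)"
    using assms by (intro sum_le_suminf summable_geometric) auto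
  also have "\<dots> = 1 / (1 - r)" using assms by (intro suminf_geometric) auto
  finally show ?thesis .
qed

lemma set_integral_sum_real:
  fixes f :: "'i \<Rightarrow> 'a \<Rightarrow> real"
  assumes "\<And>i. i \<in> I \<Longrightarrow> set_integrable M A (f i)"
  shows "set_integrable M A (\<lambda>x. \<Sum>i\<in>I. f i x)"
    and "(LINT x:A|M. \<Sum>i\<in>I. f i x) = (\<Sum>i\<in>I. LINT x:A|M. f i x)"
  using assms unfolding set_integrable_def set_lebesgue_integral_def
  by (simp_all add: sum_distrib_left)

lemma powr_le_imp_le:
  fixes a b p :: real
  assumes "a powr p \<le> b powr p" "a \<ge> 0" "b \<ge> 0" "p > 0"
  shows "a \<le> b"
  using powr_less_mono2[of p b a] assms by force

text \<open>Hoelder's inequality for sums up to the factor 2, again from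
  \<open>le_eps_powr\<close>.\<close>

lemma sum_le_powr_mean:
  fixes c :: "'i \<Rightarrow> real"
  assumes "finite X" "\<And>i. i \<in> X \<Longrightarrow> c i \<ge> 0" and p: "p \<ge> 1" and B: "B \<ge> 0"
    and le: "(\<Sum>i\<in>X. c i powr p) \<le> B powr p" and n: "real (card X) \<le> n" "n > 0"
  shows "(\<Sum>i\<in>X. c i) \<le> 2 * B * n powr (1 - 1 / p)"
proof (cases "B = 0")
  case True
  then have "(\<Sum>i\<in>X. c i powr p) = 0"
    using le assms(1) by (intro antisym sum_nonneg) auto
  then have "\<forall>i\<in>X. c i = 0" using assms(1) by (subst (asm) sum_nonneg_eq_0_iff) auto
  then show ?thesis by (simp add: True)
next
  case False
  \<comment> \<open>Chosen so that the two terms \<open>n * \<epsilon>\<close> and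
    \<open>\<epsilon> powr (1 - p) * B powr p\<close> are equal.\<close>
  define \<epsilon> where "\<epsilon> = B * n powr (- 1 / p)"
  have \<epsilon>: "\<epsilon> > 0" using False B n by (simp add: \<epsilon>_def)
  have "(\<Sum>i\<in>X. c i) \<le> (\<Sum>i\<in>X. \<epsilon> + \<epsilon> powr (1 - p) * c i powr p)"
    using assms(2) p \<epsilon> by (intro sum_mono le_eps_powr) auto
  also have "\<dots> = real (card X) * \<epsilon> + \<epsilon> powr (1 - p) * (\<Sum>i\<in>X. c i powr p)"
    by (simp add: sum.distrib sum_distrib_left)
  also have "\<dots> \<le> n * \<epsilon> + \<epsilon> powr (1 - p) * B powr p"
    using n le \<epsilon> by (intro add_mono mult_right_mono mult_left_mono) auto
  also have "\<epsilon> powr (1 - p) * B powr p = n * \<epsilon>"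
  proof -
    have "\<epsilon> powr (1 - p) = \<epsilon> / \<epsilon> powr p" using \<epsilon> by (simp add: powr_diff)
    moreover have "\<epsilon> powr p = B powr p / n"
    proof -
      have "(n powr (- 1 / p)) powr p = 1 / n"
        using n p by (simp only: powr_powr) (simp add: powr_neg_one)
      then show ?thesis by (simp add: \<epsilon>_def powr_mult)
    qed
    ultimately show ?thesis using False B n by simp
  qed
  also have "n * \<epsilon> + n * \<epsilon> = 2 * B * (n powr 1 * n powr (- 1 / p))"
    using n by (simp add: \<epsilon>_def)
  also have "n powr 1 * n powr (- 1 / p) = n powr (1 - 1 / p)"
    unfolding powr_add[symmetric] by simp
  finally show ?thesis .
qed

lemma bspline_measurable [measurable]: "bspline y d j \<in> borel_measurable borel"
proof (induction d arbitrary: j)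
  case 0
  have "bspline y 0 j = (\<lambda>t. indicator {y j..<y (j + 1)} t)" by (rule ext) (auto simp: indicator_def)
  then show ?case by simp
next
  case (Suc d)
  note [measurable] = Suc
  show ?case by simp measurable
qed

lemma spline_sum_superset:
  assumes "finite X" "\<And>j. bspline y d j t \<noteq> 0 \<Longrightarrow> j \<in> X"
  shows "spline_sum y (Suc d) c t = (\<Sum>j\<in>X. c j * of_real (bspline y d j t))"
  unfolding spline_sum_def using assms by (intro sum.mono_neutral_cong_left) auto

lemma set_integrable_bspline: "set_integrable lebesgue {a..b} (\<lambda>t. bspline y d j t)" if "strict_mono y"
proof (rule set_integrable_bound[OF set_integrable_const_interval[where c = "2 ^ d"]])
  show "set_borel_measurable lebesgue {a..b} (bspline y d j)"
    unfolding set_borel_measurable_def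
    by (intro borel_measurable_scaleR borel_measurable_indicator measurable_completion) auto
  show "AE t in lebesgue. t \<in> {a..b} \<longrightarrow> norm (bspline y d j t) \<le> norm (2 ^ d :: real)"
    using bspline_bounds[OF that, of d j] by (intro AE_I2) simp
qed

lemma integral_bspline_le:
  assumes y: "strict_mono y"
  shows "(LINT t:{a..b}|lebesgue. bspline y d j t) \<le> 2 ^ d * (y (j + int d + 1) - y j)"
proof -
  have less: "y j < y (j + int d + 1)" using y by (simp add: strict_mono_less)
  have "(LINT t:{a..b}|lebesgue. bspline y d j t) \<le> (LINT t|lebesgue. 2 ^ d * indicator {y j..y (j + int d + 1)} t)"
    unfolding set_lebesgue_integral_def
  proof (rule integral_mono)
    show "integrable lebesgue (\<lambda>t. indicator {a..b} t *\<^sub>R bspline y d j t)"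
      using set_integrable_bspline[OF y] by (simp add: set_integrable_def)
    show "integrable lebesgue (\<lambda>t. 2 ^ d * indicator {y j..y (j + int d + 1)} t :: real)"
      by (intro integrable_mult_right integrable_real_indicator) (auto simp: emeasure_lborel_Icc_eq)
    fix t
    show "indicator {a..b} t *\<^sub>R bspline y d j t \<le> 2 ^ d * indicator {y j..y (j + int d + 1)} t"
      using bspline_bounds[OF y, of d j t] by (auto simp: indicator_def)
  qed
  also have "\<dots> = 2 ^ d * (y (j + int d + 1) - y j)" using less by simp
  finally show ?thesis .
qed

context multilevel
begin

lemma spline_sum_bound:
  assumes d: "d \<ge> 1" and c: "\<And>j. norm (c j) \<le> B" and t: "t \<in> {x m J..x m (J + 1)}"
  shows "norm (poly_real (spiece (x m) d c J) t) \<le> real (Suc d) * (B * 2 ^ d)"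
proof -
  have B: "B \<ge> 0" using c[of 0] norm_ge_zero[of "c 0"] by linarith
  have "poly_real (spiece (x m) d c J) t = (\<Sum>j\<in>{J - int d..J}. c j * poly_real (bpiece (x m) d j J) t)"
    by (simp add: spiece_def poly_real_def poly_sum)
  also have "norm \<dots> \<le> (\<Sum>j\<in>{J - int d..J}. B * 2 ^ d)"
    using c bpiece_bound[OF strict, of m J t d] t B
    by (intro sum_norm_le) (auto simp: norm_mult intro!: mult_mono)
  finally show ?thesis by (simp add: add.commute)
qed

text \<open>Inside one interval this is the inequality for polynomials. Neighbouring pieces agree at
  knots, so increments add up along the chain of intervals from \<open>s\<close> to
  \<open>t\<close>.\<close>

lemma spline_Lipschitz:
  assumes d: "d \<ge> 1"
  shows "\<exists>C>0. \<forall>m c B s t. (\<forall>j. norm (c j) \<le> B) \<longrightarrow>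
    norm (spline_sum (x m) (Suc d) c t - spline_sum (x m) (Suc d) c s) \<le> C * B * \<bar>t - s\<bar> / mesh m"
proof -
  obtain C where C: "C > 0" "\<forall>R a L s t. degree R \<le> d \<longrightarrow> L > 0 \<longrightarrow> s \<in> {a..a + L} \<longrightarrow> t \<in> {a..a + L} \<longrightarrow>
     norm (poly_real R t - poly_real R s) \<le> C * pmean R a L * (\<bar>t - s\<bar> / L)"
    using poly_real_Lipschitz[of d] by blast
  define K where "K = C * (real (Suc d) * 2 ^ d)"
  have "norm (spline_sum (x m) (Suc d) c t - spline_sum (x m) (Suc d) c s) \<le> K * B * \<bar>t - s\<bar> / mesh m"
    if c: "\<forall>j. norm (c j) \<le> B" for m c B s t
  proof -
    let ?S = "spline_sum (x m) (Suc d) c"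
    have B: "B \<ge> 0" using c[rule_format, of 0] norm_ge_zero[of "c 0"] by linarith
    have piece: "norm (?S t - ?S s) \<le> K * B / mesh m * (t - s)"
      if s: "s \<in> {x m J..x m (J + 1)}" and t: "t \<in> {x m J..x m (J + 1)}" and st: "s \<le> t" for J s t
    proof -
      let ?R = "spiece (x m) d c J"
      have L: "x m J + len m J = x m (J + 1)" by (simp add: len_def)
      have "(LINT u:{x m J..x m (J + 1)}|lebesgue. norm (poly_real ?R u))
          \<le> (LINT u:{x m J..x m (J + 1)}|lebesgue. real (Suc d) * (B * 2 ^ d))"
        using c by (intro set_integral_mono set_integrable_const_interval spline_sum_bound d
            set_integrable_continuous_lebesgue[of _ _ "\<lambda>t. norm (poly_real ?R t)"] continuous_intros) auto
      also have "\<dots> = len m J * (real (Suc d) * (B * 2 ^ d))"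
        using set_integral_const_interval[of "x m J" "x m (J + 1)"] by (simp add: len_def)
      finally have "pmean ?R (x m J) (len m J) \<le> real (Suc d) * (B * 2 ^ d)"
        using len_pos[of m J] unfolding pmean_def L by (simp only: pos_divide_le_eq mult.commute)
      then have "C * pmean ?R (x m J) (len m J) * (\<bar>t - s\<bar> / len m J) \<le> C * (real (Suc d) * (B * 2 ^ d)) * (\<bar>t - s\<bar> / mesh m)"
        using C(1) B mesh_pos[of m] mesh_le_len[of m J] len_pos[of m J]
        by (intro mult_mono mult_left_mono divide_left_mono pmean_nonneg) auto
      moreover have "norm (poly_real ?R t - poly_real ?R s) \<le> C * pmean ?R (x m J) (len m J) * (\<bar>t - s\<bar> / len m J)"
        using s t by (intro C(2)[rule_format] degree_spiece len_pos) (simp_all add: L)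
      moreover have "?S t = poly_real ?R t" "?S s = poly_real ?R s"
        using s t d by (auto intro!: spline_sum_closed strict)
      ultimately show ?thesis using st by (simp add: K_def mult_ac)
    qed
    have chain: "norm (?S t - ?S s) \<le> K * B / mesh m * (t - s)"
      if "s \<in> {x m J..x m (J + 1)}" "t \<in> {x m (J + int n)..x m (J + int n + 1)}" "s \<le> t" for J n s t
      using that
    proof (induction n arbitrary: t)
      case 0
      then show ?case using piece[of s J t] by simp
    next
      case (Suc n)
      define u where "u = x m (J + int n + 1)"
      have tu: "u \<le> t" "t \<le> x m (J + int n + 1 + 1)" using Suc.prems(2) by (simp_all add: u_def algebra_simps)
      have "x m (J + 1) \<le> u" by (simp add: u_def)
      then have su: "s \<le> u" using Suc.prems(1) by simp
      have "norm (?S u - ?S s) \<le> K * B / mesh m * (u - s)"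
        using Suc.prems(1) su by (intro Suc.IH) (simp_all add: u_def)
      moreover have "norm (?S t - ?S u) \<le> K * B / mesh m * (t - u)"
        using tu by (intro piece[of u "J + int n + 1" t]) (simp_all add: u_def)
      ultimately have "norm (?S t - ?S s) \<le> K * B / mesh m * (t - u) + K * B / mesh m * (u - s)"
        using norm_triangle_ineq[of "?S t - ?S u" "?S u - ?S s"] by simp
      then show ?case by (simp add: algebra_simps flip: diff_divide_distrib add_divide_distrib)
    qed
    have ordered: "norm (?S t - ?S s) \<le> K * B / mesh m * (t - s)" if "s \<le> t" for s t
    proof -
      obtain J where J: "x m J \<le> s" "s < x m (J + 1)" using ex_interval by blast
      obtain J' where J': "x m J' \<le> t" "t < x m (J' + 1)" using ex_interval by blast
      have "x m J < x m (J' + 1)" using J J' that by linarith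
      then have "J' = J + int (nat (J' - J))" by simp
      then show ?thesis using chain[of s J t "nat (J' - J)"] J J' that by simp
    qed
    show ?thesis
      using ordered[of s t] ordered[of t s] by (cases "s \<le> t") (simp_all add: norm_minus_commute mult_ac)
  qed
  moreover have "K > 0" using C by (simp add: K_def)
  ultimately show ?thesis by blast
qed

lemma continuous_spline_sum:
  assumes "d \<ge> 1" "\<And>j. norm (c j) \<le> B"
  shows "continuous_on S (spline_sum (x m) (Suc d) c)"
proof -
  obtain C where C: "C > 0" "\<forall>m c B s t. (\<forall>j. norm (c j) \<le> B) \<longrightarrow>
    norm (spline_sum (x m) (Suc d) c t - spline_sum (x m) (Suc d) c s) \<le> C * B * \<bar>t - s\<bar> / mesh m"
    using spline_Lipschitz[OF assms(1)] by blast
  have B: "B \<ge> 0" using assms(2)[of 0] norm_ge_zero[of "c 0"] by linarith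
  have "(C * B / mesh m)-lipschitz_on S (spline_sum (x m) (Suc d) c)"
    using C(1) B mesh_pos[of m] C(2)[rule_format, of c B m] assms(2)
    by (intro lipschitz_onI) (auto simp: dist_norm)
  then show ?thesis by (rule lipschitz_on_continuous_on)
qed

text \<open>Up to a factor, \<open>(b - a) / mesh m\<close> B-splines meet the interval, each with
  integral at most a multiple of \<open>mesh m\<close>. Hoelder's inequality costs their number to
  the power \<open>1 - 1 / p\<close>, which leaves the gain
  \<open>(mesh m / (b - a)) powr (1 / p)\<close>: fine levels contribute little.\<close>

lemma spline_L1:
  assumes d: "d \<ge> 1" and p: "p \<ge> 1"
  shows "\<exists>C>0. \<forall>m c B a b. B \<ge> 0 \<longrightarrow> (\<forall>X. finite X \<longrightarrow> (\<Sum>j\<in>X. norm (c j) powr p) \<le> B powr p) \<longrightarrow>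
    a < b \<longrightarrow> mesh m \<le> b - a \<longrightarrow>
    (LINT t:{a..b}|lebesgue. norm (spline_sum (x m) (Suc d) c t)) \<le> C * B * (b - a) * (mesh m / (b - a)) powr (1 / p)"
proof -
  define K where "K = 2 * (real d + 3) powr (1 - 1 / p) * (2 ^ d * (real (Suc d) * lam))"
  have K: "K > 0" using lam by (simp add: K_def)
  have "(LINT t:{a..b}|lebesgue. norm (spline_sum (x m) (Suc d) c t)) \<le> K * B * (b - a) * (mesh m / (b - a)) powr (1 / p)"
    if B: "B \<ge> 0" and c: "\<forall>X. finite X \<longrightarrow> (\<Sum>j\<in>X. norm (c j) powr p) \<le> B powr p"
      and ab: "a < b" and mesh: "mesh m \<le> b - a" for m c B a b
  proof -
    let ?\<phi> = "bspline (x m) d"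
    obtain ja where Ja: "x m ja \<le> a" "a < x m (ja + 1)" using ex_interval by blast
    obtain jb where Jb: "x m jb \<le> b" "b < x m (jb + 1)" using ex_interval by blast
    note J = Ja Jb
    define X where "X = {ja - int d..jb}"
    have "x m ja < x m (jb + 1)" using J ab by linarith
    then have jab: "ja \<le> jb" by simp
    have "of_int (jb - ja - 1) * mesh m \<le> b - a"
    proof (cases "ja + 1 \<le> jb")
      case True
      then show ?thesis using knot_diff_ge[OF True, of m] J by (simp only: diff_diff_eq)
    next
      case False
      then have "of_int (jb - ja - 1) * mesh m \<le> 0 * mesh m"
        using mesh_pos[of m] by (intro mult_right_mono) auto
      then show ?thesis using ab by simp
    qed
    then have cnt: "of_int (jb - ja - 1) \<le> (b - a) / mesh m"
      using mesh_pos[of m] by (simp add: field_simps)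
    have one: "1 \<le> (b - a) / mesh m" using mesh mesh_pos[of m] by simp
    \<comment> \<open>At most \<open>(jb - ja - 1) + (d + 2)\<close> B-splines meet the interval.
      The first summand is at most \<open>(b - a) / mesh m\<close>, and so is 1, because
      \<open>mesh m \<le> b - a\<close>.\<close>
    define n where "n = (real d + 3) * ((b - a) / mesh m)"
    have n0: "n > 0" unfolding n_def using one by (intro mult_pos_pos) linarith+
    have "real (card X) = of_int (jb - ja - 1) + (real d + 2)" using jab by (simp add: X_def)
    also have "\<dots> \<le> (b - a) / mesh m + (real d + 2) * ((b - a) / mesh m)"
    proof -
      have 2: "(real d + 2) * 1 \<le> (real d + 2) * ((b - a) / mesh m)" by (intro mult_left_mono one) auto
      show ?thesis using add_mono[OF cnt 2] by (simp only: mult_1_right)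
    qed
    also have "\<dots> = n"
    proof -
      have g: "v + (real d + 2) * v = (real d + 3) * v" for v :: real by (simp add: algebra_simps)
      show ?thesis unfolding n_def by (rule g)
    qed
    finally have n: "real (card X) \<le> n" .
    have S: "spline_sum (x m) (Suc d) c t = (\<Sum>j\<in>X. c j * of_real (?\<phi> j t))" if t: "t \<in> {a..b}" for t
    proof (rule spline_sum_superset)
      fix j assume "?\<phi> j t \<noteq> 0"
      then have "x m j \<le> t" "t < x m (j + int d + 1)"
        using bspline_bounds[OF strict, of m d j t] by auto
      then have "x m j < x m (jb + 1)" "x m ja < x m (j + int d + 1)"
        using J t unfolding atLeastAtMost_iff by linarith+
      then show "j \<in> X" by (simp add: X_def)
    qed (simp add: X_def)
    have int: "set_integrable lebesgue {a..b} (\<lambda>t. norm (c j) * ?\<phi> j t)" for j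
      by (intro set_integrable_mult_right set_integrable_bspline strict)
    have "(LINT t:{a..b}|lebesgue. norm (spline_sum (x m) (Suc d) c t)) \<le> (LINT t:{a..b}|lebesgue. \<Sum>j\<in>X. norm (c j) * ?\<phi> j t)"
    proof (rule set_integral_mono)
      have cb: "norm (c j) \<le> B" for j
      proof -
        have "norm (c j) powr p \<le> B powr p" using c[rule_format, of "{j}"] by simp
        then show ?thesis by (rule powr_le_imp_le) (use p B in auto)
      qed
      show "set_integrable lebesgue {a..b} (\<lambda>t. norm (spline_sum (x m) (Suc d) c t))"
        by (intro set_integrable_norm set_integrable_continuous_lebesgue continuous_spline_sum[OF d cb])
      show "set_integrable lebesgue {a..b} (\<lambda>t. \<Sum>j\<in>X. norm (c j) * ?\<phi> j t)"
        by (intro set_integral_sum_real(1) int)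
      fix t assume t: "t \<in> {a..b}"
      have nn: "\<bar>?\<phi> j t\<bar> = ?\<phi> j t" for j using bspline_bounds[OF strict, of m d j t] by simp
      show "norm (spline_sum (x m) (Suc d) c t) \<le> (\<Sum>j\<in>X. norm (c j) * ?\<phi> j t)"
        unfolding S[OF t] by (rule sum_norm_le) (simp add: norm_mult nn)
    qed
    also have "\<dots> = (\<Sum>j\<in>X. norm (c j) * (LINT t:{a..b}|lebesgue. ?\<phi> j t))"
      by (simp add: set_integral_sum_real(2)[OF int])
    also have "\<dots> \<le> (\<Sum>j\<in>X. norm (c j) * (2 ^ d * (real (Suc d) * lam * mesh m)))"
    proof (intro sum_mono mult_left_mono)
      fix j
      have "(LINT t:{a..b}|lebesgue. ?\<phi> j t) \<le> 2 ^ d * (x m (j + int d + 1) - x m j)"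
        by (rule integral_bspline_le[OF strict])
      also have "\<dots> \<le> 2 ^ d * (real (Suc d) * lam * mesh m)"
        using knot_diff_le[of j "j + int d + 1" m] by (intro mult_left_mono) (auto simp: algebra_simps)
      finally show "(LINT t:{a..b}|lebesgue. ?\<phi> j t) \<le> 2 ^ d * (real (Suc d) * lam * mesh m)" .
    qed simp
    also have "\<dots> = (\<Sum>j\<in>X. norm (c j)) * (2 ^ d * (real (Suc d) * lam * mesh m))"
      by (simp only: sum_distrib_right)
    also have "\<dots> \<le> (2 * B * n powr (1 - 1 / p)) * (2 ^ d * (real (Suc d) * lam * mesh m))"
      using c p B n n0 lam mesh_pos[of m] by (intro mult_right_mono sum_le_powr_mean) (auto simp: X_def)
    also have "n powr (1 - 1 / p) = (real d + 3) powr (1 - 1 / p) * ((b - a) / mesh m) powr (1 - 1 / p)"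
      unfolding n_def by (rule powr_mult)
    also have "((b - a) / mesh m) powr (1 - 1 / p) = (b - a) / mesh m * (mesh m / (b - a)) powr (1 / p)"
    proof -
      have "((b - a) / mesh m) powr (1 - 1 / p) = (b - a) / mesh m / ((b - a) / mesh m) powr (1 / p)"
        using one ab mesh_pos[of m] by (simp add: powr_diff)
      also have "((b - a) / mesh m) powr (1 / p) = 1 / (mesh m / (b - a)) powr (1 / p)"
        using ab mesh_pos[of m] by (simp add: powr_divide)
      finally show ?thesis by simp
    qed
    also have "2 * B * ((real d + 3) powr (1 - 1 / p) * ((b - a) / mesh m * (mesh m / (b - a)) powr (1 / p))) *
        (2 ^ d * (real (Suc d) * lam * mesh m)) = K * B * (b - a) * (mesh m / (b - a)) powr (1 / p)"
      using mesh_pos[of m] by (simp add: K_def)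
    finally show ?thesis .
  qed
  then show ?thesis using K by blast
qed

text \<open>Levels of mesh size at least \<open>b - a\<close> are treated by the Lipschitz estimate, the others by the
  \<open>L\<^sup>1\<close> estimate; both contributions are geometric sums.\<close>

lemma splines_oscillation:
  assumes d: "d \<ge> 1" and p: "p \<ge> 1"
  shows "\<exists>C>0. \<forall>c B a b M. B \<ge> 0 \<longrightarrow> (\<forall>m X. finite X \<longrightarrow> (\<Sum>j\<in>X. norm (c m j) powr p) \<le> B powr p) \<longrightarrow>
    a < b \<longrightarrow> finite M \<longrightarrow>
    (\<exists>z. (LINT t:{a..b}|lebesgue. norm ((\<Sum>m\<in>M. spline_sum (x m) (Suc d) (c m) t) - z)) \<le> C * B * (b - a))"
proof -
  obtain C1 where C1: "C1 > 0" "\<forall>m c B s t. (\<forall>j. norm (c j) \<le> B) \<longrightarrow>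
    norm (spline_sum (x m) (Suc d) c t - spline_sum (x m) (Suc d) c s) \<le> C1 * B * \<bar>t - s\<bar> / mesh m"
    using spline_Lipschitz[OF d] by blast
  obtain C2 where C2: "C2 > 0" "\<forall>m c B a b. B \<ge> 0 \<longrightarrow> (\<forall>X. finite X \<longrightarrow> (\<Sum>j\<in>X. norm (c j) powr p) \<le> B powr p) \<longrightarrow>
    a < b \<longrightarrow> mesh m \<le> b - a \<longrightarrow>
    (LINT t:{a..b}|lebesgue. norm (spline_sum (x m) (Suc d) c t)) \<le> C2 * B * (b - a) * (mesh m / (b - a)) powr (1 / p)"
    using spline_L1[OF d p] by blast
  \<comment> \<open>The factor gained per level in the L1 estimate when the mesh halves.\<close>
  define r where "r = (1 / 2) powr (1 / p)"
  have r: "0 < r" "r < 1" using p powr_less_mono2[of "1 / p" "1 / 2" 1] by (auto simp: r_def)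
  define K where "K = C1 * 2 + C2 * (1 / (1 - r))"
  have K: "K > 0" using C1(1) C2(1) r by (simp add: K_def add_pos_nonneg)
  have "\<exists>z. (LINT t:{a..b}|lebesgue. norm ((\<Sum>m\<in>M. spline_sum (x m) (Suc d) (c m) t) - z)) \<le> K * B * (b - a)"
    if B: "B \<ge> 0" and c: "\<forall>m X. finite X \<longrightarrow> (\<Sum>j\<in>X. norm (c m j) powr p) \<le> B powr p"
      and ab: "a < b" and M: "finite M" for c :: "int \<Rightarrow> int \<Rightarrow> complex" and B a b M
  proof -
    define D where "D = b - a"
    have D: "D > 0" using ab by (simp add: D_def)
    let ?S = "\<lambda>m t. spline_sum (x m) (Suc d) (c m) t"
    have cb: "norm (c m j) \<le> B" for m j
    proof -
      have "norm (c m j) powr p \<le> B powr p" using c[rule_format, of "{j}" m] by simp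
      then show ?thesis by (rule powr_le_imp_le) (use p B in auto)
    qed
    define Mb where "Mb = {m \<in> M. D < mesh m}"
    define Ms where "Ms = {m \<in> M. mesh m \<le> D}"
    have fin: "finite Mb" "finite Ms" using M by (simp_all add: Mb_def Ms_def)
    have MM: "M = Mb \<union> Ms" "Mb \<inter> Ms = {}" by (auto simp: Mb_def Ms_def)
    \<comment> \<open>Coarse splines are nearly constant on the interval, so their values at
      \<open>a\<close> are subtracted; the fine ones are bounded without subtraction.\<close>
    define z where "z = (\<Sum>m\<in>Mb. ?S m a)"
    have int: "set_integrable lebesgue {a..b} (\<lambda>t. norm (?S m t))" for m
      by (intro set_integrable_norm set_integrable_continuous_lebesgue continuous_spline_sum[OF d cb])
    \<comment> \<open>Larger indices are finer levels, so \<open>Max Mb\<close> is the finest of the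
      coarse levels, and \<open>D / mesh m\<close> decays geometrically away from it.\<close>
    have big: "(\<Sum>m\<in>Mb. D / mesh m) \<le> 2"
    proof -
      have "(\<Sum>m\<in>Mb. D / mesh m) \<le> 1 / (1 - 1 / 2)"
      proof (rule sum_geometric_le[OF fin(1), where \<psi> = "\<lambda>m. nat (Max Mb - m)"])
        fix m assume m: "m \<in> Mb"
        have le: "m \<le> Max Mb" and mem: "Max Mb \<in> Mb" using m fin(1) by (auto intro: Max_in)
        have "D * 2 ^ nat (Max Mb - m) \<le> mesh (Max Mb) * 2 ^ nat (Max Mb - m)"
          using mem by (intro mult_right_mono) (auto simp: Mb_def)
        also have "\<dots> \<le> mesh m" using mesh_power'[OF le] by (simp add: mult.commute)
        finally show "D / mesh m \<le> (1 / 2) ^ nat (Max Mb - m)"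
          using mesh_pos[of m] by (simp add: field_simps power_one_over)
      next
        have "m \<le> Max Mb" if "m \<in> Mb" for m using that fin(1) by simp
        then show "inj_on (\<lambda>m. nat (Max Mb - m)) Mb" by (force simp: inj_on_def nat_eq_iff2)
      qed auto
      then show ?thesis by simp
    qed
    have small: "(\<Sum>m\<in>Ms. (mesh m / D) powr (1 / p)) \<le> 1 / (1 - r)"
    proof (rule sum_geometric_le[OF fin(2) r, where \<psi> = "\<lambda>m. nat (m - Min Ms)"])
      fix m assume m: "m \<in> Ms"
      have le: "Min Ms \<le> m" and mem: "Min Ms \<in> Ms" using m fin(2) by (auto intro: Min_in)
      have "2 ^ nat (m - Min Ms) * mesh m \<le> D"
        using mesh_power'[OF le] mem by (simp add: Ms_def)
      then have "mesh m / D \<le> (1 / 2) ^ nat (m - Min Ms)"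
        using D by (simp add: field_simps power_one_over)
      then have "(mesh m / D) powr (1 / p) \<le> ((1 / 2) ^ nat (m - Min Ms)) powr (1 / p)"
        using D p mesh_pos[of m] by (intro powr_mono2) auto
      also have "\<dots> = r ^ nat (m - Min Ms)"
        by (simp add: r_def powr_powr mult.commute flip: powr_realpow)
      finally show "(mesh m / D) powr (1 / p) \<le> r ^ nat (m - Min Ms)" .
    next
      have "Min Ms \<le> m" if "m \<in> Ms" for m using that fin(2) by simp
      then show "inj_on (\<lambda>m. nat (m - Min Ms)) Ms" by (force simp: inj_on_def nat_eq_iff2)
    qed
    have "(LINT t:{a..b}|lebesgue. norm ((\<Sum>m\<in>M. ?S m t) - z))
        \<le> (LINT t:{a..b}|lebesgue. (\<Sum>m\<in>Mb. C1 * B * D / mesh m) + (\<Sum>m\<in>Ms. norm (?S m t)))"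
    proof (rule set_integral_mono)
      show "set_integrable lebesgue {a..b} (\<lambda>t. norm ((\<Sum>m\<in>M. ?S m t) - z))"
        by (intro set_integrable_norm set_integrable_continuous_lebesgue continuous_intros continuous_spline_sum[OF d cb])
      show "set_integrable lebesgue {a..b} (\<lambda>t. (\<Sum>m\<in>Mb. C1 * B * D / mesh m) + (\<Sum>m\<in>Ms. norm (?S m t)))"
        by (intro set_integral_add set_integral_sum_real(1) set_integrable_const_interval int)
      fix t assume t: "t \<in> {a..b}"
      have "(\<Sum>m\<in>M. ?S m t) - z = (\<Sum>m\<in>Mb. ?S m t - ?S m a) + (\<Sum>m\<in>Ms. ?S m t)"
        unfolding MM(1) z_def using fin MM(2) by (simp add: sum.union_disjoint sum_subtractf)
      also have "norm \<dots> \<le> (\<Sum>m\<in>Mb. C1 * B * D / mesh m) + (\<Sum>m\<in>Ms. norm (?S m t))"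
      proof (rule order_trans[OF norm_triangle_ineq add_mono[OF sum_norm_le norm_sum]])
        fix m
        have "norm (?S m t - ?S m a) \<le> C1 * B * \<bar>t - a\<bar> / mesh m" by (rule C1(2)[rule_format, OF cb])
        also have "\<dots> \<le> C1 * B * D / mesh m"
          using t C1(1) B mesh_pos[of m] by (intro divide_right_mono mult_left_mono) (auto simp: D_def)
        finally show "norm (?S m t - ?S m a) \<le> C1 * B * D / mesh m" .
      qed
      finally show "norm ((\<Sum>m\<in>M. ?S m t) - z) \<le> (\<Sum>m\<in>Mb. C1 * B * D / mesh m) + (\<Sum>m\<in>Ms. norm (?S m t))" .
    qed
    also have "\<dots> = D * (\<Sum>m\<in>Mb. C1 * B * D / mesh m) + (\<Sum>m\<in>Ms. LINT t:{a..b}|lebesgue. norm (?S m t))"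
      using ab
      by (simp add: set_integral_add(2)[OF set_integrable_const_interval set_integral_sum_real(1)[OF int]]
          set_integral_const_interval set_integral_sum_real(2)[OF int] D_def)
    also have "\<dots> \<le> D * (C1 * B * (\<Sum>m\<in>Mb. D / mesh m)) + (\<Sum>m\<in>Ms. C2 * B * D * (mesh m / D) powr (1 / p))"
    proof (intro add_mono sum_mono)
      fix m assume "m \<in> Ms"
      then show "(LINT t:{a..b}|lebesgue. norm (?S m t)) \<le> C2 * B * D * (mesh m / D) powr (1 / p)"
        using C2(2) B c ab unfolding D_def Ms_def by blast
    qed (simp add: sum_distrib_left)
    also have "\<dots> = D * (C1 * B * (\<Sum>m\<in>Mb. D / mesh m)) + C2 * B * D * (\<Sum>m\<in>Ms. (mesh m / D) powr (1 / p))"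
      by (simp add: sum_distrib_left)
    also have "\<dots> \<le> D * (C1 * B * 2) + C2 * B * D * (1 / (1 - r))"
      using B C1(1) C2(1) D big small by (intro add_mono mult_left_mono) auto
    also have "\<dots> = K * B * (b - a)" unfolding K_def D_def[symmetric] by (simp only: distrib_left distrib_right mult_ac)
    finally show ?thesis by blast
  qed
  then show ?thesis using K by blast
qed

end

subsection \<open>Convergence of the quasi-interpolants\<close>

lemma finite_large_terms:
  fixes a :: "'i \<Rightarrow> real"
  assumes sum: "(\<lambda>i. a i powr \<tau>) summable_on UNIV" and \<tau>: "\<tau> > 0" and \<epsilon>: "\<epsilon> > 0"
  shows "finite {i. \<epsilon> \<le> a i}"
proof (rule ccontr)
  assume inf: "infinite {i. \<epsilon> \<le> a i}"
  let ?N = "\<Sum>\<^sub>\<infinity>i. a i powr \<tau>"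
  obtain n :: nat where n: "?N / \<epsilon> powr \<tau> < real n" using reals_Archimedean2 by blast
  obtain Y where Y: "Y \<subseteq> {i. \<epsilon> \<le> a i}" "finite Y" "card Y = n"
    using infinite_arbitrarily_large[OF inf] by blast
  have "real n * \<epsilon> powr \<tau> = (\<Sum>i\<in>Y. \<epsilon> powr \<tau>)" using Y by simp
  also have "\<dots> \<le> (\<Sum>i\<in>Y. a i powr \<tau>)" using Y \<epsilon> \<tau> by (intro sum_mono powr_mono2) auto
  also have "\<dots> \<le> ?N" using Y by (intro finite_sum_le_infsum sum) auto
  finally show False using n \<epsilon> by (simp add: field_simps)
qed

text \<open>The average is within \<open>K\<close> of any admissible \<open>z\<close>, so replacing
  \<open>z\<close> by it at most doubles the bound. The free choice of \<open>z\<close> on each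
  interval is what makes additive constants invisible.\<close>

lemma bmo_norm_le:
  fixes h :: "real \<Rightarrow> complex"
  assumes loc: "\<And>a b. set_integrable lebesgue {a..b} h" and K: "K \<ge> 0"
    and osc: "\<And>a b. a < b \<Longrightarrow> \<exists>z. (LINT t:{a..b}|lebesgue. norm (h t - z)) \<le> K * (b - a)"
  shows "bmo_norm h \<le> ennreal (2 * K)"
  unfolding bmo_norm_def
proof (rule SUP_least, clarify, rule ennreal_leI)
  fix a b :: real assume ab: "a < b"
  obtain z where z: "(LINT t:{a..b}|lebesgue. norm (h t - z)) \<le> K * (b - a)" using osc[OF ab] by blast
  have const: "set_integrable lebesgue {a..b} (\<lambda>t. w)" for w :: complex
    by (intro set_integrable_continuous_lebesgue continuous_intros)
  have hz: "set_integrable lebesgue {a..b} (\<lambda>t. h t - w)" for w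
    by (intro set_integral_diff(1) loc const)
  have "(LINT t:{a..b}|lebesgue. h t - z) = (LINT t:{a..b}|lebesgue. h t) - (b - a) *\<^sub>R z"
    using ab by (simp add: set_integral_diff(2)[OF loc const]) (simp add: set_lebesgue_integral_def)
  then have "average a b h - z = (1 / (b - a)) *\<^sub>R (LINT t:{a..b}|lebesgue. h t - z)"
    using ab by (simp add: average_def scaleR_diff_right)
  then have "norm (average a b h - z) = 1 / (b - a) * norm (LINT t:{a..b}|lebesgue. h t - z)"
    using ab by simp
  also have "\<dots> \<le> 1 / (b - a) * (K * (b - a))"
    using ab z order_trans[OF set_integral_norm_bound[OF hz] z] by (intro mult_left_mono) auto
  finally have av: "norm (average a b h - z) \<le> K" using ab by simp
  have "(LINT t:{a..b}|lebesgue. norm (h t - average a b h))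
      \<le> (LINT t:{a..b}|lebesgue. norm (h t - z) + norm (average a b h - z))"
  proof (rule set_integral_mono[OF set_integrable_norm[OF hz]
        set_integral_add(1)[OF set_integrable_norm[OF hz] set_integrable_const_interval]])
    fix t show "norm (h t - average a b h) \<le> norm (h t - z) + norm (average a b h - z)"
      using norm_triangle_ineq4[of "h t - z" "average a b h - z"] by simp
  qed
  also have "\<dots> = (LINT t:{a..b}|lebesgue. norm (h t - z)) + (b - a) * norm (average a b h - z)"
    using ab by (simp add: set_integral_add(2)[OF set_integrable_norm[OF hz] set_integrable_const_interval]
        set_integral_const_interval)
  also have "\<dots> \<le> K * (b - a) + (b - a) * K"
    using z av ab by (intro add_mono mult_left_mono) auto
  finally show "1 / (b - a) * (LINT t:{a..b}|lebesgue. norm (h t - average a b h)) \<le> 2 * K"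
    using ab by (simp add: field_simps)
qed

context multilevel
begin

lemma ex_index_range:
  "\<exists>ja jb. (\<forall>t\<in>{a..b}. \<exists>J\<in>{ja..jb}. x m J \<le> t \<and> t < x m (J + 1)) \<and> (a \<le> b \<longrightarrow> ja \<le> jb) \<and>
     (a \<le> b \<longrightarrow> of_int (jb - ja + 1) * mesh m \<le> b - a + 2 * mesh m)"
proof -
  obtain ja where ja: "x m ja \<le> a" "a < x m (ja + 1)" using ex_interval by blast
  obtain jb where jb: "x m jb \<le> b" "b < x m (jb + 1)" using ex_interval by blast
  have "\<exists>J\<in>{ja..jb}. x m J \<le> t \<and> t < x m (J + 1)" if t: "t \<in> {a..b}" for t
  proof -
    obtain J where J: "x m J \<le> t" "t < x m (J + 1)" using ex_interval by blast
    have "x m ja < x m (J + 1)" "x m J < x m (jb + 1)"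
      using ja jb J t unfolding atLeastAtMost_iff by linarith+
    then show ?thesis using J by (intro bexI[of _ J]) auto
  qed
  moreover have "ja \<le> jb" if "a \<le> b"
  proof -
    have "x m ja < x m (jb + 1)" using ja jb that by linarith
    then show ?thesis by simp
  qed
  moreover have "of_int (jb - ja + 1) * mesh m \<le> b - a + 2 * mesh m" if "a \<le> b"
  proof (cases "ja + 1 \<le> jb")
    case True
    have "of_int (jb - (ja + 1)) * mesh m \<le> b - a"
      using knot_diff_ge[OF True, of m] ja jb by linarith
    then show ?thesis by (simp add: algebra_simps)
  next
    case False
    then have "of_int (jb - ja + 1) * mesh m \<le> 2 * mesh m"
      using mesh_pos[of m] by (intro mult_right_mono) auto
    then show ?thesis using that by linarith
  qed
  ultimately show ?thesis by blast
qed

text \<open>The coefficients need not be bounded globally: those outside a finite range around the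
  interval are set to 0, which changes nothing on it.\<close>

lemma continuous_spline_sum_local:
  assumes d: "d \<ge> 1"
  shows "continuous_on {a..b} (spline_sum (x m) (Suc d) c)"
proof -
  obtain ja jb where J: "\<forall>t\<in>{a..b}. \<exists>J\<in>{ja..jb}. x m J \<le> t \<and> t < x m (J + 1)"
    using ex_index_range by blast
  define X where "X = {ja - int d..jb}"
  define c' where "c' j = (if j \<in> X then c j else 0)" for j
  have "norm (c' j) \<le> (\<Sum>i\<in>X. norm (c i))" for j
    by (auto simp: c'_def X_def intro: member_le_sum sum_nonneg)
  then have "continuous_on {a..b} (spline_sum (x m) (Suc d) c')"
    by (rule continuous_spline_sum[OF d])
  moreover have "spline_sum (x m) (Suc d) c' t = spline_sum (x m) (Suc d) c t" if t: "t \<in> {a..b}" for t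
  proof -
    obtain J where J': "J \<in> {ja..jb}" "x m J \<le> t" "t < x m (J + 1)" using J[rule_format, OF t] by blast
    show ?thesis
      unfolding spline_sum_finite[OF strict J'(2,3)] using J'(1)
      by (intro sum.cong) (auto simp: c'_def X_def)
  qed
  ultimately show ?thesis by (rule continuous_on_eq)
qed

end

context quasi_interpolation
begin

lemma continuous_T: "continuous_on {a..b} (T m f)"
  unfolding T_eq[abs_def] by (rule continuous_spline_sum_local[OF d])

definition summable_W :: "real \<Rightarrow> (real \<Rightarrow> complex) \<Rightarrow> bool" where
  "summable_W \<tau> f \<longleftrightarrow> Lq_loc q f \<and> \<tau> > 0 \<and> (\<lambda>(m, j). W f m j powr \<tau>) summable_on UNIV"

lemma integrable_f: "Lq_loc q f \<Longrightarrow> set_integrable lebesgue {a..b} f"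
  using Lq_on_imp_integrable(2)[OF _ q] by (simp add: Lq_loc_def)

lemma W_large_finite: "summable_W \<tau> f \<Longrightarrow> \<epsilon> > 0 \<Longrightarrow> finite {(m, j). \<epsilon> \<le> W f m j}"
  using finite_large_terms[of "\<lambda>(m, j). W f m j" \<tau> \<epsilon>]
  by (simp add: summable_W_def case_prod_unfold)

text \<open>Only finitely many pairs have \<open>W f m j \<ge> \<epsilon>\<close>, so beyond some
  level, in either direction, the local quantities are small uniformly in \<open>j\<close>.\<close>

lemma W_small:
  assumes "summable_W \<tau> f" "\<epsilon> > 0"
  shows "\<exists>N::nat. \<forall>m j. int N \<le> \<bar>m\<bar> \<longrightarrow> W f m j < \<epsilon>"
proof -
  have "finite ((\<lambda>(m, j). nat \<bar>m\<bar>) ` {(m, j). \<epsilon> \<le> W f m j})"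
    using W_large_finite[OF assms] by (rule finite_imageI)
  then obtain N where N: "\<forall>n\<in>(\<lambda>(m, j). nat \<bar>m\<bar>) ` {(m, j). \<epsilon> \<le> W f m j}. n < N"
    using finite_nat_set_iff_bounded by blast
  have "W f m j < \<epsilon>" if "int N \<le> \<bar>m\<bar>" for m j
  proof (rule ccontr)
    assume "\<not> W f m j < \<epsilon>"
    then have "nat \<bar>m\<bar> \<in> (\<lambda>(m, j). nat \<bar>m\<bar>) ` {(m, j). \<epsilon> \<le> W f m j}"
      by (intro rev_image_eqI[of "(m, j)"]) auto
    then have "nat \<bar>m\<bar> < N" using N by blast
    then show False using that by simp
  qed
  then show ?thesis by blast
qed

lemma W_bounded:
  assumes "summable_W \<tau> f"
  shows "\<exists>\<eta>>0. \<forall>m j. W f m j \<le> \<eta>"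
proof -
  let ?S = "{(m, j). 1 \<le> W f m j}"
  have fin: "finite ?S" using W_large_finite[OF assms, of 1] by simp
  have "W f m j \<le> 1 + (\<Sum>(m, j)\<in>?S. W f m j)" for m j
  proof (cases "(m, j) \<in> ?S")
    case True
    have "(\<lambda>(m, j). W f m j) (m, j) \<le> (\<Sum>(m, j)\<in>?S. W f m j)"
      by (rule member_le_sum[OF True _ fin]) auto
    then show ?thesis by simp
  next
    case False
    moreover have "0 \<le> (\<Sum>(m, j)\<in>?S. W f m j)" by (rule sum_nonneg) auto
    ultimately show ?thesis by auto
  qed
  moreover have "1 + (\<Sum>(m, j)\<in>?S. W f m j) > 0"
    by (intro add_pos_nonneg sum_nonneg) auto
  ultimately show ?thesis by blast
qed

text \<open>The error on one interval of level \<open>n\<close> is at most a multiple of mesh times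
  \<open>W\<close>, and the number of intervals covering \<open>{a..b}\<close> times the mesh stays
  bounded; so the uniform smallness of \<open>W\<close> decides.\<close>

lemma T_to_f:
  assumes f: "summable_W \<tau> f" and ab: "a < b" and \<epsilon>: "\<epsilon> > 0"
  shows "\<exists>N::nat. \<forall>n\<ge>N. (LINT t:{a..b}|lebesgue. norm (f t - T (int n) f t)) \<le> \<epsilon>"
proof -
  have fq: "Lq_loc q f" using f by (simp add: summable_W_def)
  obtain C where C: "C > 0" "\<forall>f m J. Lq_loc q f \<longrightarrow> (\<exists>R. degree R \<le> d \<and>
     (\<forall>t\<in>{x m J..x m (J + 1)}. norm (T m f t - poly_real R t) \<le> C * W f m J) \<and>
     (LINT t:Om m J|lebesgue. norm (f t - poly_real R t)) \<le> C * mesh m * W f m J)"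
    using local_poly by blast
  \<comment> \<open>The term \<open>2 * mesh 0\<close> pays for the intervals that may stick out at
    both ends of \<open>{a..b}\<close>; the levels \<open>n \<ge> 0\<close> have mesh at most
    \<open>mesh 0\<close>.\<close>
  define K where "K = (C + lam * C) * (b - a + 2 * mesh 0)"
  have K: "K > 0" unfolding K_def using C lam ab mesh_pos[of 0] by (intro mult_pos_pos add_pos_nonneg add_nonneg_pos) auto
  obtain N where N: "\<forall>m j. int N \<le> \<bar>m\<bar> \<longrightarrow> W f m j < \<epsilon> / K"
    using W_small[OF f, of "\<epsilon> / K"] \<epsilon> K by auto
  have "(LINT t:{a..b}|lebesgue. norm (f t - T (int n) f t)) \<le> \<epsilon>" if n: "n \<ge> N" for n
  proof -
    let ?m = "int n"
    let ?g = "\<lambda>t. norm (f t - T ?m f t)"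
    have g: "set_integrable lebesgue {u..v} ?g" for u v
      by (intro set_integrable_norm set_integral_diff(1) integrable_f[OF fq] set_integrable_continuous_lebesgue continuous_T)
    have piece: "(LINT t:{x ?m J..x ?m (J + 1)}|lebesgue. ?g t) \<le> (C + lam * C) * mesh ?m * (\<epsilon> / K)" for J
    proof -
      obtain R where R: "\<forall>t\<in>{x ?m J..x ?m (J + 1)}. norm (T ?m f t - poly_real R t) \<le> C * W f ?m J"
        "(LINT t:Om ?m J|lebesgue. norm (f t - poly_real R t)) \<le> C * mesh ?m * W f ?m J"
        using C(2)[rule_format, OF fq, of ?m J] by blast
      have fR: "set_integrable lebesgue {u..v} (\<lambda>t. norm (f t - poly_real R t))" for u v
        using fq by (intro set_integrable_norm Lq_on_imp_integrable(2)[OF _ q] Lq_on_diff Lq_on_poly q) (simp add: Lq_loc_def)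
      have Wn: "W f ?m J \<le> \<epsilon> / K" using N n by (simp add: less_imp_le)
      have W0: "W f ?m J \<ge> 0" by (rule W_nonneg[OF fq])
      have "(LINT t:{x ?m J..x ?m (J + 1)}|lebesgue. ?g t)
          \<le> (LINT t:{x ?m J..x ?m (J + 1)}|lebesgue. norm (f t - poly_real R t) + C * W f ?m J)"
      proof (intro set_integral_mono g set_integral_add(1) fR set_integrable_const_interval)
        fix t assume t: "t \<in> {x ?m J..x ?m (J + 1)}"
        have "?g t \<le> norm (f t - poly_real R t) + norm (T ?m f t - poly_real R t)"
          using norm_triangle_ineq4[of "f t - poly_real R t" "T ?m f t - poly_real R t"] by simp
        then show "?g t \<le> norm (f t - poly_real R t) + C * W f ?m J" using R(1) t by force
      qed
      also have "\<dots> = (LINT t:{x ?m J..x ?m (J + 1)}|lebesgue. norm (f t - poly_real R t)) + len ?m J * (C * W f ?m J)"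
        by (simp add: set_integral_add(2)[OF fR set_integrable_const_interval] set_integral_const_interval len_def)
      also have "\<dots> \<le> (LINT t:Om ?m J|lebesgue. norm (f t - poly_real R t)) + (lam * mesh ?m) * (C * W f ?m J)"
        using C(1) W0 by (intro add_mono set_integral_mono_subset fR mult_right_mono len_le_mesh interval_in_Om) auto
      also have "\<dots> \<le> C * mesh ?m * W f ?m J + (lam * mesh ?m) * (C * W f ?m J)"
        using R(2) by simp
      also have "\<dots> = (C + lam * C) * mesh ?m * W f ?m J" by (simp add: algebra_simps)
      also have "\<dots> \<le> (C + lam * C) * mesh ?m * (\<epsilon> / K)"
        using C(1) lam mesh_pos[of ?m] by (intro mult_left_mono Wn) auto
      finally show ?thesis .
    qed
    obtain ja jb where J: "\<forall>t\<in>{a..b}. \<exists>J\<in>{ja..jb}. x ?m J \<le> t \<and> t < x ?m (J + 1)" "ja \<le> jb"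
      "of_int (jb - ja + 1) * mesh ?m \<le> b - a + 2 * mesh ?m"
      using ex_index_range[of a b ?m] ab by auto
    let ?I = "\<lambda>J. {x ?m J..x ?m (J + 1)}"
    have "(LINT t:{a..b}|lebesgue. ?g t) \<le> (\<Sum>J\<in>{ja..jb}. LINT t:(?I J)|lebesgue. ?g t)"
    proof -
      have gi: "integrable lebesgue (\<lambda>t. indicator {u..v} t *\<^sub>R ?g t)" for u v
        using g[of u v] by (simp add: set_integrable_def)
      have "(LINT t:{a..b}|lebesgue. ?g t) \<le> (LINT t|lebesgue. (\<Sum>J\<in>{ja..jb}. indicator (?I J) t *\<^sub>R ?g t))"
        unfolding set_lebesgue_integral_def
      proof (rule integral_mono[OF gi Bochner_Integration.integrable_sum[OF gi]])
        fix t
        show "indicator {a..b} t *\<^sub>R ?g t \<le> (\<Sum>J\<in>{ja..jb}. indicator (?I J) t *\<^sub>R ?g t)"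
        proof (cases "t \<in> {a..b}")
          case True
          then obtain J0 where J0: "J0 \<in> {ja..jb}" "t \<in> ?I J0" using J(1) by fastforce
          have "indicator (?I J0) t *\<^sub>R ?g t \<le> (\<Sum>J\<in>{ja..jb}. indicator (?I J) t *\<^sub>R ?g t)"
            using J0(1) by (intro member_le_sum) auto
          then show ?thesis using True J0(2) by simp
        qed (simp add: sum_nonneg)
      qed
      also have "\<dots> = (\<Sum>J\<in>{ja..jb}. LINT t|lebesgue. indicator (?I J) t *\<^sub>R ?g t)"
        by (rule Bochner_Integration.integral_sum[OF gi])
      finally show ?thesis unfolding set_lebesgue_integral_def .
    qed
    also have "\<dots> \<le> (\<Sum>J\<in>{ja..jb}. (C + lam * C) * mesh ?m * (\<epsilon> / K))"
      by (intro sum_mono piece)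
    also have "\<dots> = (C + lam * C) * (\<epsilon> / K) * (of_int (jb - ja + 1) * mesh ?m)"
      using J(2) by simp
    also have "\<dots> \<le> (C + lam * C) * (\<epsilon> / K) * (b - a + 2 * mesh 0)"
      using C(1) lam K \<epsilon> J(3) mesh_antimono[of 0 ?m] by (intro mult_left_mono) auto
    also have "\<dots> = K * (\<epsilon> / K)" unfolding K_def by (simp only: mult_ac)
    also have "\<dots> = \<epsilon>" using K by simp
    finally show ?thesis .
  qed
  then show ?thesis by blast
qed

lemma ex_local_poly:
  assumes "Lq_loc q f"
  shows "\<exists>C RR. C > 0 \<and> (\<forall>m J. degree (RR m J) \<le> d \<and>
     (\<forall>t\<in>{x m J..x m (J + 1)}. norm (T m f t - poly_real (RR m J) t) \<le> C * W f m J) \<and>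
     (LINT t:Om m J|lebesgue. norm (f t - poly_real (RR m J) t)) \<le> C * mesh m * W f m J)"
proof -
  obtain C where C: "C > 0" "\<forall>f m J. Lq_loc q f \<longrightarrow> (\<exists>R. degree R \<le> d \<and>
     (\<forall>t\<in>{x m J..x m (J + 1)}. norm (T m f t - poly_real R t) \<le> C * W f m J) \<and>
     (LINT t:Om m J|lebesgue. norm (f t - poly_real R t)) \<le> C * mesh m * W f m J)"
    using local_poly by blast
  define RR where "RR m J = (SOME R. degree R \<le> d \<and>
     (\<forall>t\<in>{x m J..x m (J + 1)}. norm (T m f t - poly_real R t) \<le> C * W f m J) \<and>
     (LINT t:Om m J|lebesgue. norm (f t - poly_real R t)) \<le> C * mesh m * W f m J)" for m J
  have "degree (RR m J) \<le> d \<and>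
     (\<forall>t\<in>{x m J..x m (J + 1)}. norm (T m f t - poly_real (RR m J) t) \<le> C * W f m J) \<and>
     (LINT t:Om m J|lebesgue. norm (f t - poly_real (RR m J) t)) \<le> C * mesh m * W f m J" for m J
    unfolding RR_def by (rule someI_ex) (rule C(2)[rule_format, OF assms])
  then show ?thesis using C(1) by blast
qed

lemma pmean_diff_le:
  assumes f: "Lq_loc q f" and L: "L > 0"
    and 1: "{a..a + L} \<subseteq> {u..v}" "(LINT t:{u..v}|lebesgue. norm (f t - poly_real R t)) \<le> e"
    and 2: "{a..a + L} \<subseteq> {u'..v'}" "(LINT t:{u'..v'}|lebesgue. norm (f t - poly_real R' t)) \<le> e'"
  shows "pmean (R' - R) a L \<le> (e + e') / L"
proof -
  have fR: "set_integrable lebesgue {u..v} (\<lambda>t. norm (f t - poly_real R t))" for u v R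
    using f by (intro set_integrable_norm Lq_on_imp_integrable(2)[OF _ q] Lq_on_diff Lq_on_poly q) (simp add: Lq_loc_def)
  have "(LINT t:{a..a + L}|lebesgue. norm (poly_real (R' - R) t))
      \<le> (LINT t:{a..a + L}|lebesgue. norm (f t - poly_real R t) + norm (f t - poly_real R' t))"
  proof (rule set_integral_mono[OF _ set_integral_add(1)[OF fR fR]])
    show "set_integrable lebesgue {a..a + L} (\<lambda>t. norm (poly_real (R' - R) t))"
      by (intro set_integrable_continuous_lebesgue continuous_intros)
    fix t show "norm (poly_real (R' - R) t) \<le> norm (f t - poly_real R t) + norm (f t - poly_real R' t)"
      using norm_triangle_ineq4[of "f t - poly_real R t" "f t - poly_real R' t"] by (simp add: poly_real_def)
  qed
  also have "\<dots> = (LINT t:{a..a + L}|lebesgue. norm (f t - poly_real R t)) + (LINT t:{a..a + L}|lebesgue. norm (f t - poly_real R' t))"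
    by (rule set_integral_add(2)[OF fR fR])
  also have "\<dots> \<le> (LINT t:{u..v}|lebesgue. norm (f t - poly_real R t)) + (LINT t:{u'..v'}|lebesgue. norm (f t - poly_real R' t))"
    by (intro add_mono set_integral_mono_subset fR 1(1) 2(1)) auto
  also have "\<dots> \<le> e + e'" by (intro add_mono 1(2) 2(2))
  finally show ?thesis unfolding pmean_def using L by (intro divide_right_mono) auto
qed

end

context quasi_interpolation
begin

text \<open>The polynomials of local approximation on nested enlarged intervals around the origin converge
  modulo constants, because their \<open>\<nu>\<close>-th coefficients change by \<open>O((mesh m) ^ (- \<nu>))\<close>.\<close>

lemma T_coarse_limit:
  assumes f: "summable_W \<tau> f"
  shows "\<exists>P\<in>Pi_poly (Suc d). \<exists>c :: nat \<Rightarrow> complex. \<forall>a b \<epsilon>. \<epsilon> > 0 \<longrightarrow>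
     (\<exists>N. \<forall>n\<ge>N. \<forall>t\<in>{a..b}. norm (T (- int n) f t - c n - poly_real P t) \<le> \<epsilon>)"
proof -
  have fq: "Lq_loc q f" using f by (simp add: summable_W_def)
  obtain C RR where C: "C > 0" and RR_all: "\<forall>m J. degree (RR m J) \<le> d \<and>
     (\<forall>t\<in>{x m J..x m (J + 1)}. norm (T m f t - poly_real (RR m J) t) \<le> C * W f m J) \<and>
     (LINT t:Om m J|lebesgue. norm (f t - poly_real (RR m J) t)) \<le> C * mesh m * W f m J"
    using ex_local_poly[OF fq] by blast
  have RRd: "degree (RR m J) \<le> d"
    and RRT: "t \<in> {x m J..x m (J + 1)} \<Longrightarrow> norm (T m f t - poly_real (RR m J) t) \<le> C * W f m J"
    and RRI: "(LINT t:Om m J|lebesgue. norm (f t - poly_real (RR m J) t)) \<le> C * mesh m * W f m J" for m J t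
    using RR_all[rule_format, of m J] by auto
  obtain \<eta> where \<eta>: "\<eta> > 0" and W\<eta>: "W f m j \<le> \<eta>" for m j
    using W_bounded[OF f] by blast
  have W0: "W f m j \<ge> 0" for m j by (rule W_nonneg[OF fq])
  obtain J0 where J0: "x 0 J0 \<le> 0" "0 < x 0 (J0 + 1)" using ex_interval by blast
  \<comment> \<open>The successive ancestors of the level 0 interval that contains the
    origin.\<close>
  define J where "J = rec_nat J0 (\<lambda>n j. par (- int n) j)"
  have J_Suc: "J (Suc n) = par (- int n) (J n)" for n by (simp add: J_def)
  have lev: "- int (Suc n) = - int n - 1" for n by simp
  have zero: "x (- int n) (J n) \<le> 0 \<and> 0 < x (- int n) (J n + 1)" for n
  proof (induction n)
    case 0
    then show ?case using J0 by (simp add: J_def)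
  next
    case (Suc n)
    then show ?case
      using par_knots[where m = "- int n" and i = "J n"] unfolding J_Suc lev by linarith
  qed
  define R where "R n = RR (- int n) (J n)" for n
  define M where "M n = mesh (- int n)" for n
  have M: "M n > 0" for n unfolding M_def by (rule mesh_pos)
  have M_growth: "2 ^ n * M 0 \<le> M n" for n using mesh_power[of n "- int n"] by (simp add: M_def)
  have right: "M n \<le> x (- int n) (J n + 2)" for n
  proof -
    have "M n \<le> len (- int n) (J n + 1)" unfolding M_def by (rule mesh_le_len)
    then show ?thesis using zero[of n] by (simp add: len_def algebra_simps)
  qed
  have left: "x (- int n) (J n - 1) \<le> - M n" for n
  proof -
    have "M n \<le> len (- int n) (J n - 1)" unfolding M_def by (rule mesh_le_len)
    then show ?thesis using zero[of n] by (simp add: len_def)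
  qed
  \<comment> \<open>As \<open>d \<ge> 1\<close>, the enlarged interval contains the right neighbour
    of interval \<open>J n\<close>, hence at least the length \<open>M n\<close> to the right of the
    origin.\<close>
  have in_Om: "{0..0 + M n} \<subseteq> Om (- int n) (J n)" for n
  proof -
    have "x (- int n) (J n - int d) \<le> x (- int n) (J n)" "x (- int n) (J n + 2) \<le> x (- int n) (J n + int d + 1)"
      using d by simp_all
    then have "x (- int n) (J n - int d) \<le> 0" "0 + M n \<le> x (- int n) (J n + int d + 1)"
      using zero[of n] right[of n] by linarith+
    then show ?thesis unfolding atLeastatMost_subset_iff by blast
  qed
  have in_Om': "{0..0 + M n} \<subseteq> Om (- int (Suc n)) (J (Suc n))" for n
    using order_trans[OF in_Om enlarged_nested[of "- int n" "J n" d]] unfolding lev J_Suc .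
  obtain C1 where C1: "C1 > 0" "\<forall>R a L n. degree R \<le> d \<longrightarrow> L > 0 \<longrightarrow>
     norm (coeff (R \<circ>\<^sub>p [:of_real a, of_real L:]) n) \<le> C1 * pmean R a L"
    using coeff_le_pmean by blast
  define E where "E = C1 * (C * (1 + real M0 * lam) * \<eta>)"
  have coeff_diff: "norm (coeff (R (Suc n)) \<nu> - coeff (R n) \<nu>) * M n ^ \<nu> \<le> E" for n \<nu>
  proof -
    have "pmean (R (Suc n) - R n) 0 (M n) \<le> (C * mesh (- int n) * W f (- int n) (J n)
        + C * mesh (- int (Suc n)) * W f (- int (Suc n)) (J (Suc n))) / M n"
      unfolding R_def by (intro pmean_diff_le[OF fq M in_Om _ in_Om'] RRI)
    also have "\<dots> \<le> (C * M n * \<eta> + C * (real M0 * lam * M n) * \<eta>) / M n"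
    proof (intro divide_right_mono add_mono mult_mono mult_left_mono W\<eta> W0)
      show "mesh (- int (Suc n)) \<le> real M0 * lam * M n"
        using mesh_parent_le[of "- int n"] unfolding lev M_def .
    qed (use C M[of n] mesh_pos lam in \<open>auto simp: M_def less_imp_le\<close>)
    also have "\<dots> = C * (1 + real M0 * lam) * \<eta>"
      using M[of n] by (simp add: field_simps)
    finally have pm: "pmean (R (Suc n) - R n) 0 (M n) \<le> C * (1 + real M0 * lam) * \<eta>" .
    have "norm (coeff ((R (Suc n) - R n) \<circ>\<^sub>p [:of_real 0, of_real (M n):]) \<nu>) \<le> C1 * pmean (R (Suc n) - R n) 0 (M n)"
      using M by (intro C1(2)[rule_format] degree_diff_le) (simp_all add: R_def RRd)
    also have "\<dots> \<le> E" unfolding E_def using C1(1) pm by (intro mult_left_mono) auto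
    finally show ?thesis
      using M[of n] by (simp add: coeff_pcompose_linear norm_mult norm_power mult.commute)
  qed
  \<comment> \<open>For \<open>\<nu> = 0\<close> the bound gives no decay; the constant coefficients
    may drift and are later subtracted as the sequence \<open>c\<close>.\<close>
  have conv: "convergent (\<lambda>n. coeff (R n) \<nu>)" if \<nu>: "\<nu> \<ge> 1" for \<nu>
  proof -
    have bound: "norm (coeff (R (Suc n)) \<nu> - coeff (R n) \<nu>) \<le> E / M 0 ^ \<nu> * (1 / 2) ^ n" for n
    proof -
      have "(2::real) ^ n \<le> 2 ^ (n * \<nu>)" using \<nu> by (intro power_increasing) auto
      then have "2 ^ n * M 0 ^ \<nu> \<le> (2 ^ n) ^ \<nu> * M 0 ^ \<nu>"
        using M[of 0] by (intro mult_right_mono) (auto simp: power_mult)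
      also have "\<dots> = (2 ^ n * M 0) ^ \<nu>" by (simp add: power_mult_distrib)
      also have "\<dots> \<le> M n ^ \<nu>" using M_growth M[of 0] by (intro power_mono) auto
      finally have "norm (coeff (R (Suc n)) \<nu> - coeff (R n) \<nu>) * (2 ^ n * M 0 ^ \<nu>)
          \<le> norm (coeff (R (Suc n)) \<nu> - coeff (R n) \<nu>) * M n ^ \<nu>"
        by (intro mult_left_mono) auto
      then have "norm (coeff (R (Suc n)) \<nu> - coeff (R n) \<nu>) * (2 ^ n * M 0 ^ \<nu>) \<le> E"
        using coeff_diff order_trans by blast
      then show ?thesis using M[of 0] by (simp add: field_simps power_one_over)
    qed
    have "summable (\<lambda>n. E / M 0 ^ \<nu> * (1 / 2) ^ n :: real)"
      by (intro summable_mult summable_geometric) simp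
    then have "summable (\<lambda>n. coeff (R (Suc n)) \<nu> - coeff (R n) \<nu>)"
      by (rule summable_comparison_test'[where N = 0]) (rule bound)
    then have "convergent (\<lambda>n. \<Sum>i<n. coeff (R (Suc i)) \<nu> - coeff (R i) \<nu>)"
      by (simp add: summable_iff_convergent)
    moreover have "(\<Sum>i<n. coeff (R (Suc i)) \<nu> - coeff (R i) \<nu>) = coeff (R n) \<nu> - coeff (R 0) \<nu>" for n
      by (induction n) simp_all
    ultimately have "convergent (\<lambda>n. coeff (R n) \<nu> - coeff (R 0) \<nu>)"
      by simp
    then show ?thesis by (simp add: convergent_diff_const_right_iff)
  qed
  define p where "p \<nu> = lim (\<lambda>n. coeff (R n) \<nu>)" for \<nu>
  have p: "(\<lambda>n. coeff (R n) \<nu>) \<longlonglongrightarrow> p \<nu>" if "\<nu> \<ge> 1" for \<nu>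
    using conv[OF that] by (simp add: p_def convergent_LIMSEQ_iff)
  define P where "P = (\<Sum>\<nu>\<in>{1..d}. monom (p \<nu>) \<nu>)"
  have "degree P \<le> d"
    unfolding P_def by (intro degree_sum_le) (auto intro: order_trans[OF degree_monom_le])
  then have PP: "P \<in> Pi_poly (Suc d)" by (simp add: Pi_poly_def)
  obtain C3 where C3: "C3 > 0" "\<forall>R a L t. degree R \<le> d \<longrightarrow> L > 0 \<longrightarrow> \<bar>t - a\<bar> \<le> 1 * L \<longrightarrow>
     norm (poly_real R t) \<le> C3 * pmean R a L"
    using poly_real_le_pmean[of 1 d] by auto
  have "\<exists>N. \<forall>n\<ge>N. \<forall>t\<in>{a..b}. norm (T (- int n) f t - coeff (R n) 0 - poly_real P t) \<le> \<epsilon>" if \<epsilon>: "\<epsilon> > 0" for a b \<epsilon>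
  proof -
    define K where "K = max \<bar>a\<bar> \<bar>b\<bar> + 1"
    have K: "K \<ge> 0" "\<And>t. t \<in> {a..b} \<Longrightarrow> \<bar>t\<bar> \<le> K" by (auto simp: K_def)
    have "(\<lambda>n. \<Sum>\<nu>\<in>{1..d}. norm (coeff (R n) \<nu> - p \<nu>) * K ^ \<nu>) \<longlonglongrightarrow> (\<Sum>\<nu>\<in>{1..d}. norm (p \<nu> - p \<nu>) * K ^ \<nu>)"
      by (intro tendsto_intros p) simp
    then have "(\<lambda>n. \<Sum>\<nu>\<in>{1..d}. norm (coeff (R n) \<nu> - p \<nu>) * K ^ \<nu>) \<longlonglongrightarrow> 0" by simp
    then have "\<forall>\<^sub>F n in sequentially. (\<Sum>\<nu>\<in>{1..d}. norm (coeff (R n) \<nu> - p \<nu>) * K ^ \<nu>) < \<epsilon> / 2"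
      using \<epsilon> by (intro order_tendstoD(2)[of _ 0]) auto
    then obtain N1 where N1: "\<And>n. n \<ge> N1 \<Longrightarrow> (\<Sum>\<nu>\<in>{1..d}. norm (coeff (R n) \<nu> - p \<nu>) * K ^ \<nu>) < \<epsilon> / 2"
      by (auto simp: eventually_sequentially)
    \<comment> \<open>The denominator collects the error of \<open>T\<close> against its local
      polynomial and that of this polynomial against \<open>R n\<close>; together they receive half
      of \<open>\<epsilon>\<close>.\<close>
    define \<delta> where "\<delta> = \<epsilon> / (2 * (C + C3 * (C + C)))"
    have CC: "C + C3 * (C + C) > 0" using C C3(1) by (intro add_pos_pos mult_pos_pos) auto
    have \<delta>: "\<delta> > 0" using CC \<epsilon> by (simp add: \<delta>_def)
    obtain N2 :: nat where N2: "\<forall>m j. int N2 \<le> \<bar>m\<bar> \<longrightarrow> W f m j < \<delta>" using W_small[OF f \<delta>] by blast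
    obtain N3 :: nat where N3: "K / M 0 < real N3" using reals_Archimedean2 by blast
    have "norm (T (- int n) f t - coeff (R n) 0 - poly_real P t) \<le> \<epsilon>"
      if n: "n \<ge> max N1 (max N2 N3)" and t: "t \<in> {a..b}" for n t
    proof -
      have "real N3 \<le> 2 ^ n"
      proof -
        have "real N3 \<le> real n" using n by simp
        also have "\<dots> \<le> 2 ^ n" by (rule of_nat_less_two_power[THEN less_imp_le])
        finally show ?thesis .
      qed
      then have "K / M 0 \<le> 2 ^ n" using N3 by linarith
      then have "K \<le> 2 ^ n * M 0" using M[of 0] by (simp only: pos_divide_le_eq)
      then have KM: "K \<le> M n" using M_growth[of n] by simp
      have Wn: "W f (- int n) j \<le> \<delta>" for j using N2 n by (simp add: less_imp_le)
      obtain J' where J': "x (- int n) J' \<le> t" "t < x (- int n) (J' + 1)" using ex_interval by blast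
      have "x (- int n) J' < x (- int n) (J n + 3)"
      proof -
        have "x (- int n) (J n + 2) < x (- int n) (J n + 3)" by simp
        then show ?thesis using J'(1) K(2)[OF t] KM right[of n] by linarith
      qed
      have Jup: "J' \<le> J n + 2" using \<open>x (- int n) J' < x (- int n) (J n + 3)\<close> by simp
      have tM: "\<bar>t\<bar> \<le> M n" using K(2)[OF t] KM by linarith
      \<comment> \<open>For large \<open>n\<close> the set \<open>{a..b}\<close> lies within
        \<open>M n\<close> of the origin, so interval \<open>J n\<close> and its two neighbours
        suffice. The index \<open>J n + 2\<close> can occur only through its left endpoint, which
        the closed interval \<open>J n + 1\<close> also contains.\<close>
      have "\<exists>J'' \<in> {J n - 1..J n + 1}. t \<in> {x (- int n) J''..x (- int n) (J'' + 1)}"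
      proof -
        have "x (- int n) (J n - 1) < x (- int n) (J' + 1)" using left[of n] tM J'(2) by linarith
        then have lo: "J n - 1 \<le> J'" by simp
        show ?thesis
        proof (cases "J' \<le> J n + 1")
          case True
          then show ?thesis using lo J' by (intro bexI[of _ J']) auto
        next
          case False
          then have "J' = J n + 2" using Jup by simp
          then have "t = x (- int n) (J n + 2)" using J'(1) tM right[of n] by simp
          then show ?thesis by (intro bexI[of _ "J n + 1"]) auto
        qed
      qed
      then obtain i where i: "i \<in> {J n - 1..J n + 1}" "t \<in> {x (- int n) i..x (- int n) (i + 1)}" by blast
      let ?Q = "RR (- int n) i" and ?a = "x (- int n) i" and ?L = "len (- int n) i"
      have aL: "?a + ?L = x (- int n) (i + 1)" by (simp add: len_def)
      have sub1: "{?a..?a + ?L} \<subseteq> Om (- int n) (J n)"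
        unfolding aL using i(1) d by (intro interval_in_Om) auto
      have sub2: "{?a..?a + ?L} \<subseteq> Om (- int n) i"
        unfolding aL by (intro interval_in_Om) auto
      have "pmean (?Q - R n) ?a ?L \<le> (C * mesh (- int n) * W f (- int n) (J n) + C * mesh (- int n) * W f (- int n) i) / ?L"
        unfolding R_def by (intro pmean_diff_le[OF fq len_pos sub1 _ sub2] RRI)
      also have "\<dots> \<le> (C * ?L * \<delta> + C * ?L * \<delta>) / ?L"
        using C len_pos[of "- int n" i] mesh_pos[of "- int n"] W0
        by (intro divide_right_mono add_mono mult_mono mult_left_mono mesh_le_len Wn) auto
      also have "\<dots> = (C + C) * \<delta>" using len_pos[of "- int n" i] by (simp add: field_simps)
      finally have pm: "pmean (?Q - R n) ?a ?L \<le> (C + C) * \<delta>" .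
      have "norm (poly_real (?Q - R n) t) \<le> C3 * pmean (?Q - R n) ?a ?L"
      proof (intro C3(2)[rule_format] degree_diff_le)
        show "\<bar>t - ?a\<bar> \<le> 1 * ?L" using i(2) by (simp add: len_def)
      qed (simp_all add: R_def RRd len_pos)
      also have "\<dots> \<le> C3 * ((C + C) * \<delta>)" using C3(1) by (intro mult_left_mono pm) auto
      finally have b1: "norm (poly_real (?Q - R n) t) \<le> C3 * (C + C) * \<delta>" by simp
      have "norm (T (- int n) f t - poly_real ?Q t) \<le> C * W f (- int n) i" by (rule RRT[OF i(2)])
      also have "\<dots> \<le> C * \<delta>" using C by (intro mult_left_mono Wn) auto
      finally have b2: "norm (T (- int n) f t - poly_real ?Q t) \<le> C * \<delta>" .
      have "norm (T (- int n) f t - poly_real (R n) t) \<le> norm (T (- int n) f t - poly_real ?Q t) + norm (poly_real (?Q - R n) t)"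
        using norm_triangle_ineq[of "T (- int n) f t - poly_real ?Q t" "poly_real (?Q - R n) t"]
        by (simp add: poly_real_def)
      also have "\<dots> \<le> C * \<delta> + C3 * (C + C) * \<delta>" by (intro add_mono b1 b2)
      also have "\<dots> = (C + C3 * (C + C)) * \<delta>" by (simp only: distrib_right)
      also have "\<dots> = \<epsilon> / 2"
      proof -
        have cancel: "s * (\<epsilon> / (2 * s)) = \<epsilon> / 2" if "s > 0" for s using that by simp
        show ?thesis unfolding \<delta>_def by (rule cancel[OF CC])
      qed
      finally have half1: "norm (T (- int n) f t - poly_real (R n) t) \<le> \<epsilon> / 2" .
      have "poly_real (R n) t = (\<Sum>\<nu>\<in>insert 0 {1..d}. coeff (R n) \<nu> * of_real t ^ \<nu>)"
      proof -
        have "insert 0 {1..d} = {..d}" by auto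
        then show ?thesis unfolding poly_real_def R_def by (simp only: poly_eq_sum_coeff[OF RRd])
      qed
      then have "poly_real (R n) t - coeff (R n) 0 - poly_real P t = (\<Sum>\<nu>\<in>{1..d}. (coeff (R n) \<nu> - p \<nu>) * of_real t ^ \<nu>)"
        by (simp add: P_def poly_real_def poly_sum poly_monom left_diff_distrib sum_subtractf)
      then have "norm (poly_real (R n) t - coeff (R n) 0 - poly_real P t) \<le> (\<Sum>\<nu>\<in>{1..d}. norm (coeff (R n) \<nu> - p \<nu>) * K ^ \<nu>)"
        using K(2)[OF t] by (simp del: atLeastAtMost_iff)
          (intro sum_norm_le, simp add: norm_mult norm_power mult_left_mono power_mono)
      also have "\<dots> \<le> \<epsilon> / 2" using N1[of n] n by simp
      finally have half2: "norm (poly_real (R n) t - coeff (R n) 0 - poly_real P t) \<le> \<epsilon> / 2" .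
      have "T (- int n) f t - coeff (R n) 0 - poly_real P t
          = (T (- int n) f t - poly_real (R n) t) + (poly_real (R n) t - coeff (R n) 0 - poly_real P t)" by simp
      then show ?thesis
        using norm_triangle_ineq[of "T (- int n) f t - poly_real (R n) t" "poly_real (R n) t - coeff (R n) 0 - poly_real P t"]
          half1 half2 by (simp only:)
    qed
    then show ?thesis by blast
  qed
  then show ?thesis using PP by (intro bexI[of _ P] exI[of _ "\<lambda>n. coeff (R n) 0"]) blast+
qed

end

section \<open>Partial sums, tails and unconditional convergence\<close>

lemma summable_tail:
  fixes a :: "'i \<Rightarrow> real"
  assumes sum: "a summable_on UNIV" and nonneg: "\<And>i. a i \<ge> 0" and \<delta>: "\<delta> > 0"
  shows "\<exists>F. finite F \<and> (\<forall>X. finite X \<longrightarrow> X \<inter> F = {} \<longrightarrow> (\<Sum>i\<in>X. a i) \<le> \<delta>)"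
proof -
  have "(sum a \<longlongrightarrow> infsum a UNIV) (finite_subsets_at_top UNIV)"
    using sum by (rule infsum_tendsto)
  then have "\<forall>\<^sub>F F in finite_subsets_at_top UNIV. infsum a UNIV - \<delta> < sum a F"
    using \<delta> by (intro order_tendstoD(1)) auto
  then obtain F where F: "finite F" "infsum a UNIV - \<delta> < sum a F"
    by (auto simp: eventually_finite_subsets_at_top)
  have "(\<Sum>i\<in>X. a i) \<le> \<delta>" if "finite X" "X \<inter> F = {}" for X
  proof -
    have "sum a X + sum a F = sum a (X \<union> F)" using F that by (simp add: sum.union_disjoint)
    also have "\<dots> \<le> infsum a UNIV"
      using F that sum nonneg by (intro finite_sum_le_infsum) auto
    finally show ?thesis using F(2) by simp
  qed
  then show ?thesis using F(1) by blast
qed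

context quasi_interpolation
begin

lemma T_telescope: "T (a + int n) f t - T a f t = (\<Sum>m\<in>{a + 1..a + int n}. spline_sum (x m) (Suc d) (bq f m) t)"
proof (induction n)
  case (Suc n)
  have set: "{a + 1..a + int (Suc n)} = insert (a + int (Suc n)) {a + 1..a + int n}" by auto
  have "T (a + int (Suc n)) f t - T a f t = spline_sum (x (a + int (Suc n))) (Suc d) (bq f (a + int (Suc n))) t
      + (T (a + int n) f t - T a f t)"
    using bq[of "a + int (Suc n)" f t] by (simp add: algebra_simps)
  then show ?case unfolding Suc set by simp
qed simp

lemma sum_parents_le:
  fixes g :: "int \<times> int \<Rightarrow> real"
  assumes X: "finite X" and nonneg: "\<And>i. g i \<ge> 0" and N: "\<And>Y. finite Y \<Longrightarrow> sum g Y \<le> N"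
  shows "(\<Sum>(m, j)\<in>X. g (m - 1, par m j)) \<le> real M0 * N"
proof -
  define \<psi> where "\<psi> i = (fst i - 1, par (fst i) (snd i))" for i :: "int \<times> int"
  have "(\<Sum>(m, j)\<in>X. g (m - 1, par m j)) = (\<Sum>i\<in>X. g (\<psi> i))"
    by (simp add: \<psi>_def case_prod_unfold)
  also have "\<dots> = (\<Sum>y\<in>\<psi> ` X. \<Sum>i\<in>{i \<in> X. \<psi> i = y}. g (\<psi> i))"
    using X by (rule sum.image_gen)
  also have "\<dots> = (\<Sum>y\<in>\<psi> ` X. real (card {i \<in> X. \<psi> i = y}) * g y)"
    by (intro sum.cong refl) simp
  also have "\<dots> \<le> (\<Sum>y\<in>\<psi> ` X. real M0 * g y)"
  proof (intro sum_mono mult_right_mono nonneg)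
    fix y
    have "{i \<in> X. \<psi> i = y} \<subseteq> Pair (fst y + 1) ` children (fst y + 1) (snd y)"
      by (auto simp: \<psi>_def children_def image_iff)
    then have "card {i \<in> X. \<psi> i = y} \<le> card (children (fst y + 1) (snd y))"
      using children_card(1) by (meson card_image_le card_mono finite_imageI order_trans)
    also have "\<dots> \<le> M0" using children_card(2)[of "fst y + 1" "snd y"] by simp
    finally show "real (card {i \<in> X. \<psi> i = y}) \<le> real M0" by simp
  qed
  also have "\<dots> = real M0 * sum g (\<psi> ` X)" by (simp add: sum_distrib_left)
  also have "\<dots> \<le> real M0 * N" using X by (intro mult_left_mono N) auto
  finally show ?thesis .
qed

text \<open>\<open>powr_sum_le\<close> holds for every nonnegative exponent, so
  \<open>\<tau> < 1\<close> is covered too. The constant is chosen before \<open>f\<close>, which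
  gives the final estimate its uniformity.\<close>

lemma bq_summable:
  "\<exists>C>0. \<forall>f. summable_W \<tau> f \<longrightarrow> (\<lambda>(m, j). norm (bq f m j) powr \<tau>) summable_on UNIV \<and>
     (\<Sum>\<^sub>\<infinity>(m, j)\<in>UNIV. norm (bq f m j) powr \<tau>) \<le> C * (\<Sum>\<^sub>\<infinity>(m, j)\<in>UNIV. W f m j powr \<tau>)"
proof -
  obtain C0 where C0: "C0 > 0" "\<forall>f m j. Lq_loc q f \<longrightarrow> norm (bq f m j) \<le> C0 * (W f m j + W f (m - 1) (par m j))"
    using bq_bound by blast
  define K where "K = C0 powr \<tau> * 2 powr \<tau>"
  have K: "K > 0" using C0(1) by (simp add: K_def)
  have "(\<lambda>(m, j). norm (bq f m j) powr \<tau>) summable_on UNIV \<and>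
     (\<Sum>\<^sub>\<infinity>(m, j)\<in>UNIV. norm (bq f m j) powr \<tau>) \<le> K * (1 + real M0) * (\<Sum>\<^sub>\<infinity>(m, j)\<in>UNIV. W f m j powr \<tau>)"
    if f: "summable_W \<tau> f" for f
  proof -
    let ?g = "\<lambda>(m, j). W f m j powr \<tau>" and ?b = "\<lambda>(m, j). norm (bq f m j) powr \<tau>"
    let ?N = "\<Sum>\<^sub>\<infinity>i. ?g i"
    have fq: "Lq_loc q f" and \<tau>: "\<tau> > 0" and sg: "?g summable_on UNIV" using f by (simp_all add: summable_W_def)
    have N: "sum ?g Y \<le> ?N" if "finite Y" for Y
      using that by (intro finite_sum_le_infsum sg) auto
    have fin: "sum ?b X \<le> K * (1 + real M0) * ?N" if X: "finite X" for X
    proof -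
      have "sum ?b X \<le> (\<Sum>i\<in>X. K * (?g i + (\<lambda>(m, j). ?g (m - 1, par m j)) i))"
      proof (rule sum_mono, clarify)
        fix m j
        have W0: "W f m j \<ge> 0" "W f (m - 1) (par m j) \<ge> 0" by (intro W_nonneg[OF fq])+
        have "norm (bq f m j) powr \<tau> \<le> (C0 * (W f m j + W f (m - 1) (par m j))) powr \<tau>"
          using \<tau> C0(2) fq by (intro powr_mono2) auto
        also have "\<dots> = C0 powr \<tau> * (W f m j + W f (m - 1) (par m j)) powr \<tau>"
          by (rule powr_mult)
        also have "\<dots> \<le> C0 powr \<tau> * (2 powr \<tau> * (W f m j powr \<tau> + W f (m - 1) (par m j) powr \<tau>))"
          using \<tau> W0 by (intro mult_left_mono powr_sum_le) auto
        finally show "norm (bq f m j) powr \<tau> \<le> K * (W f m j powr \<tau> + W f (m - 1) (par m j) powr \<tau>)"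
          by (simp add: K_def mult.assoc)
      qed
      also have "\<dots> = K * (sum ?g X + (\<Sum>(m, j)\<in>X. ?g (m - 1, par m j)))"
        by (simp add: sum_distrib_left[symmetric] sum.distrib)
      also have "\<dots> \<le> K * (?N + real M0 * ?N)"
        using K by (intro mult_left_mono add_mono N[OF X] sum_parents_le[OF X _ N]) auto
      finally show ?thesis by (simp add: algebra_simps)
    qed
    have sb: "?b summable_on UNIV"
    proof (rule nonneg_bdd_above_summable_on)
      show "bdd_above (sum ?b ` {F. F \<subseteq> UNIV \<and> finite F})"
        using fin by (auto simp: bdd_above_def)
    qed auto
    moreover have "infsum ?b UNIV \<le> K * (1 + real M0) * ?N"
      by (rule infsum_le_finite_sums[OF sb]) (rule fin)
    ultimately show ?thesis by simp
  qed
  moreover have "K * (1 + real M0) > 0" using K by (simp add: add_pos_nonneg)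
  ultimately show ?thesis by blast
qed

definition atom :: "(real \<Rightarrow> complex) \<Rightarrow> int \<times> int \<Rightarrow> real \<Rightarrow> complex" where
  "atom f i t = bq f (fst i) (snd i) * of_real (bspline (x (fst i)) d (snd i) t)"

lemma single_spline:
  "spline_sum (x m) (Suc d) (\<lambda>i. if i = j then z else 0) t = z * of_real (bspline (x m) d j t)"
proof -
  obtain J where J: "x m J \<le> t" "t < x m (J + 1)" using ex_interval by blast
  have "spline_sum (x m) (Suc d) (\<lambda>i. if i = j then z else 0) t
      = (\<Sum>i\<in>insert j {J - int d..J}. (if i = j then z else 0) * of_real (bspline (x m) d i t))"
    using bspline_outside[OF strict J] by (intro spline_sum_superset) blast+
  also have "\<dots> = (\<Sum>i\<in>{j}. (if i = j then z else 0) * of_real (bspline (x m) d i t))"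
    by (intro sum.mono_neutral_right) auto
  finally show ?thesis by simp
qed

lemma atom_eq: "atom f i = spline_sum (x (fst i)) (Suc d) (\<lambda>l. if l = snd i then bq f (fst i) (snd i) else 0)"
  by (rule ext) (simp add: atom_def single_spline)

lemma continuous_atom: "continuous_on S (atom f i)"
  unfolding atom_eq by (rule continuous_spline_sum[OF d, where B = "norm (bq f (fst i) (snd i))"]) auto

text \<open>One level with one possibly nonzero coefficient, so the oscillation estimate applies
  with exponent 1.\<close>

lemma atom_BMO: "atom f i \<in> BMO"
proof -
  let ?B = "norm (bq f (fst i) (snd i))"
  let ?c = "\<lambda>m l. if l = snd i then bq f (fst i) (snd i) else 0"
  obtain C where C: "C > 0" "\<forall>c B a b M. B \<ge> 0 \<longrightarrow> (\<forall>m X. finite X \<longrightarrow> (\<Sum>j\<in>X. norm (c m j) powr 1) \<le> B powr 1) \<longrightarrow>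
    a < b \<longrightarrow> finite M \<longrightarrow>
    (\<exists>z. (LINT t:{a..b}|lebesgue. norm ((\<Sum>m\<in>M. spline_sum (x m) (Suc d) (c m) t) - z)) \<le> C * B * (b - a))"
    using splines_oscillation[OF d, of 1] by auto
  have "(\<Sum>l\<in>X. norm (?c m l) powr 1) \<le> ?B powr 1" if "finite X" for m X
  proof -
    have "(\<Sum>l\<in>X. norm (?c m l) powr 1) = (\<Sum>l\<in>X. if l = snd i then ?B else 0)"
      by (intro sum.cong) auto
    also have "\<dots> \<le> ?B powr 1" using that by (simp add: sum.delta)
    finally show ?thesis .
  qed
  then have "\<exists>z. (LINT t:{a..b}|lebesgue. norm (atom f i t - z)) \<le> C * ?B * (b - a)" if "a < b" for a b
    using C(2)[rule_format, of ?B ?c a b "{fst i}"] that by (simp add: atom_eq)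
  then have "bmo_norm (atom f i) \<le> ennreal (2 * (C * ?B))"
    using C(1) by (intro bmo_norm_le set_integrable_continuous_lebesgue continuous_atom) auto
  then have "bmo_norm (atom f i) < \<infinity>" by (rule le_less_trans) simp
  moreover have "Lq_loc 1 (atom f i)"
    unfolding Lq_loc_def by (intro allI Lq_on_continuous continuous_atom) simp
  ultimately show ?thesis by (simp add: BMO_def)
qed

text \<open>Finite partial sums are the elements of \<open>C0\<close> that will witness membership
  of the sum in \<open>VMO\<close>.\<close>

lemma sum_atoms_C0: "finite F \<Longrightarrow> (\<lambda>t. \<Sum>i\<in>F. atom f i t) \<in> C0"
proof -
  assume F: "finite F"
  have "bounded (\<Union>i\<in>F. {x (fst i) (snd i)..x (fst i) (snd i + int d + 1)})"
    using F by (intro bounded_UN) auto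
  moreover have "{t. (\<Sum>i\<in>F. atom f i t) \<noteq> 0} \<subseteq> (\<Union>i\<in>F. {x (fst i) (snd i)..x (fst i) (snd i + int d + 1)})"
  proof
    fix t assume "t \<in> {t. (\<Sum>i\<in>F. atom f i t) \<noteq> 0}"
    then obtain i where i: "i \<in> F" "atom f i t \<noteq> 0"
      using sum.neutral[of F "\<lambda>i. atom f i t"] by blast
    then have "bspline (x (fst i)) d (snd i) t \<noteq> 0" by (auto simp: atom_def)
    then have "t \<in> {x (fst i) (snd i)..x (fst i) (snd i + int d + 1)}"
      using bspline_bounds[OF strict[of "fst i"], where j = "snd i" and t = t and d = d] by auto
    then show "t \<in> (\<Union>i\<in>F. {x (fst i) (snd i)..x (fst i) (snd i + int d + 1)})" by (rule UN_I[OF i(1)])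
  qed
  ultimately have "bounded {t. (\<Sum>i\<in>F. atom f i t) \<noteq> 0}" by (rule bounded_subset)
  then show ?thesis
    unfolding C0_def by (auto simp: compact_closure intro!: continuous_on_sum continuous_atom)
qed

text \<open>The terms in \<open>F\<close> are moved out of the level by setting their coefficients
  to 0; at each \<open>t\<close> only finitely many indices count.\<close>

lemma level_split:
  assumes F: "finite F"
  shows "spline_sum (x m) (Suc d) (bq f m) t
    = spline_sum (x m) (Suc d) (\<lambda>j. if (m, j) \<in> F then 0 else bq f m j) t + (\<Sum>j\<in>{j. (m, j) \<in> F}. atom f (m, j) t)"
proof -
  obtain J where J: "x m J \<le> t" "t < x m (J + 1)" using ex_interval by blast
  have fin: "finite {j. (m, j) \<in> F}"
    using finite_vimageI[OF F, of "Pair m"] by (simp add: vimage_def inj_on_def)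
  define X where "X = {j. (m, j) \<in> F} \<union> {J - int d..J}"
  have X: "finite X" using fin by (simp add: X_def)
  have sup: "j \<in> X" if "bspline (x m) d j t \<noteq> 0" for j
    using bspline_outside[OF strict J] that unfolding X_def by blast
  have S: "(\<Sum>j\<in>{j. (m, j) \<in> F}. atom f (m, j) t) = (\<Sum>j\<in>X. if (m, j) \<in> F then atom f (m, j) t else 0)"
    using X by (intro sum.mono_neutral_cong_left) (auto simp: X_def)
  have E: "spline_sum (x m) (Suc d) c t = (\<Sum>j\<in>X. c j * of_real (bspline (x m) d j t))" for c
    by (rule spline_sum_superset[OF X]) (rule sup)
  show ?thesis
    unfolding S E sum.distrib[symmetric] by (intro sum.cong refl) (simp add: atom_def)
qed

text \<open>The telescoped levels run from \<open>- n + 1\<close> to \<open>n\<close>; the strict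
  bound on the levels occurring in \<open>F\<close> puts all its terms among them.\<close>

lemma partial_sum_split:
  assumes F: "finite F" "\<And>m j. (m, j) \<in> F \<Longrightarrow> \<bar>m\<bar> < int n"
  shows "T (int n) f t - T (- int n) f t - (\<Sum>i\<in>F. atom f i t)
    = (\<Sum>m\<in>{- int n + 1..int n}. spline_sum (x m) (Suc d) (\<lambda>j. if (m, j) \<in> F then 0 else bq f m j) t)"
proof -
  let ?M = "{- int n + 1..int n}"
  have fin: "finite {j. (m, j) \<in> F}" for m
    using finite_vimageI[OF F(1), of "Pair m"] by (simp add: vimage_def inj_on_def)
  have "F = (SIGMA m:?M. {j. (m, j) \<in> F})" using F(2) by (fastforce simp: abs_less_iff)
  then have "(\<Sum>i\<in>F. atom f i t) = (\<Sum>m\<in>?M. \<Sum>j\<in>{j. (m, j) \<in> F}. atom f (m, j) t)"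
    using fin by (simp add: sum.Sigma case_prod_unfold)
  moreover have "T (int n) f t - T (- int n) f t = (\<Sum>m\<in>?M. spline_sum (x m) (Suc d) (bq f m) t)"
    using T_telescope[of "- int n" "n + n" f t] by simp
  ultimately show ?thesis
    by (simp add: level_split[OF F(1)] sum.distrib)
qed

text \<open>On a fixed interval, \<open>f - P\<close> minus the atoms in \<open>F\<close> is, up to
  a constant and two errors, a finite sum of splines with coefficients outside \<open>F\<close>. The
  errors, \<open>f - T n f\<close> at the fine end and \<open>T (- n) f - c n - P\<close> at the
  coarse end, are made small by choosing \<open>n\<close> for that interval. As the oscillation
  bound does not involve \<open>n\<close>, the result is uniform over intervals.\<close>

lemma tail_bmo:
  "\<exists>C>0. \<forall>f P c F B. summable_W \<tau> f \<longrightarrow>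
    (\<forall>a b \<epsilon>. \<epsilon> > 0 \<longrightarrow> (\<exists>N. \<forall>n\<ge>N. \<forall>t\<in>{a..b}. norm (T (- int n) f t - c n - poly_real P t) \<le> \<epsilon>)) \<longrightarrow>
    finite F \<longrightarrow> B > 0 \<longrightarrow> (\<forall>X. finite X \<longrightarrow> X \<inter> F = {} \<longrightarrow> (\<Sum>(m, j)\<in>X. norm (bq f m j) powr \<tau>) \<le> B powr \<tau>) \<longrightarrow>
    bmo_norm (\<lambda>t. f t - poly_real P t - (\<Sum>i\<in>F. atom f i t)) \<le> ennreal (C * B)"
proof -
  define p where "p = max \<tau> 1"
  have p: "p \<ge> 1" "p \<ge> \<tau>" by (auto simp: p_def)
  obtain C where C: "C > 0" and osc: "\<forall>c B a b M. B \<ge> 0 \<longrightarrow> (\<forall>m X. finite X \<longrightarrow> (\<Sum>j\<in>X. norm (c m j) powr p) \<le> B powr p) \<longrightarrow>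
    a < b \<longrightarrow> finite M \<longrightarrow>
    (\<exists>z. (LINT t:{a..b}|lebesgue. norm ((\<Sum>m\<in>M. spline_sum (x m) (Suc d) (c m) t) - z)) \<le> C * B * (b - a))"
    using splines_oscillation[OF d p(1)] by blast
  have "bmo_norm (\<lambda>t. f t - poly_real P t - (\<Sum>i\<in>F. atom f i t)) \<le> ennreal (2 * ((C + 1) * B))"
    if f: "summable_W \<tau> f"
      and lim: "\<forall>a b \<epsilon>. \<epsilon> > 0 \<longrightarrow> (\<exists>N. \<forall>n\<ge>N. \<forall>t\<in>{a..b}. norm (T (- int n) f t - c n - poly_real P t) \<le> \<epsilon>)"
      and F: "finite F" and B: "B > 0"
      and tail: "\<forall>X. finite X \<longrightarrow> X \<inter> F = {} \<longrightarrow> (\<Sum>(m, j)\<in>X. norm (bq f m j) powr \<tau>) \<le> B powr \<tau>"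
    for f P F B and c :: "nat \<Rightarrow> complex"
  proof (rule bmo_norm_le)
    have fq: "Lq_loc q f" and \<tau>: "\<tau> > 0" using f by (simp_all add: summable_W_def)
    have cont: "continuous_on {a..b} (\<lambda>t. poly_real P t + (\<Sum>i\<in>F. atom f i t))" for a b
      by (intro continuous_intros continuous_atom)
    show "set_integrable lebesgue {a..b} (\<lambda>t. f t - poly_real P t - (\<Sum>i\<in>F. atom f i t))" for a b
      using set_integral_diff(1)[OF integrable_f[OF fq] set_integrable_continuous_lebesgue[OF cont]]
      by (simp add: diff_diff_eq)
    show "(C + 1) * B \<ge> 0" using C B by simp
    fix a b :: real assume ab: "a < b"
    define e where "e m j = (if (m, j) \<in> F then 0 else bq f m j)" for m j
    have e\<tau>: "(\<Sum>j\<in>X. norm (e m j) powr \<tau>) \<le> B powr \<tau>" if X: "finite X" for m X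
    proof -
      let ?Y = "{j \<in> X. (m, j) \<notin> F}"
      have "(\<Sum>j\<in>X. norm (e m j) powr \<tau>) = (\<Sum>j\<in>?Y. norm (bq f m j) powr \<tau>)"
        using X by (intro sum.mono_neutral_cong_right) (auto simp: e_def)
      also have "\<dots> = (\<Sum>(m, j)\<in>Pair m ` ?Y. norm (bq f m j) powr \<tau>)"
        by (simp add: sum.reindex inj_on_def)
      also have "\<dots> \<le> B powr \<tau>" using X by (intro tail[rule_format]) auto
      finally show ?thesis .
    qed
    have e1: "norm (e m j) \<le> B" for m j
    proof (rule powr_le_imp_le)
      show "norm (e m j) powr \<tau> \<le> B powr \<tau>" using e\<tau>[of "{j}" m] by simp
    qed (use B \<tau> in auto)
    \<comment> \<open>Each coefficient is at most \<open>B\<close>, so its power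
      \<open>p - \<tau>\<close> can be replaced by that of \<open>B\<close>: the bound with exponent
      \<open>\<tau>\<close> passes to the larger exponent \<open>p\<close> with the same
      \<open>B\<close>.\<close>
    have ep: "(\<Sum>j\<in>X. norm (e m j) powr p) \<le> B powr p" if X: "finite X" for m X
    proof -
      have "(\<Sum>j\<in>X. norm (e m j) powr p) \<le> (\<Sum>j\<in>X. B powr (p - \<tau>) * norm (e m j) powr \<tau>)"
      proof (rule sum_mono)
        fix j
        have "norm (e m j) powr p = norm (e m j) powr (p - \<tau>) * norm (e m j) powr \<tau>"
          by (simp flip: powr_add)
        also have "\<dots> \<le> B powr (p - \<tau>) * norm (e m j) powr \<tau>"
          using e1 p by (intro mult_right_mono powr_mono2) auto
        finally show "norm (e m j) powr p \<le> B powr (p - \<tau>) * norm (e m j) powr \<tau>" .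
      qed
      also have "\<dots> = B powr (p - \<tau>) * (\<Sum>j\<in>X. norm (e m j) powr \<tau>)" by (simp only: sum_distrib_left)
      also have "\<dots> \<le> B powr (p - \<tau>) * B powr \<tau>" by (intro mult_left_mono e\<tau> X) auto
      also have "\<dots> = B powr p" by (simp flip: powr_add)
      finally show ?thesis .
    qed
    \<comment> \<open>The two errors may be of size \<open>B\<close> on average, each taking half;
      this is the summand 1 in \<open>C + 1\<close>.\<close>
    have BB: "B * (b - a) > 0" using B ab by simp
    obtain N1 where N1: "\<And>n. n \<ge> N1 \<Longrightarrow> (LINT t:{a..b}|lebesgue. norm (f t - T (int n) f t)) \<le> B * (b - a) / 2"
      using T_to_f[OF f ab, of "B * (b - a) / 2"] BB by auto
    have "B / 2 > 0" using B by simp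
    with lim obtain N2 where N2: "\<forall>n\<ge>N2. \<forall>t\<in>{a..b}. norm (T (- int n) f t - c n - poly_real P t) \<le> B / 2"
      by presburger
    have "finite ((\<lambda>i. nat \<bar>fst i\<bar>) ` F)" using F by simp
    then obtain N3 where N3: "\<forall>k\<in>(\<lambda>i. nat \<bar>fst i\<bar>) ` F. k < N3"
      using finite_nat_set_iff_bounded by blast
    define n where "n = max N1 (max N2 N3)"
    have Fn: "\<bar>m\<bar> < int n" if "(m, j) \<in> F" for m j
    proof -
      have "nat \<bar>m\<bar> < N3" using N3 that by force
      then show ?thesis by (simp add: n_def)
    qed
    let ?M = "{- int n + 1..int n}"
    let ?S = "\<lambda>t. \<Sum>m\<in>?M. spline_sum (x m) (Suc d) (e m) t"
    obtain z where z: "(LINT t:{a..b}|lebesgue. norm (?S t - z)) \<le> C * B * (b - a)"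
      using osc[rule_format, of B e a b ?M] ep ab B by auto
    have S: "T (int n) f t - T (- int n) f t - (\<Sum>i\<in>F. atom f i t) = ?S t" for t
      unfolding e_def by (rule partial_sum_split[OF F Fn])
    have i1: "set_integrable lebesgue {a..b} (\<lambda>t. norm (f t - T (int n) f t))"
      by (intro set_integrable_norm set_integral_diff(1) integrable_f[OF fq] set_integrable_continuous_lebesgue continuous_T)
    have i2: "set_integrable lebesgue {a..b} (\<lambda>t. norm (?S t - z))"
      by (intro set_integrable_norm set_integrable_continuous_lebesgue continuous_intros continuous_spline_sum_local d)
    have "(LINT t:{a..b}|lebesgue. norm (f t - poly_real P t - (\<Sum>i\<in>F. atom f i t) - (z + c n)))
        \<le> (LINT t:{a..b}|lebesgue. (norm (f t - T (int n) f t) + norm (?S t - z)) + B / 2)"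
    proof (rule set_integral_mono[OF set_integrable_norm
          set_integral_add(1)[OF set_integral_add(1)[OF i1 i2] set_integrable_const_interval]])
      have "continuous_on {a..b} (\<lambda>t. poly_real P t + (\<Sum>i\<in>F. atom f i t) + (z + c n))"
        by (intro continuous_intros continuous_atom)
      from set_integral_diff(1)[OF integrable_f[OF fq] set_integrable_continuous_lebesgue[OF this]]
      show "set_integrable lebesgue {a..b} (\<lambda>t. f t - poly_real P t - (\<Sum>i\<in>F. atom f i t) - (z + c n))"
        by (simp add: diff_diff_eq)
      fix t assume t: "t \<in> {a..b}"
      have eq: "f t - poly_real P t - (\<Sum>i\<in>F. atom f i t) - (z + c n)
          = ((f t - T (int n) f t) + (?S t - z)) + (T (- int n) f t - c n - poly_real P t)"
        unfolding S[symmetric] by simp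
      have n3: "norm (T (- int n) f t - c n - poly_real P t) \<le> B / 2"
        by (rule N2[rule_format, OF _ t]) (simp add: n_def)
      show "norm (f t - poly_real P t - (\<Sum>i\<in>F. atom f i t) - (z + c n))
          \<le> (norm (f t - T (int n) f t) + norm (?S t - z)) + B / 2"
        unfolding eq by (rule order_trans[OF norm_triangle_ineq add_mono[OF norm_triangle_ineq n3]])
    qed
    also have "\<dots> = (LINT t:{a..b}|lebesgue. norm (f t - T (int n) f t)) + (LINT t:{a..b}|lebesgue. norm (?S t - z))
        + (b - a) * (B / 2)"
      unfolding set_integral_add(2)[OF set_integral_add(1)[OF i1 i2] set_integrable_const_interval]
        set_integral_add(2)[OF i1 i2] set_integral_const_interval[OF less_imp_le[OF ab]] ..
    also have "\<dots> \<le> B * (b - a) / 2 + C * B * (b - a) + (b - a) * (B / 2)"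
      using N1[of n] z by (intro add_mono) (auto simp: n_def)
    also have "\<dots> = (C + 1) * B * (b - a)" by (simp add: field_simps)
    finally show "\<exists>z. (LINT t:{a..b}|lebesgue. norm (f t - poly_real P t - (\<Sum>i\<in>F. atom f i t) - z)) \<le> (C + 1) * B * (b - a)"
      by blast
  qed
  note main = this
  show ?thesis
  proof (intro exI[of _ "2 * (C + 1)"] conjI allI impI, goal_cases)
    case 1
    then show ?case using C by simp
  next
    case (2 f P c F B)
    show ?case unfolding mult.assoc by (rule main[OF 2])
  qed
qed

text \<open>\<open>tail_bmo\<close> serves three purposes: \<open>F\<close> empty gives membership
  in BMO, one large \<open>F\<close> the approximation by \<open>C0\<close>, and all finite sets
  above it the unconditional convergence.\<close>

lemma decomposition:
  assumes f: "summable_W \<tau> f"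
  shows "\<exists>P\<in>Pi_poly (Suc d). (\<lambda>t. f t - poly_real P t) \<in> VMO \<and> has_sum_BMO (atom f) (\<lambda>t. f t - poly_real P t)"
proof -
  have fq: "Lq_loc q f" and \<tau>: "\<tau> > 0" using f by (simp_all add: summable_W_def)
  let ?b = "\<lambda>(m, j). norm (bq f m j) powr \<tau>"
  have sb: "?b summable_on UNIV" using bq_summable[of \<tau>] f by blast
  obtain P c where P: "P \<in> Pi_poly (Suc d)" and lim: "\<forall>a b \<epsilon>. \<epsilon> > 0 \<longrightarrow>
     (\<exists>N. \<forall>n\<ge>N. \<forall>t\<in>{a..b}. norm (T (- int n) f t - c n - poly_real P t) \<le> \<epsilon>)"
    using T_coarse_limit[OF f] by blast
  obtain C where C: "C > 0" and tail_all: "\<forall>f P c F B. summable_W \<tau> f \<longrightarrow>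
    (\<forall>a b \<epsilon>. \<epsilon> > 0 \<longrightarrow> (\<exists>N. \<forall>n\<ge>N. \<forall>t\<in>{a..b}. norm (T (- int n) f t - c n - poly_real P t) \<le> \<epsilon>)) \<longrightarrow>
    finite F \<longrightarrow> B > 0 \<longrightarrow> (\<forall>X. finite X \<longrightarrow> X \<inter> F = {} \<longrightarrow> (\<Sum>(m, j)\<in>X. norm (bq f m j) powr \<tau>) \<le> B powr \<tau>) \<longrightarrow>
    bmo_norm (\<lambda>t. f t - poly_real P t - (\<Sum>i\<in>F. atom f i t)) \<le> ennreal (C * B)"
    using tail_bmo[of \<tau>] by blast
  define h where "h t = f t - poly_real P t" for t
  have tail: "bmo_norm (\<lambda>t. h t - (\<Sum>i\<in>F. atom f i t)) \<le> ennreal (C * B)"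
    if "finite F" "B > 0" "\<And>X. finite X \<Longrightarrow> X \<inter> F = {} \<Longrightarrow> sum ?b X \<le> B powr \<tau>" for F B
    unfolding h_def
    using tail_all[THEN spec, THEN spec, THEN spec, THEN spec, THEN spec, THEN mp, OF f, THEN mp, OF lim] that by simp
  have small: "\<exists>F. finite F \<and> (\<forall>F'. finite F' \<and> F \<subseteq> F' \<longrightarrow> bmo_norm (\<lambda>t. h t - (\<Sum>i\<in>F'. atom f i t)) < \<epsilon>)"
    if \<epsilon>: "\<epsilon> > 0" for \<epsilon> :: ennreal
  proof -
    \<comment> \<open>As \<open>\<epsilon>\<close> may be infinite, a finite value strictly below it
      is taken first.\<close>
    obtain z where z: "0 < z" "z < \<epsilon>" using dense[OF \<epsilon>] by blast
    define r where "r = enn2real z"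
    have "z < top" using z(2) by (rule less_le_trans) simp
    then have r: "r > 0" "ennreal r < \<epsilon>" using z by (simp_all add: r_def enn2real_positive_iff)
    define B where "B = r / C"
    have B: "B > 0" "C * B = r" using r C by (simp_all add: B_def)
    obtain F where F: "finite F" "\<forall>X. finite X \<longrightarrow> X \<inter> F = {} \<longrightarrow> sum ?b X \<le> B powr \<tau>"
      using summable_tail[OF sb, of "B powr \<tau>"] B by auto
    have "bmo_norm (\<lambda>t. h t - (\<Sum>i\<in>F'. atom f i t)) < \<epsilon>" if "finite F'" "F \<subseteq> F'" for F'
    proof -
      have "bmo_norm (\<lambda>t. h t - (\<Sum>i\<in>F'. atom f i t)) \<le> ennreal (C * B)"
        using that F(2) B(1) by (intro tail) auto
      then show ?thesis using B r by simp
    qed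
    then show ?thesis using F(1) by blast
  qed
  have "h \<in> BMO"
  proof -
    \<comment> \<open>Adding 1 keeps \<open>B\<close> positive, as \<open>tail_bmo\<close> demands,
      even if all coefficients vanish.\<close>
    define B where "B = (infsum ?b UNIV + 1) powr (1 / \<tau>)"
    have N: "infsum ?b UNIV \<ge> 0" by (intro infsum_nonneg) auto
    then have B: "B > 0" "B powr \<tau> = infsum ?b UNIV + 1" using \<tau> by (auto simp: B_def powr_powr)
    have "bmo_norm (\<lambda>t. h t - (\<Sum>i\<in>{}. atom f i t)) \<le> ennreal (C * B)"
    proof (rule tail)
      fix X :: "(int \<times> int) set" assume "finite X"
      then have "sum ?b X \<le> infsum ?b UNIV" by (intro finite_sum_le_infsum sb) auto
      then show "sum ?b X \<le> B powr \<tau>" by (simp add: B)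
    qed (use B in auto)
    then have "bmo_norm h < \<infinity>" by (simp add: le_less_trans)
    moreover have "Lq_loc 1 h"
      unfolding Lq_loc_def h_def
      using fq by (intro allI Lq_on_imp_integrable(1)[OF _ q] Lq_on_diff Lq_on_poly q) (simp add: Lq_loc_def)
    ultimately show ?thesis by (simp add: BMO_def)
  qed
  moreover have "\<exists>g\<in>C0. bmo_norm (\<lambda>t. h t - g t) < \<epsilon>" if \<epsilon>: "\<epsilon> > 0" for \<epsilon>
  proof -
    from small[OF \<epsilon>] obtain F where F: "finite F"
      "\<forall>F'. finite F' \<and> F \<subseteq> F' \<longrightarrow> bmo_norm (\<lambda>t. h t - (\<Sum>i\<in>F'. atom f i t)) < \<epsilon>"
      by (elim exE conjE)
    then have "bmo_norm (\<lambda>t. h t - (\<Sum>i\<in>F. atom f i t)) < \<epsilon>" by simp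
    then show ?thesis by (rule bexI[OF _ sum_atoms_C0[OF F(1)]])
  qed
  ultimately have "h \<in> VMO" by (simp add: VMO_def)
  moreover have "((\<lambda>F. bmo_norm (\<lambda>t. h t - (\<Sum>i\<in>F. atom f i t))) \<longlongrightarrow> 0) (finite_subsets_at_top UNIV)"
  proof (rule order_tendstoI)
    fix \<epsilon> :: ennreal assume "0 < \<epsilon>"
    from small[OF this]
    show "\<forall>\<^sub>F F in finite_subsets_at_top UNIV. bmo_norm (\<lambda>t. h t - (\<Sum>i\<in>F. atom f i t)) < \<epsilon>"
      by (simp add: eventually_finite_subsets_at_top)
  qed simp
  ultimately have "h \<in> VMO \<and> has_sum_BMO (atom f) h"
    using \<open>h \<in> BMO\<close> atom_BMO by (simp add: has_sum_BMO_def)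
  then show ?thesis unfolding h_def[abs_def] by (rule bexI[OF _ P])
qed

end

theorem theorem3p7:
  fixes \<alpha> \<tau> q A lam :: real and k M0 :: nat
    and x \<xi> :: "int \<Rightarrow> int \<Rightarrow> real"
    and Proj :: "real \<Rightarrow> real \<Rightarrow> (real \<Rightarrow> complex) \<Rightarrow> complex poly"
  assumes "\<alpha> > 0" and "\<tau> = 1 / \<alpha>" and "k \<ge> 2" and "1 \<le> q"
    and "regular_multilevel_partition M0 lam x"
    and "near_best_projectors k q A Proj"
    and "admissible_points k x \<xi>"
  shows "\<exists>c>0. \<forall>f\<in>besov_space x k q \<tau>.
           (\<exists>P\<in>Pi_poly k.
              (\<lambda>t. f t - poly_real P t) \<in> VMO \<and>
              has_sum_BMO
                (\<lambda>(m, j) t. b_coeff k Proj x \<xi> f m j * of_real (bspline (x m) (k - 1) j t))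
                (\<lambda>t. f t - poly_real P t)) \<and>
           (\<lambda>(m, j). norm (b_coeff k Proj x \<xi> f m j) powr \<tau>) summable_on UNIV \<and>
           (\<Sum>\<^sub>\<infinity>(m, j)\<in>UNIV. norm (b_coeff k Proj x \<xi> f m j) powr \<tau>) powr (1 / \<tau>)
             \<le> c * besov_norm x k q \<tau> f"
proof -
  define d where "d = k - 1"
  have k: "k = Suc d" and d: "d \<ge> 1" using assms(3) by (simp_all add: d_def)
  have \<tau>: "\<tau> > 0" using assms(1,2) by simp
  interpret quasi_interpolation x M0 lam \<xi> Proj q A d
    using assms(4-7) d unfolding k by unfold_locales
  have W: "besov_local x k q f (m, j) = W f m j" for f m j
    by (simp add: W_def k)
  have W': "(\<lambda>I. besov_local x k q f I powr \<tau>) = (\<lambda>(m, j). W f m j powr \<tau>)" for f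
    by (rule ext) (auto simp: W)
  obtain C where C: "C > 0" and bound: "\<forall>f. summable_W \<tau> f \<longrightarrow> (\<lambda>(m, j). norm (bq f m j) powr \<tau>) summable_on UNIV \<and>
     (\<Sum>\<^sub>\<infinity>(m, j)\<in>UNIV. norm (bq f m j) powr \<tau>) \<le> C * (\<Sum>\<^sub>\<infinity>(m, j)\<in>UNIV. W f m j powr \<tau>)"
    using bq_summable by blast
  have atom: "(\<lambda>(m, j) t. b_coeff k Proj x \<xi> f m j * of_real (bspline (x m) (k - 1) j t)) = atom f" for f
    by (auto simp: fun_eq_iff atom_def bq_def k)
  have b: "b_coeff k Proj x \<xi> f m j = bq f m j" for f m j by (simp add: bq_def k)
  show ?thesis
  proof (intro exI[of _ "C powr (1 / \<tau>)"] conjI ballI)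
    show "C powr (1 / \<tau>) > 0" using C by simp
    fix f assume "f \<in> besov_space x k q \<tau>"
    then have f: "summable_W \<tau> f" using \<tau> unfolding besov_space_def summable_W_def W' by simp
    show "\<exists>P\<in>Pi_poly k. (\<lambda>t. f t - poly_real P t) \<in> VMO \<and>
              has_sum_BMO
                (\<lambda>(m, j) t. b_coeff k Proj x \<xi> f m j * of_real (bspline (x m) (k - 1) j t))
                (\<lambda>t. f t - poly_real P t)"
      unfolding atom using decomposition[OF f] unfolding k .
    show "(\<lambda>(m, j). norm (b_coeff k Proj x \<xi> f m j) powr \<tau>) summable_on UNIV"
      unfolding b using bound f by blast
    have "(\<Sum>\<^sub>\<infinity>(m, j)\<in>UNIV. norm (bq f m j) powr \<tau>) powr (1 / \<tau>)
        \<le> (C * (\<Sum>\<^sub>\<infinity>(m, j)\<in>UNIV. W f m j powr \<tau>)) powr (1 / \<tau>)"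
      using bound f \<tau> by (intro powr_mono2 infsum_nonneg) auto
    also have "\<dots> = C powr (1 / \<tau>) * besov_norm x k q \<tau> f"
      unfolding besov_norm_def W' by (rule powr_mult)
    finally show "(\<Sum>\<^sub>\<infinity>(m, j)\<in>UNIV. norm (b_coeff k Proj x \<xi> f m j) powr \<tau>) powr (1 / \<tau>)
        \<le> C powr (1 / \<tau>) * besov_norm x k q \<tau> f"
      unfolding b .
  qed
qed

end
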